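(* Let $\lambda$ be an infinite cardinal and $(K,\preceq)$ an AEC with $\mathrm{LST}(K,\preceq)\le\lambda$. Suppose $K$ is categorical in $\lambda$, $\mathfrak{s}=(K,\preceq,S^{bs},\mathrm{nf})$ is a semi-good non-forking $\lambda$-frame satisfying the conjugation property, the class of uniqueness triples satisfies the existence property, $(K,\preceq)$ satisfies the amalgamation property in $\lambda^+$, and $(K,\preceq)$ satisfies the $(\lambda,\lambda^+)$-tameness for non-forking types property. Then for every two models $M,M^+\in K_{\lambda^+}$: $$M\preceq M^+\iff M\preceq^{NF}_{\lambda^+}M^+.$$
   Context: Conventions. $K_\mu$ is the class of models of $K$ of cardinality $\mu$. An embedding $f:M\to N$ is an isomorphism onto some $f[M]\preceq N$. For $M_0\preceq M_1,M_2$, an amalgamation of $M_1,M_2$ over $M_0$ is $(f_1,f_2,M_3)$ with $f_\ell:M_\ell\to M_3$ embeddings fixing $M_0$ pointwise. Galois types: $(M_0,M_1,a_1)E^*(M_0,M_2,a_2)$ iff some amalgamation $(f_1,f_2,M_3)$ over $M_0$ has $f_1(a_1)=f_2(a_2)$; $E$ is the transitive closure of $E^*$, and $\mathrm{tp}(a_1,M_0,M_1)=\mathrm{tp}(a_2,M_0,M_2)$ iff they are $E$-related; $S(M)$ is the set of types over $M$. Amalgamation property in $\lambda^+$: any $M_1,M_2\in K_{\lambda^+}$ $\preceq$-extending $M_0\in K_{\lambda^+}$ have an amalgamation over $M_0$. A filtration of $M\in K_{\lambda^+}$ is a $\preceq$-increasing continuous sequence $\langle M_\alpha:\alpha<\lambda^+\rangle$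 in $K_\lambda$, each $\preceq M$, with union $M$. Semi-good non-forking $\lambda$-frame $\mathfrak{s}=(K,\preceq,S^{bs},\mathrm{nf})$: (i) $(K_\lambda,\preceq)$ nonempty with joint embedding, amalgamation, no maximal model; (ii) for $M\in K_\lambda$, $S^{bs}(M)\subseteq S(M)$ a set of non-algebraic ("basic") types, isomorphism-invariant, with density (if $M\preceq N$ in $K_\lambda$, $M\ne N$, some $a\in N-M$ has basic type over $M$) and $|S^{bs}(M)|\le\lambda^+$; (iii) $\mathrm{nf}$ an isomorphism-invariant relation "$p$ does not fork over $M_0$" ($M_0\preceq M_1$ in $K_\lambda$, $p\in S^{bs}(M_1)$) with monotonicity (if $M_0\preceq M_0'\preceq M_1'\preceq M_1$ and $p$ does not fork over $M_0$ then $p\restriction M_1'$ is basic and does not fork over $M_0'$), local character (for increasing continuous $\langle M_\alpha:\alpha\le\delta\rangle$, $\delta$ limit, each $p\in S^{bs}(M_\delta)$ does not fork over some $M_\alpha$, $\alpha<\delta$), uniqueness (basic $p,q$ over $M_1$ not forking over $M_0$ with $p\restriction M_0=q\restriction M_0$ are equal), extension (each $p\in S^{bs}(M_0)$ has an extension in $S^{bs}(M_1)$ not forking over $M_0$, for $M_0\preceq M_1$), symmetry (if $M_0\preceq M_1\preceq M_2$, $a_1\in M_1-M_0$ with basic type over $M_0$, $a_2\in M_2-M_1$ with $\mathrm{tp}(a_2,M_1,M_2)$ not forking over $M_0$, then there are $M_1',M_3$ with $M_0\preceq M_1'\preceq M_3$, $M_2\preceq M_3$, $a_2\in M_1'$,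 $\mathrm{tp}(a_1,M_1',M_3)$ not forking over $M_0$), continuity (if $\langle M_\alpha:\alpha\le\delta\rangle$ is increasing continuous, $p\in S(M_\delta)$ and every $p\restriction M_\alpha$, $\alpha<\delta$, is basic and does not fork over $M_0$, then $p$ is basic and does not fork over $M_0$). Non-forking for larger models: for $M_0\preceq M_1\preceq M_2$ of cardinality $\ge\lambda$, $a\in M_2-M_1$, $\mathrm{tp}(a,M_1,M_2)$ does not fork over $M_0$ iff for some $N_0\in K_\lambda$, $N_0\preceq M_0$, every $N\in K_\lambda$ with $N_0\preceq N\preceq M_1$ has $\mathrm{tp}(a,N,M_2)$ basic and not forking over $N_0$. $(\lambda,\lambda^+)$-tameness for non-forking types: for all $M_0,M_1,M_2\in K_{\lambda^+}$ with $M_0\preceq M_1,M_2$ and $a_\ell\in M_\ell-M_0$: if for some $M_0^-\in K_\lambda$, $M_0^-\preceq M_0$, $\mathrm{tp}(a_1,M_0^-,M_1)=\mathrm{tp}(a_2,M_0^-,M_2)$ and both $\mathrm{tp}(a_\ell,M_0,M_\ell)$ do not fork over $M_0^-$, then $\mathrm{tp}(a_1,M_0,M_1)=\mathrm{tp}(a_2,M_0,M_2)$. Conjugation property: $K$ categorical in $\lambda$, and whenever $M_1\preceq M_2$ in $K_\lambda$, $p_1\in S^{bs}(M_1)$, $p_2\in S^{bs}(M_2)$ the non-forking extension of $p_1$, there is an isomorphism $f:M_1\to M_2$ with $f(p_1)=p_2$. Uniqueness triples: $(M,N,a)$ with $M\preceq N$ in $K_\lambda$, $a\in N-M$, $\mathrm{tp}(a,M,N)$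 basic, such that for every $M_1\in K_\lambda$ with $M\preceq M_1$ and all $N_1,N_2\in K_\lambda$ with $M_1\preceq N_\ell$ and embeddings $f_\ell:N\to N_\ell$ fixing $M$ with $\mathrm{tp}(f_\ell(a),M_1,N_\ell)$ not forking over $M$, there are $N^*$ and embeddings $g_\ell:N_\ell\to N^*$ with $g_1\restriction M_1=g_2\restriction M_1$, $g_1\circ f_1=g_2\circ f_2$. Existence property: every $p\in S^{bs}(M)$, $M\in K_\lambda$, equals $\mathrm{tp}(a,M,N)$ for some uniqueness triple $(M,N,a)$. $NF$: under these hypotheses there is (by earlier work) a unique $NF\subseteq{}^4K_\lambda$ satisfying: (a) $NF(M_0,M_1,M_2,M_3)$ implies $M_0\preceq M_\ell\preceq M_3$ and $M_1\cap M_2=M_0$; (b) monotonicity (shrinking $M_1,M_2$ to $N_\ell$ with $M_0\preceq N_\ell\preceq M_\ell$ and replacing $M_3$ by any $N_3\supseteq N_1,N_2$ having a common $\preceq$-extension with $M_3$); (c) extension (if $N_0\preceq N_1,N_2$ in $K_\lambda$ with $N_1\cap N_2=N_0$ then $NF(N_0,N_1,N_2,N_3)$ for some $N_3$); (d) weak uniqueness (two such $N_3$'s jointly embed over $N_1\cup N_2$); (e) symmetry in the middle arguments; (f) long transitivity along increasing continuous chains; (g) isomorphism invariance; and respecting $\mathfrak{s}$ (if $NF(M_0,M_1,M_2,M_3)$, $a\in M_1-M_0$ with basic type over $M_0$, then $\mathrm{tp}(a,M_2,M_3)$ does not fork over $M_0$). $\widehat{NF}(N_0,N_1,M_0,M_1)$: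 $N_\ell\in K_\lambda$, $M_\ell\in K_{\lambda^+}$, and there are filtrations $\langle N_{0,\alpha}\rangle,\langle N_{1,\alpha}\rangle$ of $M_0,M_1$ with $N_{0,0}=N_0,N_{1,0}=N_1$ and $NF(N_{0,\alpha},N_{1,\alpha},N_{0,\alpha+1},N_{1,\alpha+1})$ for all $\alpha$. $M_0\preceq^{NF}_{\lambda^+}M_1$ means $M_0\preceq M_1$ in $K_{\lambda^+}$ and $\widehat{NF}(N_0,N_1,M_0,M_1)$ for some $N_0,N_1\in K_\lambda$. *)

theory Defs
  imports Main
begin

unbundle cardinal_syntax

section \<open>Structures\<close>

record ('f, 'r) vocabulary =
  Funs :: "'f set"
  Rels :: "'r set"
  farity :: "'f \<Rightarrow> nat"
  rarity :: "'r \<Rightarrow> nat"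

record ('a, 'f, 'r) struct =
  univ :: "'a set"
  fint :: "'f \<Rightarrow> 'a list \<Rightarrow> 'a"
  rint :: "'r \<Rightarrow> 'a list \<Rightarrow> bool"

text \<open>Interpretations take fixed default values outside their domain, so that two structures
  for the same vocabulary are equal as HOL values iff they are equal as structures.\<close>

definition is_struct :: "('f, 'r) vocabulary \<Rightarrow> ('a, 'f, 'r) struct \<Rightarrow> bool" where
  "is_struct V M \<longleftrightarrow>
     univ M \<noteq> {} \<and>
     (\<forall>F xs. if F \<in> Funs V \<and> length xs = farity V F \<and> set xs \<subseteq> univ M
             then fint M F xs \<in> univ M else fint M F xs = undefined) \<and>
     (\<forall>R xs. rint M R xs \<longrightarrow> R \<in> Rels V \<and> length xs = rarity V R \<and> set xs \<subseteq> univ M)"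

definition substructure ::
    "('f, 'r) vocabulary \<Rightarrow> ('a, 'f, 'r) struct \<Rightarrow> ('a, 'f, 'r) struct \<Rightarrow> bool" where
  "substructure V M N \<longleftrightarrow>
     is_struct V M \<and> is_struct V N \<and> univ M \<subseteq> univ N \<and>
     (\<forall>F\<in>Funs V. \<forall>xs. length xs = farity V F \<and> set xs \<subseteq> univ M \<longrightarrow> fint M F xs = fint N F xs) \<and>
     (\<forall>R\<in>Rels V. \<forall>xs. length xs = rarity V R \<and> set xs \<subseteq> univ M \<longrightarrow> rint M R xs = rint N R xs)"

text \<open>Maps between structures are total functions of which only the values on the universe of the
  source matter.\<close>

definition is_iso ::
    "('f, 'r) vocabulary \<Rightarrow> ('a \<Rightarrow> 'a) \<Rightarrow> ('a, 'f, 'r) struct \<Rightarrow> ('a, 'f, 'r) struct \<Rightarrow> bool" where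
  "is_iso V f M N \<longleftrightarrow>
     is_struct V M \<and> is_struct V N \<and> bij_betw f (univ M) (univ N) \<and>
     (\<forall>F\<in>Funs V. \<forall>xs. length xs = farity V F \<and> set xs \<subseteq> univ M \<longrightarrow>
        f (fint M F xs) = fint N F (map f xs)) \<and>
     (\<forall>R\<in>Rels V. \<forall>xs. length xs = rarity V R \<and> set xs \<subseteq> univ M \<longrightarrow>
        rint M R xs = rint N R (map f xs))"

text \<open>For a nonempty chain \<open>C\<close> of structures there is exactly one such \<open>U\<close>, because every tuple
  from the union of the universes already lies in a member of \<open>C\<close>.\<close>

definition is_union ::
    "('f, 'r) vocabulary \<Rightarrow> ('a, 'f, 'r) struct \<Rightarrow> ('a, 'f, 'r) struct set \<Rightarrow> bool" where
  "is_union V U C \<longleftrightarrow>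
     is_struct V U \<and> univ U = (\<Union>M\<in>C. univ M) \<and> (\<forall>M\<in>C. substructure V M U)"


section \<open>Ordinal-indexed chains\<close>

text \<open>The ordinals below the order type of a well-order \<open>r\<close> are represented by the elements of
  \<open>Field r\<close>, so those below \<open>\<lambda>\<^sup>+\<close> by the elements of \<open>Field (cardSuc lam)\<close>.\<close>

abbreviation ozero :: "'i rel \<Rightarrow> 'i" where
  "ozero r \<equiv> wo_rel.minim r (Field r)"

abbreviation osuc :: "'i rel \<Rightarrow> 'i \<Rightarrow> 'i" where
  "osuc r i \<equiv> wo_rel.suc r {i}"

definition is_limit :: "'i rel \<Rightarrow> 'i \<Rightarrow> bool" where
  "is_limit r d \<longleftrightarrow>
     d \<in> Field r \<and> underS r d \<noteq> {} \<and> (\<forall>i\<in>underS r d. \<exists>j\<in>underS r d. i \<noteq> j \<and> (i, j) \<in> r)"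

record ('a, 'f, 'r) aec =
  voc :: "('f, 'r) vocabulary"
  models :: "('a, 'f, 'r) struct set"
  le :: "('a, 'f, 'r) struct \<Rightarrow> ('a, 'f, 'r) struct \<Rightarrow> bool"

abbreviation strong_sub ::
    "('a, 'f, 'r) struct \<Rightarrow> ('a, 'f, 'r, 'z) aec_scheme \<Rightarrow> ('a, 'f, 'r) struct \<Rightarrow> bool"
    ("_ \<preceq>\<^bsub>_\<^esub> _" [51, 0, 51] 50) where
  "M \<preceq>\<^bsub>K\<^esub> N \<equiv> le K M N"

text \<open>The index set \<open>I\<close> is meant to be an initial segment of the well-order \<open>r\<close>.
  The case \<open>i = j\<close> makes every member of the chain a model.\<close>

definition inc_cont ::
    "('a, 'f, 'r) aec \<Rightarrow> 'i rel \<Rightarrow> 'i set \<Rightarrow> ('i \<Rightarrow> ('a, 'f, 'r) struct) \<Rightarrow> bool" where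
  "inc_cont K r I M \<longleftrightarrow>
     (\<forall>j\<in>I. \<forall>i\<in>under r j. M i \<preceq>\<^bsub>K\<^esub> M j) \<and>
     (\<forall>j\<in>I. is_limit r j \<longrightarrow> is_union (voc K) (M j) (M ` underS r j))"


section \<open>Abstract elementary classes\<close>

text \<open>A class of models is represented by its members whose universe is a set of elements of the
  type \<open>'a\<close>.  A strictly increasing ordinal-indexed chain of such models has length below
  \<open>|'a|\<^sup>+\<close>, so well-orders on \<open>'a\<close> provide all the index sets needed in the chain axioms.
  Statements about models of cardinality at most \<open>\<lambda>\<^sup>+\<close> carry the proviso
  \<open>\<lambda>\<^sup>+ < |UNIV :: 'a set|\<close>: it leaves room inside \<open>'a\<close> for extensions, amalgamations and
  isomorphic copies of such models, as there is in the proper class of all models.\<close>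

definition LS_property :: "('a, 'f, 'r) aec \<Rightarrow> 'c rel \<Rightarrow> bool" where
  "LS_property K kappa \<longleftrightarrow>
     (\<forall>M\<in>models K. \<forall>A\<subseteq>univ M. \<exists>N. N \<preceq>\<^bsub>K\<^esub> M \<and> A \<subseteq> univ N \<and> |univ N| \<le>o kappa +c |A| )"

text \<open>\<open>LST(K) \<le> lam\<close>: the least cardinal with the Loewenheim-Skolem-Tarski property exists and is
  at most \<open>lam\<close>.\<close>

definition LST_le :: "('a, 'f, 'r) aec \<Rightarrow> 'c rel \<Rightarrow> bool" where
  "LST_le K lam \<longleftrightarrow> (\<exists>kappa :: 'c rel. Card_order kappa \<and> kappa \<le>o lam \<and> LS_property K kappa)"

locale abstract_elementary_class =
  fixes K :: "('a, 'f, 'r) aec"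
  assumes models_struct: "M \<in> models K \<Longrightarrow> is_struct (voc K) M"
    and le_models: "M \<preceq>\<^bsub>K\<^esub> N \<Longrightarrow> M \<in> models K \<and> N \<in> models K"
    and models_iso: "M \<in> models K \<Longrightarrow> is_iso (voc K) f M M' \<Longrightarrow> M' \<in> models K"
    and le_iso: "M \<preceq>\<^bsub>K\<^esub> N \<Longrightarrow> is_iso (voc K) f N N' \<Longrightarrow> is_iso (voc K) f M M' \<Longrightarrow> M' \<preceq>\<^bsub>K\<^esub> N'"
    and le_refl: "M \<in> models K \<Longrightarrow> M \<preceq>\<^bsub>K\<^esub> M"
    and le_trans: "M \<preceq>\<^bsub>K\<^esub> N \<Longrightarrow> N \<preceq>\<^bsub>K\<^esub> P \<Longrightarrow> M \<preceq>\<^bsub>K\<^esub> P"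
    and le_substructure: "M \<preceq>\<^bsub>K\<^esub> N \<Longrightarrow> substructure (voc K) M N"
    and coherence:
      "substructure (voc K) M0 M1 \<Longrightarrow> M0 \<preceq>\<^bsub>K\<^esub> M2 \<Longrightarrow> M1 \<preceq>\<^bsub>K\<^esub> M2 \<Longrightarrow> M0 \<preceq>\<^bsub>K\<^esub> M1"
    and chain_union:
      "\<And>(r :: 'a rel) M U i. Well_order r \<Longrightarrow> inc_cont K r (Field r) M \<Longrightarrow>
         is_union (voc K) U (M ` Field r) \<Longrightarrow> i \<in> Field r \<Longrightarrow> M i \<preceq>\<^bsub>K\<^esub> U"
    and smoothness:
      "\<And>(r :: 'a rel) M U N. Well_order r \<Longrightarrow> Field r \<noteq> {} \<Longrightarrow> inc_cont K r (Field r) M \<Longrightarrow>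
         is_union (voc K) U (M ` Field r) \<Longrightarrow> (\<And>i. i \<in> Field r \<Longrightarrow> M i \<preceq>\<^bsub>K\<^esub> N) \<Longrightarrow> U \<preceq>\<^bsub>K\<^esub> N"
    and LST_exists: "\<exists>kappa :: 'a rel. Card_order kappa \<and> LS_property K kappa"

definition models_card :: "('a, 'f, 'r) aec \<Rightarrow> 'c rel \<Rightarrow> ('a, 'f, 'r) struct set" where
  "models_card K mu = {M \<in> models K. |univ M| =o mu}"

definition categorical :: "('a, 'f, 'r) aec \<Rightarrow> 'c rel \<Rightarrow> bool" where
  "categorical K mu \<longleftrightarrow>
     models_card K mu \<noteq> {} \<and>
     (\<forall>M\<in>models_card K mu. \<forall>N\<in>models_card K mu. \<exists>f. is_iso (voc K) f M N)"

definition is_embedding ::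
    "('a, 'f, 'r) aec \<Rightarrow> ('a \<Rightarrow> 'a) \<Rightarrow> ('a, 'f, 'r) struct \<Rightarrow> ('a, 'f, 'r) struct \<Rightarrow> bool" where
  "is_embedding K f M N \<longleftrightarrow> (\<exists>M'. is_iso (voc K) f M M' \<and> M' \<preceq>\<^bsub>K\<^esub> N)"

definition is_amalgamation ::
    "('a, 'f, 'r) aec \<Rightarrow> ('a, 'f, 'r) struct \<Rightarrow> ('a, 'f, 'r) struct \<Rightarrow> ('a, 'f, 'r) struct \<Rightarrow>
     ('a \<Rightarrow> 'a) \<Rightarrow> ('a \<Rightarrow> 'a) \<Rightarrow> ('a, 'f, 'r) struct \<Rightarrow> bool" where
  "is_amalgamation K M0 M1 M2 f1 f2 M3 \<longleftrightarrow>
     is_embedding K f1 M1 M3 \<and> is_embedding K f2 M2 M3 \<and>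
     (\<forall>x\<in>univ M0. f1 x = x \<and> f2 x = x)"

definition amalgamation_property :: "('a, 'f, 'r) aec \<Rightarrow> 'c rel \<Rightarrow> bool" where
  "amalgamation_property K mu \<longleftrightarrow>
     (\<forall>M0\<in>models_card K mu. \<forall>M1\<in>models_card K mu. \<forall>M2\<in>models_card K mu.
        M0 \<preceq>\<^bsub>K\<^esub> M1 \<longrightarrow> M0 \<preceq>\<^bsub>K\<^esub> M2 \<longrightarrow> (\<exists>f1 f2 M3. is_amalgamation K M0 M1 M2 f1 f2 M3))"


section \<open>Galois types\<close>

type_synonym ('a, 'f, 'r) triple = "('a, 'f, 'r) struct \<times> ('a, 'f, 'r) struct \<times> 'a"
type_synonym ('a, 'f, 'r) gtype = "('a, 'f, 'r) triple set"

definition E_star :: "('a, 'f, 'r) aec \<Rightarrow> ('a, 'f, 'r) triple rel" where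
  "E_star K = {((M0, M1, a1), (M0, M2, a2)) | M0 M1 M2 a1 a2.
     M0 \<preceq>\<^bsub>K\<^esub> M1 \<and> M0 \<preceq>\<^bsub>K\<^esub> M2 \<and> a1 \<in> univ M1 \<and> a2 \<in> univ M2 \<and>
     (\<exists>f1 f2 M3. is_amalgamation K M0 M1 M2 f1 f2 M3 \<and> f1 a1 = f2 a2)}"

text \<open>\<open>tp K a M N\<close> is \<open>tp(a, M, N)\<close>, as the set of triples that represent it.\<close>

definition tp ::
    "('a, 'f, 'r) aec \<Rightarrow> 'a \<Rightarrow> ('a, 'f, 'r) struct \<Rightarrow> ('a, 'f, 'r) struct \<Rightarrow> ('a, 'f, 'r) gtype" where
  "tp K a M N = (E_star K)\<^sup>+ `` {(M, N, a)}"

definition types_over :: "('a, 'f, 'r) aec \<Rightarrow> ('a, 'f, 'r) struct \<Rightarrow> ('a, 'f, 'r) gtype set" where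
  "types_over K M = {tp K a M N | a N. M \<preceq>\<^bsub>K\<^esub> N \<and> a \<in> univ N}"

definition nonalgebraic_types ::
    "('a, 'f, 'r) aec \<Rightarrow> ('a, 'f, 'r) struct \<Rightarrow> ('a, 'f, 'r) gtype set" where
  "nonalgebraic_types K M = {tp K a M N | a N. M \<preceq>\<^bsub>K\<^esub> N \<and> a \<in> univ N - univ M}"

text \<open>Restriction of a type to a smaller model \<open>M0\<close>: all the representatives \<open>(M, N, a)\<close> of \<open>p\<close>
  give the same class \<open>tp(a, M0, N)\<close>, so the union below is that class.\<close>

definition restrict_type ::
    "('a, 'f, 'r) aec \<Rightarrow> ('a, 'f, 'r) gtype \<Rightarrow> ('a, 'f, 'r) struct \<Rightarrow> ('a, 'f, 'r) gtype" where
  "restrict_type K p M0 = (\<Union>(M, N, a)\<in>p. tp K a M0 N)"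

text \<open>The image \<open>f(p)\<close> of a type \<open>p = tp(a, M, N)\<close> under an isomorphism \<open>f : M \<rightarrow> M'\<close> is
  \<open>tp(g a, M', N')\<close> for any isomorphism \<open>g : N \<rightarrow> N'\<close> extending \<open>f\<close>; again all
  choices of the representative and of \<open>g\<close> give the same class.\<close>

definition image_type ::
    "('a, 'f, 'r) aec \<Rightarrow> ('a \<Rightarrow> 'a) \<Rightarrow> ('a, 'f, 'r) struct \<Rightarrow> ('a, 'f, 'r) gtype \<Rightarrow> ('a, 'f, 'r) gtype" where
  "image_type K f M' p =
     \<Union>{tp K (g a) M' N' | M N a g N'.
         (M, N, a) \<in> p \<and> is_iso (voc K) g N N' \<and> (\<forall>x\<in>univ M. g x = f x)}"


section \<open>Semi-good frames\<close>

text \<open>\<open>nf p M0 M1\<close> means that the basic type \<open>p\<close> over \<open>M1\<close> does not fork over \<open>M0\<close>.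
  Limit ordinals in the chain axioms range over the limit ordinals below \<open>\<lambda>\<^sup>+\<close>.\<close>

locale semi_good_frame =
  fixes K :: "('a, 'f, 'r) aec"
    and lam :: "'c rel"
    and Sbs :: "('a, 'f, 'r) struct \<Rightarrow> ('a, 'f, 'r) gtype set"
    and nf :: "('a, 'f, 'r) gtype \<Rightarrow> ('a, 'f, 'r) struct \<Rightarrow> ('a, 'f, 'r) struct \<Rightarrow> bool"
  assumes nonempty: "models_card K lam \<noteq> {}"
    and joint_embedding:
      "M1 \<in> models_card K lam \<Longrightarrow> M2 \<in> models_card K lam \<Longrightarrow>
         \<exists>M3\<in>models_card K lam. \<exists>f1 f2. is_embedding K f1 M1 M3 \<and> is_embedding K f2 M2 M3"
    and amalgamation: "amalgamation_property K lam"
    and no_maximal: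
      "M \<in> models_card K lam \<Longrightarrow> \<exists>N\<in>models_card K lam. M \<preceq>\<^bsub>K\<^esub> N \<and> M \<noteq> N"
    and basic_nonalgebraic:
      "M \<in> models_card K lam \<Longrightarrow> Sbs M \<subseteq> nonalgebraic_types K M"
    and basic_iso:
      "M \<in> models_card K lam \<Longrightarrow> is_iso (voc K) f M M' \<Longrightarrow> p \<in> Sbs M \<Longrightarrow> image_type K f M' p \<in> Sbs M'"
    and density:
      "M \<in> models_card K lam \<Longrightarrow> N \<in> models_card K lam \<Longrightarrow> M \<preceq>\<^bsub>K\<^esub> N \<Longrightarrow> M \<noteq> N \<Longrightarrow>
         \<exists>a\<in>univ N - univ M. tp K a M N \<in> Sbs M"
    and few_basic: "M \<in> models_card K lam \<Longrightarrow> |Sbs M| \<le>o cardSuc lam"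
    and nf_basic:
      "nf p M0 M1 \<Longrightarrow>
         M0 \<in> models_card K lam \<and> M1 \<in> models_card K lam \<and> M0 \<preceq>\<^bsub>K\<^esub> M1 \<and> p \<in> Sbs M1"
    and nf_iso:
      "nf p M0 M1 \<Longrightarrow> is_iso (voc K) f M1 M1' \<Longrightarrow> is_iso (voc K) f M0 M0' \<Longrightarrow>
         nf (image_type K f M1' p) M0' M1'"
    and nf_monotonicity:
      "nf p M0 M1 \<Longrightarrow> M0' \<in> models_card K lam \<Longrightarrow> M1' \<in> models_card K lam \<Longrightarrow>
         M0 \<preceq>\<^bsub>K\<^esub> M0' \<Longrightarrow> M0' \<preceq>\<^bsub>K\<^esub> M1' \<Longrightarrow> M1' \<preceq>\<^bsub>K\<^esub> M1 \<Longrightarrow>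
         restrict_type K p M1' \<in> Sbs M1' \<and> nf (restrict_type K p M1') M0' M1'"
    and local_character:
      "is_limit (cardSuc lam) d \<Longrightarrow> inc_cont K (cardSuc lam) (under (cardSuc lam) d) C \<Longrightarrow>
         (\<And>i. i \<in> under (cardSuc lam) d \<Longrightarrow> C i \<in> models_card K lam) \<Longrightarrow>
         p \<in> Sbs (C d) \<Longrightarrow> \<exists>i\<in>underS (cardSuc lam) d. nf p (C i) (C d)"
    and nf_uniqueness:
      "nf p M0 M1 \<Longrightarrow> nf q M0 M1 \<Longrightarrow> restrict_type K p M0 = restrict_type K q M0 \<Longrightarrow> p = q"
    and nf_extension:
      "M0 \<in> models_card K lam \<Longrightarrow> M1 \<in> models_card K lam \<Longrightarrow> M0 \<preceq>\<^bsub>K\<^esub> M1 \<Longrightarrow> p \<in> Sbs M0 \<Longrightarrow>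
         \<exists>q\<in>Sbs M1. restrict_type K q M0 = p \<and> nf q M0 M1"
    and nf_symmetry:
      "M0 \<in> models_card K lam \<Longrightarrow> M1 \<in> models_card K lam \<Longrightarrow> M2 \<in> models_card K lam \<Longrightarrow>
         M0 \<preceq>\<^bsub>K\<^esub> M1 \<Longrightarrow> M1 \<preceq>\<^bsub>K\<^esub> M2 \<Longrightarrow>
         a1 \<in> univ M1 - univ M0 \<Longrightarrow> tp K a1 M0 M1 \<in> Sbs M0 \<Longrightarrow>
         a2 \<in> univ M2 - univ M1 \<Longrightarrow> nf (tp K a2 M1 M2) M0 M1 \<Longrightarrow>
         \<exists>M1'\<in>models_card K lam. \<exists>M3\<in>models_card K lam.
           M0 \<preceq>\<^bsub>K\<^esub> M1' \<and> M1' \<preceq>\<^bsub>K\<^esub> M3 \<and> M2 \<preceq>\<^bsub>K\<^esub> M3 \<and> a2 \<in> univ M1' \<and> nf (tp K a1 M1' M3) M0 M1'"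
    and nf_continuity:
      "is_limit (cardSuc lam) d \<Longrightarrow> inc_cont K (cardSuc lam) (under (cardSuc lam) d) C \<Longrightarrow>
         (\<And>i. i \<in> under (cardSuc lam) d \<Longrightarrow> C i \<in> models_card K lam) \<Longrightarrow>
         p \<in> types_over K (C d) \<Longrightarrow>
         (\<And>i. i \<in> underS (cardSuc lam) d \<Longrightarrow>
            restrict_type K p (C i) \<in> Sbs (C i) \<and>
            nf (restrict_type K p (C i)) (C (ozero (cardSuc lam))) (C i)) \<Longrightarrow>
         p \<in> Sbs (C d) \<and> nf p (C (ozero (cardSuc lam))) (C d)"

definition conjugation_property ::
    "('a, 'f, 'r) aec \<Rightarrow> 'c rel \<Rightarrow> (('a, 'f, 'r) struct \<Rightarrow> ('a, 'f, 'r) gtype set) \<Rightarrow>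
     (('a, 'f, 'r) gtype \<Rightarrow> ('a, 'f, 'r) struct \<Rightarrow> ('a, 'f, 'r) struct \<Rightarrow> bool) \<Rightarrow> bool" where
  "conjugation_property K lam Sbs nf \<longleftrightarrow>
     categorical K lam \<and>
     (\<forall>M1\<in>models_card K lam. \<forall>M2\<in>models_card K lam. \<forall>p1\<in>Sbs M1. \<forall>p2\<in>Sbs M2.
        M1 \<preceq>\<^bsub>K\<^esub> M2 \<longrightarrow> nf p2 M1 M2 \<longrightarrow> restrict_type K p2 M1 = p1 \<longrightarrow>
        (\<exists>f. is_iso (voc K) f M1 M2 \<and> image_type K f M2 p1 = p2))"

definition uniqueness_triple ::
    "('a, 'f, 'r) aec \<Rightarrow> 'c rel \<Rightarrow> (('a, 'f, 'r) struct \<Rightarrow> ('a, 'f, 'r) gtype set) \<Rightarrow>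
     (('a, 'f, 'r) gtype \<Rightarrow> ('a, 'f, 'r) struct \<Rightarrow> ('a, 'f, 'r) struct \<Rightarrow> bool) \<Rightarrow>
     ('a, 'f, 'r) struct \<Rightarrow> ('a, 'f, 'r) struct \<Rightarrow> 'a \<Rightarrow> bool" where
  "uniqueness_triple K lam Sbs nf M N a \<longleftrightarrow>
     M \<in> models_card K lam \<and> N \<in> models_card K lam \<and> M \<preceq>\<^bsub>K\<^esub> N \<and> a \<in> univ N - univ M \<and>
     tp K a M N \<in> Sbs M \<and>
     (\<forall>M1\<in>models_card K lam. \<forall>N1\<in>models_card K lam. \<forall>N2\<in>models_card K lam. \<forall>f1 f2.
        M \<preceq>\<^bsub>K\<^esub> M1 \<longrightarrow> M1 \<preceq>\<^bsub>K\<^esub> N1 \<longrightarrow> M1 \<preceq>\<^bsub>K\<^esub> N2 \<longrightarrow>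
        is_embedding K f1 N N1 \<longrightarrow> is_embedding K f2 N N2 \<longrightarrow>
        (\<forall>x\<in>univ M. f1 x = x \<and> f2 x = x) \<longrightarrow>
        nf (tp K (f1 a) M1 N1) M M1 \<longrightarrow> nf (tp K (f2 a) M1 N2) M M1 \<longrightarrow>
        (\<exists>N' g1 g2. is_embedding K g1 N1 N' \<and> is_embedding K g2 N2 N' \<and>
           (\<forall>x\<in>univ M1. g1 x = g2 x) \<and> (\<forall>x\<in>univ N. g1 (f1 x) = g2 (f2 x))))"

definition uniqueness_triples_exist ::
    "('a, 'f, 'r) aec \<Rightarrow> 'c rel \<Rightarrow> (('a, 'f, 'r) struct \<Rightarrow> ('a, 'f, 'r) gtype set) \<Rightarrow>
     (('a, 'f, 'r) gtype \<Rightarrow> ('a, 'f, 'r) struct \<Rightarrow> ('a, 'f, 'r) struct \<Rightarrow> bool) \<Rightarrow> bool" where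
  "uniqueness_triples_exist K lam Sbs nf \<longleftrightarrow>
     (\<forall>M\<in>models_card K lam. \<forall>p\<in>Sbs M.
        \<exists>N a. uniqueness_triple K lam Sbs nf M N a \<and> p = tp K a M N)"

text \<open>\<open>nf_large K lam Sbs nf a M0 M1 M2\<close>: the type \<open>tp(a, M1, M2)\<close>, over a model of any cardinality
  at least \<open>\<lambda>\<close>, does not fork over \<open>M0\<close>.\<close>

definition nf_large ::
    "('a, 'f, 'r) aec \<Rightarrow> 'c rel \<Rightarrow> (('a, 'f, 'r) struct \<Rightarrow> ('a, 'f, 'r) gtype set) \<Rightarrow>
     (('a, 'f, 'r) gtype \<Rightarrow> ('a, 'f, 'r) struct \<Rightarrow> ('a, 'f, 'r) struct \<Rightarrow> bool) \<Rightarrow>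
     'a \<Rightarrow> ('a, 'f, 'r) struct \<Rightarrow> ('a, 'f, 'r) struct \<Rightarrow> ('a, 'f, 'r) struct \<Rightarrow> bool" where
  "nf_large K lam Sbs nf a M0 M1 M2 \<longleftrightarrow>
     lam \<le>o |univ M0| \<and> M0 \<preceq>\<^bsub>K\<^esub> M1 \<and> M1 \<preceq>\<^bsub>K\<^esub> M2 \<and> a \<in> univ M2 - univ M1 \<and>
     (\<exists>N0\<in>models_card K lam. N0 \<preceq>\<^bsub>K\<^esub> M0 \<and>
        (\<forall>N\<in>models_card K lam. N0 \<preceq>\<^bsub>K\<^esub> N \<longrightarrow> N \<preceq>\<^bsub>K\<^esub> M1 \<longrightarrow>
           tp K a N M2 \<in> Sbs N \<and> nf (tp K a N M2) N0 N))"

definition tame_nonforking ::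
    "('a, 'f, 'r) aec \<Rightarrow> 'c rel \<Rightarrow> (('a, 'f, 'r) struct \<Rightarrow> ('a, 'f, 'r) gtype set) \<Rightarrow>
     (('a, 'f, 'r) gtype \<Rightarrow> ('a, 'f, 'r) struct \<Rightarrow> ('a, 'f, 'r) struct \<Rightarrow> bool) \<Rightarrow> bool" where
  "tame_nonforking K lam Sbs nf \<longleftrightarrow>
     (\<forall>M0\<in>models_card K (cardSuc lam). \<forall>M1\<in>models_card K (cardSuc lam).
      \<forall>M2\<in>models_card K (cardSuc lam). \<forall>a1\<in>univ M1 - univ M0. \<forall>a2\<in>univ M2 - univ M0.
        M0 \<preceq>\<^bsub>K\<^esub> M1 \<longrightarrow> M0 \<preceq>\<^bsub>K\<^esub> M2 \<longrightarrow>
        (\<exists>M\<in>models_card K lam. M \<preceq>\<^bsub>K\<^esub> M0 \<and> tp K a1 M M1 = tp K a2 M M2 \<and>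
           nf_large K lam Sbs nf a1 M M0 M1 \<and> nf_large K lam Sbs nf a2 M M0 M2) \<longrightarrow>
        tp K a1 M0 M1 = tp K a2 M0 M2)"


section \<open>Non-forking amalgamation and the relation it induces on models of size \<open>\<lambda>\<^sup>+\<close>\<close>

text \<open>The chains in long transitivity have the form \<open>\<langle>M\<^sub>i : i \<le> d\<rangle>\<close> with \<open>0 < d < \<lambda>\<^sup>+\<close>; for
  \<open>d = 0\<close> the hypothesis would be void.\<close>

locale nonforking_amalgamation =
  fixes K :: "('a, 'f, 'r) aec"
    and lam :: "'c rel"
    and Sbs :: "('a, 'f, 'r) struct \<Rightarrow> ('a, 'f, 'r) gtype set"
    and nf :: "('a, 'f, 'r) gtype \<Rightarrow> ('a, 'f, 'r) struct \<Rightarrow> ('a, 'f, 'r) struct \<Rightarrow> bool"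
    and NF :: "('a, 'f, 'r) struct \<Rightarrow> ('a, 'f, 'r) struct \<Rightarrow> ('a, 'f, 'r) struct \<Rightarrow>
               ('a, 'f, 'r) struct \<Rightarrow> bool"
  assumes NF_models:
      "NF M0 M1 M2 M3 \<Longrightarrow> {M0, M1, M2, M3} \<subseteq> models_card K lam"
    and NF_disjoint:
      "NF M0 M1 M2 M3 \<Longrightarrow>
         M0 \<preceq>\<^bsub>K\<^esub> M1 \<and> M0 \<preceq>\<^bsub>K\<^esub> M2 \<and> M1 \<preceq>\<^bsub>K\<^esub> M3 \<and> M2 \<preceq>\<^bsub>K\<^esub> M3 \<and> univ M1 \<inter> univ M2 = univ M0"
    and NF_monotonicity:
      "NF M0 M1 M2 M3 \<Longrightarrow> {N1, N2, N3, P} \<subseteq> models_card K lam \<Longrightarrow>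
         M0 \<preceq>\<^bsub>K\<^esub> N1 \<Longrightarrow> N1 \<preceq>\<^bsub>K\<^esub> M1 \<Longrightarrow> M0 \<preceq>\<^bsub>K\<^esub> N2 \<Longrightarrow> N2 \<preceq>\<^bsub>K\<^esub> M2 \<Longrightarrow>
         univ N1 \<union> univ N2 \<subseteq> univ N3 \<Longrightarrow> M3 \<preceq>\<^bsub>K\<^esub> P \<Longrightarrow> N3 \<preceq>\<^bsub>K\<^esub> P \<Longrightarrow> NF M0 N1 N2 N3"
    and NF_extension:
      "{N0, N1, N2} \<subseteq> models_card K lam \<Longrightarrow> N0 \<preceq>\<^bsub>K\<^esub> N1 \<Longrightarrow> N0 \<preceq>\<^bsub>K\<^esub> N2 \<Longrightarrow>
         univ N1 \<inter> univ N2 = univ N0 \<Longrightarrow> \<exists>N3. NF N0 N1 N2 N3"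
    and NF_weak_uniqueness:
      "NF N0 N1 N2 N3 \<Longrightarrow> NF N0 N1 N2 N3' \<Longrightarrow>
         \<exists>P f f'. is_embedding K f N3 P \<and> is_embedding K f' N3' P \<and>
           (\<forall>x\<in>univ N1 \<union> univ N2. f x = x \<and> f' x = x)"
    and NF_symmetry: "NF N0 N1 N2 N3 \<Longrightarrow> NF N0 N2 N1 N3"
    and NF_long_transitivity:
      "d \<in> Field (cardSuc lam) \<Longrightarrow> underS (cardSuc lam) d \<noteq> {} \<Longrightarrow>
         inc_cont K (cardSuc lam) (under (cardSuc lam) d) A \<Longrightarrow>
         inc_cont K (cardSuc lam) (under (cardSuc lam) d) B \<Longrightarrow>
         (\<And>i. i \<in> under (cardSuc lam) d \<Longrightarrow> A i \<in> models_card K lam \<and> B i \<in> models_card K lam) \<Longrightarrow>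
         (\<And>i. i \<in> underS (cardSuc lam) d \<Longrightarrow>
            NF (A i) (A (osuc (cardSuc lam) i)) (B i) (B (osuc (cardSuc lam) i))) \<Longrightarrow>
         NF (A (ozero (cardSuc lam))) (A d) (B (ozero (cardSuc lam))) (B d)"
    and NF_iso:
      "NF M0 M1 M2 M3 \<Longrightarrow> is_iso (voc K) f M0 M0' \<Longrightarrow> is_iso (voc K) f M1 M1' \<Longrightarrow>
         is_iso (voc K) f M2 M2' \<Longrightarrow> is_iso (voc K) f M3 M3' \<Longrightarrow> NF M0' M1' M2' M3'"
    and NF_respects_frame:
      "NF M0 M1 M2 M3 \<Longrightarrow> a \<in> univ M1 - univ M0 \<Longrightarrow> tp K a M0 M1 \<in> Sbs M0 \<Longrightarrow>
         nf (tp K a M2 M3) M0 M2"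

definition is_filtration ::
    "('a, 'f, 'r) aec \<Rightarrow> 'c rel \<Rightarrow> ('c set \<Rightarrow> ('a, 'f, 'r) struct) \<Rightarrow> ('a, 'f, 'r) struct \<Rightarrow> bool" where
  "is_filtration K lam N M \<longleftrightarrow>
     inc_cont K (cardSuc lam) (Field (cardSuc lam)) N \<and>
     (\<forall>i\<in>Field (cardSuc lam). N i \<in> models_card K lam \<and> N i \<preceq>\<^bsub>K\<^esub> M) \<and>
     is_union (voc K) M (N ` Field (cardSuc lam))"

definition NF_hat ::
    "('a, 'f, 'r) aec \<Rightarrow> 'c rel \<Rightarrow>
     (('a, 'f, 'r) struct \<Rightarrow> ('a, 'f, 'r) struct \<Rightarrow> ('a, 'f, 'r) struct \<Rightarrow> ('a, 'f, 'r) struct \<Rightarrow> bool) \<Rightarrow>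
     ('a, 'f, 'r) struct \<Rightarrow> ('a, 'f, 'r) struct \<Rightarrow> ('a, 'f, 'r) struct \<Rightarrow> ('a, 'f, 'r) struct \<Rightarrow> bool" where
  "NF_hat K lam NF N0 N1 M0 M1 \<longleftrightarrow>
     {N0, N1} \<subseteq> models_card K lam \<and> {M0, M1} \<subseteq> models_card K (cardSuc lam) \<and>
     (\<exists>A B. is_filtration K lam A M0 \<and> is_filtration K lam B M1 \<and>
        A (ozero (cardSuc lam)) = N0 \<and> B (ozero (cardSuc lam)) = N1 \<and>
        (\<forall>i\<in>Field (cardSuc lam).
           NF (A i) (B i) (A (osuc (cardSuc lam) i)) (B (osuc (cardSuc lam) i))))"

definition le_NF ::
    "('a, 'f, 'r) aec \<Rightarrow> 'c rel \<Rightarrow>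
     (('a, 'f, 'r) struct \<Rightarrow> ('a, 'f, 'r) struct \<Rightarrow> ('a, 'f, 'r) struct \<Rightarrow> ('a, 'f, 'r) struct \<Rightarrow> bool) \<Rightarrow>
     ('a, 'f, 'r) struct \<Rightarrow> ('a, 'f, 'r) struct \<Rightarrow> bool" where
  "le_NF K lam NF M0 M1 \<longleftrightarrow>
     M0 \<in> models_card K (cardSuc lam) \<and> M1 \<in> models_card K (cardSuc lam) \<and> M0 \<preceq>\<^bsub>K\<^esub> M1 \<and>
     (\<exists>N0\<in>models_card K lam. \<exists>N1\<in>models_card K lam. NF_hat K lam NF N0 N1 M0 M1)"

end

theory Submission
  imports Defs
begin

text \<open>
  Only the implication from \<open>M \<preceq> M'\<close> is a theorem; the other one is part of the definition.
  Three facts about models of size \<open>\<lambda>\<^sup>+\<close> carry it.  Every proper extension \<open>X \<preceq> N\<close> contains an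
  element whose type over \<open>X\<close> does not fork over a model of size \<open>\<lambda>\<close>.  Every such type is realized
  in some \<open>X'\<close> with \<open>X \<preceq>\<^sup>N\<^sup>F X'\<close>: amalgamate a realization of its restriction with a filtration of
  \<open>X\<close>, level by level, and apply tameness; by amalgamation in \<open>\<lambda>\<^sup>+\<close>, \<open>X'\<close> and \<open>N\<close> then embed into a
  common model over \<open>X\<close> with the two realizations identified.  Finally \<open>\<preceq>\<^sup>N\<^sup>F\<close> is closed under unions
  of chains of length \<open>\<lambda>\<^sup>+\<close>, by a diagonal intersection of clubs and long transitivity.

  Starting from \<open>(M, M')\<close>, one builds chains \<open>X\<^sub>i \<preceq> N\<^sub>i\<close> for \<open>i < \<lambda>\<^sup>+\<close> in which bookkeeping moves every
  element of non-forking type over \<open>X\<^sub>i\<close> into some later \<open>X\<^sub>j\<close>.  By density the unions coincide, so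
  \<open>M \<preceq> M' \<preceq> X\<close> with \<open>M \<preceq>\<^sup>N\<^sup>F X\<close>, and monotonicity of \<open>NF\<close> gives \<open>M \<preceq>\<^sup>N\<^sup>F M'\<close>.
\<close>

section \<open>Ordinals below \<open>\<lambda>\<^sup>+\<close>\<close>

text \<open>For an arbitrary M \<preceq> M' nothing is known about \<open>NF\<close> between the
  levels of two filtrations; it is available only for extensions built level by level with
  \<open>NF_extension\<close>. This forces the detour through a larger model made of such
  extensions, and a descent to M' at the end. In the descent a level of X is cut down to its trace
  on M', which is a level of a given filtration of M' only for a club of indices. Filtrations are
  never canonical, so comparisons of them hold on clubs only; hence clubs are coded concretely by
  functions, and \<open>le_NF_clubI\<close> is the way to prove \<open>le_NF\<close>. The
  construction controls types only over models of size \<open>lam\<close>; tameness closes that gap.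
  Equality of types is a transitive closure, and amalgamation in \<open>\<lambda>\<^sup>+\<close>
  turns it back into a single amalgam in which the two elements coincide. Regularity of the
  successor cardinal enters only through \<open>ord_bounded\<close>.\<close>

locale succ_card =
  fixes lam :: "'c rel"
  assumes lam_card: "Card_order lam" and lam_inf: "infinite (Field lam)"
begin

abbreviation R :: "'c set rel" where "R \<equiv> cardSuc lam"
abbreviation ord :: "'c set set" where "ord \<equiv> Field R"
abbreviation oz :: "'c set" where "oz \<equiv> ozero R"
abbreviation os :: "'c set \<Rightarrow> 'c set" where "os \<equiv> osuc R"

definition ile :: "'c set \<Rightarrow> 'c set \<Rightarrow> bool" (infix "\<sqsubseteq>" 50) where "i \<sqsubseteq> j \<longleftrightarrow> (i, j) \<in> R"
definition ilt :: "'c set \<Rightarrow> 'c set \<Rightarrow> bool" (infix "\<sqsubset>" 50) where "i \<sqsubset> j \<longleftrightarrow> i \<noteq> j \<and> (i, j) \<in> R"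

lemma R_card: "Card_order R"
  by (simp add: cardSuc_Card_order lam_card)

lemma R_wo: "Well_order R"
  by (simp add: cardSuc_Well_order lam_card)

lemma R_wo_rel: "wo_rel R"
  by (simp add: wo_rel_def R_wo)

lemma lam_less_R: "lam <o R"
  by (simp add: cardSuc_greater lam_card)

lemma R_inf: "infinite ord"
  using lam_card lam_inf cardSuc_finite by blast

lemma mem_underS [simp]: "i \<in> underS R j \<longleftrightarrow> i \<sqsubset> j"
  by (auto simp: underS_def ilt_def)

lemma mem_under [simp]: "i \<in> under R j \<longleftrightarrow> i \<sqsubseteq> j"
  by (auto simp: under_def ile_def)

lemma ile_ord: assumes "i \<sqsubseteq> j" shows "i \<in> ord" "j \<in> ord"
  using assms by (auto simp: ile_def Field_def)

lemma ilt_ord: assumes "i \<sqsubset> j" shows "i \<in> ord" "j \<in> ord"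
  using assms by (auto simp: ilt_def Field_def)

lemma ile_refl [simp]: "i \<sqsubseteq> i \<longleftrightarrow> i \<in> ord"
  using R_wo by (auto simp: ile_def Field_def well_order_on_def linear_order_on_def
      partial_order_on_def preorder_on_def refl_on_def)

lemma ilt_irrefl [simp]: "\<not> i \<sqsubset> i"
  by (simp add: ilt_def)

lemma ile_trans: "i \<sqsubseteq> j \<Longrightarrow> j \<sqsubseteq> k \<Longrightarrow> i \<sqsubseteq> k"
  using wo_rel.TRANS[OF R_wo_rel] unfolding ile_def by (meson transD)

lemma ile_antisym: "i \<sqsubseteq> j \<Longrightarrow> j \<sqsubseteq> i \<Longrightarrow> i = j"
  using wo_rel.ANTISYM[OF R_wo_rel] unfolding ile_def by (meson antisymD)

lemma ilt_iff: "i \<sqsubset> j \<longleftrightarrow> i \<sqsubseteq> j \<and> i \<noteq> j"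
  by (auto simp: ile_def ilt_def)

lemma ilt_imp_ile: "i \<sqsubset> j \<Longrightarrow> i \<sqsubseteq> j"
  by (simp add: ilt_iff)

lemma ile_ilt_trans: "i \<sqsubseteq> j \<Longrightarrow> j \<sqsubset> k \<Longrightarrow> i \<sqsubset> k"
  by (metis ile_antisym ile_trans ilt_iff)

lemma ilt_ile_trans: "i \<sqsubset> j \<Longrightarrow> j \<sqsubseteq> k \<Longrightarrow> i \<sqsubset> k"
  by (metis ile_antisym ile_trans ilt_iff)

lemma ilt_trans: "i \<sqsubset> j \<Longrightarrow> j \<sqsubset> k \<Longrightarrow> i \<sqsubset> k"
  using ile_ilt_trans ilt_imp_ile by blast

lemma ile_linear: "i \<in> ord \<Longrightarrow> j \<in> ord \<Longrightarrow> i \<sqsubseteq> j \<or> j \<sqsubseteq> i"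
  using wo_rel.TOTALS[OF R_wo_rel] unfolding ile_def by blast

lemma not_ile: "i \<in> ord \<Longrightarrow> j \<in> ord \<Longrightarrow> \<not> i \<sqsubseteq> j \<longleftrightarrow> j \<sqsubset> i"
  by (metis ile_antisym ile_linear ile_refl ilt_iff)

lemma not_ilt: "i \<in> ord \<Longrightarrow> j \<in> ord \<Longrightarrow> \<not> i \<sqsubset> j \<longleftrightarrow> j \<sqsubseteq> i"
  by (metis not_ile)

lemma wf_ilt: "wf {(i, j). i \<sqsubset> j}"
proof -
  have "{(i, j). i \<sqsubset> j} = R - Id" by (auto simp: ilt_def)
  then show ?thesis using wo_rel.WF[OF R_wo_rel] by simp
qed

lemma ord_least:
  assumes "B \<subseteq> ord" "B \<noteq> {}"
  shows "\<exists>b\<in>B. \<forall>x\<in>B. b \<sqsubseteq> x"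
  using wo_rel.minim_isMinim[OF R_wo_rel assms] unfolding wo_rel.isMinim_def[OF R_wo_rel] ile_def
  by blast

lemma ord_ne: "ord \<noteq> {}"
  using R_inf by auto

lemma oz_ord [simp]: "oz \<in> ord" and oz_least: "i \<in> ord \<Longrightarrow> oz \<sqsubseteq> i"
  using wo_rel.minim_in[OF R_wo_rel order_refl ord_ne] wo_rel.minim_least[OF R_wo_rel order_refl, of i]
  by (auto simp: ile_def)

lemma not_lt_oz [simp]: "\<not> i \<sqsubset> oz"
  by (meson ile_ilt_trans ilt_irrefl ilt_ord(1) oz_least)

section \<open>Sets of cardinality at most \<open>lam\<close>\<close>

lemma card_underS: "i \<in> ord \<Longrightarrow> |{j. j \<sqsubset> i}| \<le>o lam"
  using card_of_underS[OF R_card, of i] cardSuc_ordLess_ordLeq[OF card_of_Card_order lam_card]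
  by (metis (no_types, lifting) Collect_cong Collect_mem_eq cardSuc_ordLeq_ordLess card_of_Card_order lam_card mem_underS)

lemma card_singleton_lam: "|{x}| \<le>o lam"
proof -
  have "Field lam \<noteq> {}" using lam_inf by auto
  then show ?thesis by (rule Card_order_singl_ordLeq[OF lam_card])
qed

lemma card_insert_lam: "|A| \<le>o lam \<Longrightarrow> |insert x A| \<le>o lam"
proof -
  assume a: "|A| \<le>o lam"
  have "|{x}| \<le>o lam"
    using Card_order_singl_ordLeq[OF lam_card] lam_inf by (metis finite.emptyI)
  then show ?thesis
    using card_of_Un_ordLeq_infinite_Field[OF lam_inf _ a lam_card, of "{x}"] by simp
qed

lemma card_Un_lam: "|A| \<le>o lam \<Longrightarrow> |B| \<le>o lam \<Longrightarrow> |A \<union> B| \<le>o lam"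
  by (rule card_of_Un_ordLeq_infinite_Field[OF lam_inf _ _ lam_card])

lemma card_UN_lam: "|I| \<le>o lam \<Longrightarrow> (\<And>i. i \<in> I \<Longrightarrow> |F i| \<le>o lam) \<Longrightarrow> |\<Union>i\<in>I. F i| \<le>o lam"
  using card_of_UNION_ordLeq_infinite_Field[OF lam_inf lam_card] by blast

lemma card_image_lam: "|A| \<le>o lam \<Longrightarrow> |f ` A| \<le>o lam"
  using card_of_image ordLeq_transitive by blast

lemma card_subset_lam: "A \<subseteq> B \<Longrightarrow> |B| \<le>o lam \<Longrightarrow> |A| \<le>o lam"
  using card_of_mono1 ordLeq_transitive by blast

lemma card_under: "i \<in> ord \<Longrightarrow> |{j. j \<sqsubseteq> i}| \<le>o lam"
proof -
  assume i: "i \<in> ord"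
  have "{j. j \<sqsubseteq> i} = insert i {j. j \<sqsubset> i}" using i by (auto simp: ilt_iff)
  then show ?thesis using card_insert_lam[OF card_underS[OF i]] by simp
qed

lemma card_countable_lam: "|range (f :: nat \<Rightarrow> 'b)| \<le>o lam"
proof -
  have "|UNIV :: nat set| \<le>o |Field lam|" using lam_inf infinite_iff_card_of_nat by blast
  then have "|UNIV :: nat set| \<le>o lam"
    using card_of_Field_ordIso[OF lam_card] ordLeq_ordIso_trans by blast
  then show ?thesis by (rule card_image_lam)
qed

text \<open>A set without a strict upper bound is cofinal, and regularity of the successor cardinal
  would give it full cardinality. Every closing-off argument below rests on this bound.\<close>

lemma ord_bounded:
  assumes "B \<subseteq> ord" "|B| \<le>o lam"
  shows "\<exists>j\<in>ord. \<forall>b\<in>B. b \<sqsubset> j"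
proof (rule ccontr)
  assume a: "\<not> ?thesis"
  have "cofinal B R"
    unfolding cofinal_def
  proof
    fix i assume i: "i \<in> ord"
    \<comment> \<open>\<open>cofinal\<close> demands an element strictly above \<open>i\<close>, so
      unboundedness is applied to some \<open>j\<close> beyond \<open>i\<close>; it exists because
      an infinite cardinal has no largest element.\<close>
    obtain j where j: "j \<in> ord" "i \<sqsubset> j"
      using infinite_Card_order_limit[OF R_card R_inf i] ilt_def by auto
    then obtain b where "b \<in> B" "\<not> b \<sqsubset> j" using a by blast
    then have "i \<sqsubset> b" using not_ilt[of b j] assms(1) j ilt_ile_trans by blast
    then show "\<exists>b\<in>B. i \<noteq> b \<and> (i, b) \<in> R" using \<open>b \<in> B\<close> ilt_def by blast
  qed
  then have "|B| =o R"
    using infinite_cardSuc_regularCard[OF lam_inf lam_card] assms(1) unfolding regularCard_def by blast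
  then have "R \<le>o lam" using assms(2) ordIso_symmetric ordIso_ordLeq_trans by blast
  then show False using lam_less_R not_ordLess_ordLeq by blast
qed

section \<open>Least strict upper bounds, successors and limits\<close>

lemma strict_ub_nonempty: "B \<subseteq> ord \<Longrightarrow> |B| \<le>o lam \<Longrightarrow> AboveS R B \<noteq> {}"
  using ord_bounded[of B] by (fastforce simp: AboveS_def ilt_def)

text \<open>The least strict upper bound. On a singleton it is the successor and on a set without
  maximum the supremum, so one operation serves successor and limit stages.\<close>

definition ssup :: "'c set set \<Rightarrow> 'c set" where "ssup B = wo_rel.suc R B"

lemma ssup:
  assumes "B \<subseteq> ord" "|B| \<le>o lam"
  shows ssup_ord: "ssup B \<in> ord" and ssup_upper: "b \<in> B \<Longrightarrow> b \<sqsubset> ssup B"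
    and ssup_least: "i \<sqsubset> ssup B \<Longrightarrow> \<exists>b\<in>B. i \<sqsubseteq> b"
proof -
  note ne = strict_ub_nonempty[OF assms]
  show 1: "ssup B \<in> ord" unfolding ssup_def using wo_rel.suc_inField[OF R_wo_rel assms(1) ne] .
  show "b \<in> B \<Longrightarrow> b \<sqsubset> ssup B" unfolding ssup_def
    using wo_rel.suc_greater[OF R_wo_rel assms(1) ne] by (auto simp: ilt_def)
  assume i: "i \<sqsubset> ssup B"
  show "\<exists>b\<in>B. i \<sqsubseteq> b"
  proof (rule ccontr)
    assume "\<not> ?thesis"
    then have "\<forall>b\<in>B. b \<sqsubset> i" using not_ile i ilt_ord assms(1) by blast
    then have "i \<in> AboveS R B" using i ilt_ord by (auto simp: AboveS_def ilt_def)
    then have "(wo_rel.suc R B, i) \<in> R" by (rule wo_rel.suc_least_AboveS[OF R_wo_rel])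
    then show False using i ile_ilt_trans unfolding ssup_def ile_def by (metis ile_def ile_ilt_trans ilt_irrefl)
  qed
qed

lemma os_ssup: "os i = ssup {i}"
  by (simp add: ssup_def)

lemma os_ord [simp]: "i \<in> ord \<Longrightarrow> os i \<in> ord"
  unfolding os_ssup by (rule ssup_ord[OF _ card_singleton_lam]) simp

lemma lt_os: "i \<in> ord \<Longrightarrow> i \<sqsubset> os i"
  unfolding os_ssup by (rule ssup_upper[OF _ card_singleton_lam]) simp_all

lemma lt_os_iff: assumes i: "i \<in> ord" shows "j \<sqsubset> os i \<longleftrightarrow> j \<sqsubseteq> i"
proof
  assume "j \<sqsubset> os i"
  then have "\<exists>b\<in>{i}. j \<sqsubseteq> b"
    unfolding os_ssup by (rule ssup_least[OF _ card_singleton_lam, rotated]) (simp add: i)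
  then show "j \<sqsubseteq> i" by simp
qed (rule ile_ilt_trans[OF _ lt_os[OF i]])

lemma os_le_iff: "i \<in> ord \<Longrightarrow> j \<in> ord \<Longrightarrow> os i \<sqsubseteq> j \<longleftrightarrow> i \<sqsubset> j"
  by (metis lt_os_iff not_ile os_ord)

lemma os_inject: "i \<in> ord \<Longrightarrow> j \<in> ord \<Longrightarrow> os i = os j \<longleftrightarrow> i = j"
  by (metis ile_antisym ile_refl lt_os_iff)

lemma os_ne_oz: "i \<in> ord \<Longrightarrow> os i \<noteq> oz"
  by (metis lt_os not_lt_oz)

lemma is_limit_iff: "is_limit R d \<longleftrightarrow> d \<in> ord \<and> d \<noteq> oz \<and> (\<forall>i. i \<sqsubset> d \<longrightarrow> os i \<sqsubset> d)"
proof
  assume L: "is_limit R d"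
  then have d: "d \<in> ord" by (simp add: is_limit_def)
  have "d \<noteq> oz" using L not_lt_oz unfolding is_limit_def by (metis equals0I mem_underS)
  moreover have "os i \<sqsubset> d" if i: "i \<sqsubset> d" for i
  proof -
    obtain j where "j \<in> underS R d" "i \<sqsubset> j"
      using L i unfolding is_limit_def ilt_def[symmetric] by (metis mem_underS)
    then have "j \<sqsubset> d" by simp
    moreover have "os i \<sqsubseteq> j" using \<open>i \<sqsubset> j\<close> ilt_ord[OF \<open>i \<sqsubset> j\<close>] by (simp add: os_le_iff)
    ultimately show ?thesis using ile_ilt_trans by blast
  qed
  ultimately show "d \<in> ord \<and> d \<noteq> oz \<and> (\<forall>i. i \<sqsubset> d \<longrightarrow> os i \<sqsubset> d)" using d by blast
next
  assume a: "d \<in> ord \<and> d \<noteq> oz \<and> (\<forall>i. i \<sqsubset> d \<longrightarrow> os i \<sqsubset> d)"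
  then have "oz \<sqsubset> d" using oz_least ilt_iff by auto
  moreover have "\<exists>j\<in>underS R d. i \<noteq> j \<and> (i, j) \<in> R" if i: "i \<in> underS R d" for i
  proof (rule bexI)
    have i': "i \<sqsubset> d" using i by simp
    show "os i \<in> underS R d" using a i' by simp
    show "i \<noteq> os i \<and> (i, os i) \<in> R" using lt_os[OF ilt_ord(1)[OF i']] unfolding ilt_def .
  qed
  ultimately show "is_limit R d" using a unfolding is_limit_def by (metis empty_iff mem_underS)
qed

lemma limit_ord: "is_limit R d \<Longrightarrow> d \<in> ord"
  by (simp add: is_limit_iff)

lemma limit_pos: "is_limit R d \<Longrightarrow> oz \<sqsubset> d"
  using oz_least[of d] unfolding is_limit_iff ilt_iff[of oz d] by auto

lemma limit_suc: "is_limit R d \<Longrightarrow> i \<sqsubset> d \<Longrightarrow> os i \<sqsubset> d"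
  unfolding is_limit_iff by simp

lemma os_not_limit: assumes i: "i \<in> ord" shows "\<not> is_limit R (os i)"
proof
  assume "is_limit R (os i)"
  from limit_suc[OF this lt_os[OF i]] show False by simp
qed

lemma oz_not_limit: "\<not> is_limit R oz"
  unfolding is_limit_iff by simp

lemma ord_cases [consumes 1, case_names zero suc limit]:
  assumes i: "i \<in> ord"
  obtains "i = oz" | j where "j \<in> ord" "i = os j" | "is_limit R i"
proof -
  have "\<exists>j\<in>ord. i = os j" if z: "i \<noteq> oz" and l: "\<not> is_limit R i"
  proof -
    obtain j where j: "j \<sqsubset> i" "\<not> os j \<sqsubset> i"
      using z l i unfolding is_limit_iff by blast
    have jo: "j \<in> ord" by (rule ilt_ord(1)[OF j(1)])
    have "os j \<sqsubseteq> i" using os_le_iff[OF jo i] j(1) by simp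
    moreover have "i \<sqsubseteq> os j" using not_ilt[OF os_ord[OF jo] i] j(2) by simp
    ultimately show ?thesis using jo ile_antisym by blast
  qed
  then show ?thesis using that by blast
qed

section \<open>Closure points and normal functions\<close>

text \<open>Functions code clubs here: when \<open>g\<close> maps \<open>ord\<close> into
  \<open>ord\<close>, these closure points form a closed unbounded set, and every closed unbounded
  set contains one of this form. Only limits count, so that continuous chains are unions at these
  points.\<close>

definition closed :: "('c set \<Rightarrow> 'c set) \<Rightarrow> 'c set \<Rightarrow> bool" where
  "closed g a \<longleftrightarrow> is_limit R a \<and> (\<forall>b. b \<sqsubset> a \<longrightarrow> g b \<sqsubset> a)"

lemma ssup_limit:
  assumes "B \<subseteq> ord" "|B| \<le>o lam" "B \<noteq> {}" "\<And>b. b \<in> B \<Longrightarrow> \<exists>c\<in>B. b \<sqsubset> c"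
  shows "is_limit R (ssup B)"
  unfolding is_limit_iff
proof (intro conjI allI impI)
  note s = ssup[OF assms(1,2)]
  show "ssup B \<in> ord" by (rule s)
  show "ssup B \<noteq> oz" using s(2) assms(3) not_lt_oz by force
  fix i assume "i \<sqsubset> ssup B"
  then obtain b where "b \<in> B" "i \<sqsubseteq> b" using s by blast
  then obtain c where c: "c \<in> B" "i \<sqsubset> c" using assms(4) ile_ilt_trans by blast
  then have "os i \<sqsubseteq> c" using os_le_iff ilt_ord by blast
  then show "os i \<sqsubset> ssup B" using s(2) c ile_ilt_trans by blast
qed

lemma ssup_closed:
  assumes "B \<subseteq> ord" "|B| \<le>o lam" "B \<noteq> {}" "\<And>b. b \<in> B \<Longrightarrow> \<exists>c\<in>B. b \<sqsubset> c"
    and "\<And>b i. b \<in> B \<Longrightarrow> i \<sqsubseteq> b \<Longrightarrow> \<exists>c\<in>B. g i \<sqsubseteq> c"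
  shows "closed g (ssup B)"
proof -
  note s = ssup[OF assms(1,2)]
  have "g i \<sqsubset> ssup B" if i: "i \<sqsubset> ssup B" for i
  proof -
    obtain b where "b \<in> B" "i \<sqsubseteq> b" using s(3)[OF i] by blast
    then obtain c where "c \<in> B" "g i \<sqsubseteq> c" using assms(5) by blast
    then show ?thesis using s(2) ile_ilt_trans by blast
  qed
  then show ?thesis unfolding closed_def using ssup_limit[OF assms(1-4)] by blast
qed

text \<open>Iterating a function that overtakes \<open>g\<close> countably often gives an increasing
  sequence whose supremum is closed under \<open>g\<close>; the sequence is bounded since
  \<open>lam\<close> is infinite. As \<open>g\<close> need not be monotone, each step has to
  overtake its values on a whole initial segment.\<close>

lemma closed_unbounded:
  assumes g: "\<And>i. i \<in> ord \<Longrightarrow> g i \<in> ord" and a: "a \<in> ord"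
  shows "\<exists>b. closed g b \<and> a \<sqsubset> b"
proof -
  have "\<exists>k\<in>ord. i \<sqsubset> k \<and> (\<forall>j. j \<sqsubseteq> i \<longrightarrow> g j \<sqsubset> k)" if i: "i \<in> ord" for i
  proof -
    have "|insert i (g ` {j. j \<sqsubseteq> i})| \<le>o lam"
      by (intro card_insert_lam card_image_lam card_under i)
    moreover have "insert i (g ` {j. j \<sqsubseteq> i}) \<subseteq> ord" using i g ile_ord by auto
    ultimately show ?thesis using ord_bounded[of "insert i (g ` {j. j \<sqsubseteq> i})"] by auto
  qed
  then obtain n where n: "\<And>i. i \<in> ord \<Longrightarrow> n i \<in> ord \<and> i \<sqsubset> n i \<and> (\<forall>j. j \<sqsubseteq> i \<longrightarrow> g j \<sqsubset> n i)" by metis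
  define s where "s m = (n ^^ m) a" for m
  have s0: "s 0 = a" and sS: "s (Suc m) = n (s m)" for m by (auto simp: s_def)
  have so: "s m \<in> ord" for m by (induction m) (auto simp: s0 sS a n)
  have "closed g (ssup (range s))"
  proof (rule ssup_closed)
    show "range s \<subseteq> ord" using so by auto
    show "|range s| \<le>o lam" by (rule card_countable_lam)
    show "\<exists>c\<in>range s. b \<sqsubset> c" if b: "b \<in> range s" for b
    proof -
      obtain m where "b = s m" using b by auto
      then have "b \<sqsubset> s (Suc m)" using n[OF so[of m]] by (simp add: sS)
      then show ?thesis by blast
    qed
    show "\<exists>c\<in>range s. g i \<sqsubseteq> c" if b: "b \<in> range s" and i: "i \<sqsubseteq> b" for b i
    proof -
      obtain m where "b = s m" using b by auto
      then have "g i \<sqsubset> s (Suc m)" using n[OF so[of m]] i by (simp add: sS)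
      then show ?thesis using ilt_imp_ile by blast
    qed
  qed simp
  moreover have "a \<sqsubset> ssup (range s)"
    using ssup_upper[of "range s"] so card_countable_lam s0 by (metis image_subsetI rangeI)
  ultimately show ?thesis by blast
qed

text \<open>Transfinite recursion with choices: by the first premise \<open>P\<close> sees only
  earlier values, and in the second the earlier values may already be assumed to satisfy
  \<open>P\<close>. The invariants of a construction are therefore written into \<open>P\<close>
  together with the construction.\<close>

lemma ord_recursion:
  assumes "\<And>x f g r. (\<And>z. z \<sqsubset> x \<Longrightarrow> f z = g z) \<Longrightarrow> P f x r = P g x r"
    and "\<And>x f. x \<in> ord \<Longrightarrow> (\<And>y. y \<sqsubset> x \<Longrightarrow> P f y (f y)) \<Longrightarrow> \<exists>r. P f x r"
  shows "\<exists>f. \<forall>x\<in>ord. P f x (f x)"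
proof -
  have "\<exists>f. \<forall>x. x \<in> ord \<longrightarrow> P f x (f x)"
  proof (rule dependent_wf_choice[OF wf_ilt])
    show "(x \<in> ord \<longrightarrow> P f x r) = (x \<in> ord \<longrightarrow> P g x r)"
      if "\<And>z. (z, x) \<in> {(i, j). i \<sqsubset> j} \<Longrightarrow> f z = g z" for f g x r
      using assms(1)[of x f g r] that by simp
    show "\<exists>r. x \<in> ord \<longrightarrow> P f x r"
      if "\<And>y. (y, x) \<in> {(i, j). i \<sqsubset> j} \<Longrightarrow> y \<in> ord \<longrightarrow> P f y (f y)" for x f
      using assms(2)[of x f] that ilt_ord by auto
  qed
  then show ?thesis by blast
qed

text \<open>The second conjunct is continuity: at a limit the value is the supremum of the earlier
  values.\<close>

definition normal :: "('c set \<Rightarrow> 'c set) \<Rightarrow> bool" where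
  "normal D \<longleftrightarrow> (\<forall>i j. i \<sqsubset> j \<longrightarrow> D i \<sqsubset> D j) \<and>
     (\<forall>i k. is_limit R i \<longrightarrow> k \<sqsubset> D i \<longrightarrow> (\<exists>j. j \<sqsubset> i \<and> k \<sqsubset> D j))"

text \<open>Away from limits take a closure point beyond all earlier values; at limits the supremum
  of the earlier closure points is again one, because every ordinal below it lies below one of them.
  This enumerates the part of a club that is used later.\<close>

lemma normal_closed:
  assumes g: "\<And>i. i \<in> ord \<Longrightarrow> g i \<in> ord"
  shows "\<exists>D. normal D \<and> (\<forall>i\<in>ord. closed g (D i))"
proof -
  define P where "P D i x \<longleftrightarrow> closed g x \<and> (\<forall>j. j \<sqsubset> i \<longrightarrow> D j \<sqsubset> x) \<and>
     (is_limit R i \<longrightarrow> (\<forall>k. k \<sqsubset> x \<longrightarrow> (\<exists>j. j \<sqsubset> i \<and> k \<sqsubset> D j)))" for D i x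
  have "\<exists>D. \<forall>i\<in>ord. P D i (D i)"
  proof (rule ord_recursion)
    show "P f x r = P h x r" if "\<And>z. z \<sqsubset> x \<Longrightarrow> f z = h z" for f h x r
      using that unfolding P_def by (metis (full_types))
    fix x f assume x: "x \<in> ord" and IH: "\<And>y. y \<sqsubset> x \<Longrightarrow> P f y (f y)"
    let ?B = "f ` {j. j \<sqsubset> x}"
    have B: "?B \<subseteq> ord" "|?B| \<le>o lam"
      using IH card_image_lam[OF card_underS[OF x]] by (auto simp: P_def closed_def is_limit_iff)
    show "\<exists>r. P f x r"
    proof (cases "is_limit R x")
      case False
      obtain r where "closed g r" "ssup ?B \<sqsubset> r"
        using closed_unbounded[of g, OF g ssup_ord[OF B]] by blast
      then have "P f x r" unfolding P_def using False ssup_upper[OF B] ilt_trans by blast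
      then show ?thesis by blast
    next
      case True
      have step: "f b \<sqsubset> f (os b) \<and> os b \<sqsubset> x" if b: "b \<sqsubset> x" for b
        using limit_suc[OF True b] IH[of "os b"] lt_os[OF ilt_ord(1)[OF b]] unfolding P_def by simp
      have "closed g (ssup ?B)"
      proof (rule ssup_closed[OF B])
        show "?B \<noteq> {}" using limit_pos[OF True] by blast
        show "\<exists>c\<in>?B. b \<sqsubset> c" if "b \<in> ?B" for b using step that by blast
        show "\<exists>c\<in>?B. g i \<sqsubseteq> c" if "b \<in> ?B" "i \<sqsubseteq> b" for b i
        proof -
          obtain y where y: "y \<sqsubset> x" "b = f y" using \<open>b \<in> ?B\<close> by blast
          have "i \<sqsubset> f (os y)" using step[OF y(1)] y that ile_ilt_trans by blast
          then have "g i \<sqsubset> f (os y)" using IH[of "os y"] step[OF y(1)] by (auto simp: P_def closed_def)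
          then show ?thesis using step[OF y(1)] ilt_imp_ile by blast
        qed
      qed
      moreover have "\<exists>j. j \<sqsubset> x \<and> k \<sqsubset> f j" if "k \<sqsubset> ssup ?B" for k
        using ssup_least[OF B that] step ile_ilt_trans by blast
      ultimately have "P f x (ssup ?B)" unfolding P_def using ssup_upper[OF B] by blast
      then show ?thesis by blast
    qed
  qed
  then obtain D where D: "\<And>i. i \<in> ord \<Longrightarrow> P D i (D i)" by blast
  have "normal D" unfolding normal_def using D ilt_ord(2) limit_ord unfolding P_def by blast
  moreover have "\<forall>i\<in>ord. closed g (D i)" using D unfolding P_def by blast
  ultimately show ?thesis by blast
qed

lemma normal_ord: "normal D \<Longrightarrow> i \<in> ord \<Longrightarrow> D i \<in> ord"
  unfolding normal_def using lt_os ilt_ord(1) by blast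

text \<open>If \<open>b\<close> were the least ordinal moved down, monotonicity would move the
  smaller ordinal \<open>D b\<close> down as well.\<close>

lemma normal_ge: "normal D \<Longrightarrow> i \<in> ord \<Longrightarrow> i \<sqsubseteq> D i"
proof (rule ccontr)
  assume D: "normal D" and i: "i \<in> ord" and n: "\<not> i \<sqsubseteq> D i"
  let ?B = "{i \<in> ord. D i \<sqsubset> i}"
  have "i \<in> ?B" using n i not_ile normal_ord[OF D i] by blast
  then obtain b where b: "b \<in> ?B" "\<And>x. x \<in> ?B \<Longrightarrow> b \<sqsubseteq> x" using ord_least[of ?B] by blast
  then have "D (D b) \<sqsubset> D b" using D unfolding normal_def by blast
  then have "D b \<in> ?B" using ilt_ord by blast
  then show False using b ile_ilt_trans ilt_irrefl by blast
qed

section \<open>Bookkeeping and closed unbounded sets\<close>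

text \<open>A bijection of \<open>(ord \<times> ord) \<times> ord\<close> with \<open>ord\<close>
  gives each pair as many positions as \<open>ord\<close> has elements. They cannot all lie below
  \<open>i\<close>, which has at most \<open>lam\<close> predecessors.\<close>

lemma bookkeeping:
  "\<exists>pr :: 'c set \<Rightarrow> 'c set \<times> 'c set. \<forall>i\<in>ord. \<forall>x\<in>ord. \<exists>j\<in>ord. i \<sqsubseteq> j \<and> pr j = (i, x)"
proof -
  have "|ord \<times> ord| =o |ord|"
    using card_of_Times_same_infinite[OF R_inf] .
  then have "|(ord \<times> ord) \<times> ord| =o |ord|"
    using card_of_Times_infinite[OF R_inf, of "ord \<times> ord"] ord_ne ordIso_imp_ordLeq
    by (metis Times_empty)
  then obtain h where h: "bij_betw h ((ord \<times> ord) \<times> ord) ord"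
    using card_of_ordIso by blast
  let ?k = "inv_into ((ord \<times> ord) \<times> ord) h"
  have "\<exists>j\<in>ord. i \<sqsubseteq> j \<and> fst (?k j) = (i, x)" if ix: "i \<in> ord" "x \<in> ord" for i x
  proof (rule ccontr)
    assume n: "\<not> ?thesis"
    let ?m = "\<lambda>z. h ((i, x), z)"
    have "?m z \<sqsubset> i" if z: "z \<in> ord" for z
    proof -
      have "?m z \<in> ord" using bij_betwE[OF h] ix z by blast
      moreover have "?k (?m z) = ((i, x), z)"
        using bij_betw_inv_into_left[OF h] ix z by blast
      ultimately show ?thesis using n not_ile ix by (metis fst_conv)
    qed
    then have "?m ` ord \<subseteq> {j. j \<sqsubset> i}" by blast
    moreover have "inj_on ?m ord"
      using h ix unfolding bij_betw_def inj_on_def by blast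
    ultimately have "|ord| \<le>o |{j. j \<sqsubset> i}|" using card_of_ordLeq by blast
    then have "R \<le>o lam"
      using card_of_Field_ordIso[OF R_card] ordIso_symmetric ordIso_ordLeq_trans
        ordLeq_transitive card_underS[OF ix(1)] by blast
    then show False using lam_less_R not_ordLess_ordLeq by blast
  qed
  then show ?thesis by (intro exI[of _ "\<lambda>j. fst (?k j)"]) blast
qed

text \<open>The set of ordinals satisfying \<open>C\<close> contains a closed unbounded set; it need not be closed.\<close>

definition club :: "('c set \<Rightarrow> bool) \<Rightarrow> bool" where
  "club C \<longleftrightarrow> (\<exists>g. (\<forall>i\<in>ord. g i \<in> ord) \<and> (\<forall>d. closed g d \<longrightarrow> C d))"

lemma club_mono: "club C \<Longrightarrow> (\<And>d. C d \<Longrightarrow> C' d) \<Longrightarrow> club C'"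
  unfolding club_def by meson

text \<open>The way clubs arise in the applications: each stage \<open>i\<close> calls for at most
  \<open>lam\<close> witnesses, and \<open>d\<close> lies above the witnesses of all its earlier
  stages. A bound for each stage is the coding function.\<close>

lemma club_bound:
  assumes "\<And>i. i \<in> ord \<Longrightarrow> B i \<subseteq> ord" "\<And>i. i \<in> ord \<Longrightarrow> |B i| \<le>o lam"
  shows "club (\<lambda>d. is_limit R d \<and> (\<forall>i. i \<sqsubset> d \<longrightarrow> (\<forall>b\<in>B i. b \<sqsubset> d)))"
proof -
  have "\<forall>i\<in>ord. \<exists>j\<in>ord. \<forall>b\<in>B i. b \<sqsubset> j" using ord_bounded assms by simp
  then obtain g where g: "\<forall>i\<in>ord. g i \<in> ord \<and> (\<forall>b\<in>B i. b \<sqsubset> g i)"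
    unfolding Bex_def by (rule bchoice[THEN exE])
  have "is_limit R d \<and> (\<forall>i. i \<sqsubset> d \<longrightarrow> (\<forall>b\<in>B i. b \<sqsubset> d))" if d: "closed g d" for d
  proof (intro conjI allI impI ballI)
    show "is_limit R d" using d by (simp add: closed_def)
    fix i b assume i: "i \<sqsubset> d" and b: "b \<in> B i"
    have "b \<sqsubset> g i" using g b ilt_ord(1)[OF i] by simp
    moreover have "g i \<sqsubset> d" using d i by (simp add: closed_def)
    ultimately show "b \<sqsubset> d" by (rule ilt_trans)
  qed
  then show ?thesis unfolding club_def using g by blast
qed

lemma club_limit: "club (is_limit R)"
  unfolding club_def by (rule exI[of _ id]) (simp add: closed_def)

lemma club_above: assumes "a \<in> ord" shows "club (\<lambda>d. a \<sqsubset> d)"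
proof -
  have "club (\<lambda>d. is_limit R d \<and> (\<forall>i. i \<sqsubset> d \<longrightarrow> (\<forall>b\<in>{a}. b \<sqsubset> d)))"
    by (rule club_bound) (simp_all add: assms card_singleton_lam)
  then show ?thesis by (rule club_mono) (use limit_pos in blast)
qed

lemma club_diagonal:
  assumes C: "\<And>i. i \<in> ord \<Longrightarrow> club (C i)"
  shows "club (\<lambda>d. \<forall>i. i \<sqsubset> d \<longrightarrow> C i d)"
proof -
  have "\<forall>i\<in>ord. \<exists>g. (\<forall>j\<in>ord. g j \<in> ord) \<and> (\<forall>d. closed g d \<longrightarrow> C i d)"
    using C unfolding club_def by blast
  then obtain g where g: "\<forall>i\<in>ord. (\<forall>j\<in>ord. g i j \<in> ord) \<and> (\<forall>d. closed (g i) d \<longrightarrow> C i d)"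
    by (rule bchoice[THEN exE])
  \<comment> \<open>A single index \<open>m\<close> has to account for both arguments of
    \<open>g i j\<close>. Below a limit \<open>d\<close> any two indices have a common bound
    \<open>m\<close>, so collecting the values with both arguments up to \<open>m\<close> makes
    \<open>d\<close> closed under every \<open>g i\<close> with \<open>i\<close> below
    \<open>d\<close>.\<close>
  let ?B = "\<lambda>m. \<Union>i\<in>{i. i \<sqsubseteq> m}. g i ` {j. j \<sqsubseteq> m}"
  have "club (\<lambda>d. is_limit R d \<and> (\<forall>m. m \<sqsubset> d \<longrightarrow> (\<forall>b\<in>?B m. b \<sqsubset> d)))"
  proof (rule club_bound)
    fix m assume m: "m \<in> ord"
    show "?B m \<subseteq> ord" using g ile_ord(1) by auto
    show "|?B m| \<le>o lam"
      by (rule card_UN_lam[OF card_under[OF m] card_image_lam[OF card_under[OF m]]])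
  qed
  then show ?thesis
  proof (rule club_mono, intro allI impI)
    fix d i assume d: "is_limit R d \<and> (\<forall>m. m \<sqsubset> d \<longrightarrow> (\<forall>b\<in>?B m. b \<sqsubset> d))" and i: "i \<sqsubset> d"
    have "g i j \<sqsubset> d" if j: "j \<sqsubset> d" for j
    proof -
      obtain m where m: "m \<sqsubset> d" "i \<sqsubseteq> m" "j \<sqsubseteq> m"
        using ile_linear[OF ilt_ord(1)[OF i] ilt_ord(1)[OF j]] i j ilt_ord(1) ile_refl by blast
      then have "g i j \<in> ?B m" by blast
      then show ?thesis using d m(1) by blast
    qed
    then have "closed (g i) d" using d by (simp add: closed_def)
    then show "C i d" using g ilt_ord(1)[OF i] by blast
  qed
qed

text \<open>A finite intersection as a diagonal one: the first condition is placed at index zero and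
  the second at all others, and every limit lies above both 0 and 1.\<close>

lemma club_conj:
  assumes "club C" "club C'"
  shows "club (\<lambda>d. C d \<and> C' d)"
proof -
  let ?C = "\<lambda>i. if i = oz then C else C'"
  have "club (\<lambda>d. \<forall>i. i \<sqsubset> d \<longrightarrow> ?C i d)" by (rule club_diagonal) (simp add: assms)
  then obtain g where g: "\<forall>i\<in>ord. g i \<in> ord" "\<forall>d. closed g d \<longrightarrow> (\<forall>i. i \<sqsubset> d \<longrightarrow> ?C i d)"
    unfolding club_def by blast
  have "C d \<and> C' d" if d: "closed g d" for d
  proof -
    have L: "is_limit R d" using d by (simp add: closed_def)
    have 1: "oz \<sqsubset> d" by (rule limit_pos[OF L])
    have 2: "os oz \<sqsubset> d" by (rule limit_suc[OF L 1])
    have "?C oz d" "?C (os oz) d" using g(2) d 1 2 by blast+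
    then show ?thesis using os_ne_oz[OF oz_ord] by simp
  qed
  then show ?thesis unfolding club_def using g(1) by blast
qed

lemma club_ex: "club C \<Longrightarrow> \<exists>d. is_limit R d \<and> C d"
  unfolding club_def using closed_unbounded[OF _ oz_ord] unfolding closed_def by metis

lemma club_normal: "club C \<Longrightarrow> \<exists>D. normal D \<and> (\<forall>i\<in>ord. C (D i))"
  unfolding club_def using normal_closed by metis

end

section \<open>Structures\<close>

text \<open>For \<open>f\<close> injective on a structure \<open>M\<close>, the only structure that
  makes \<open>f\<close> an isomorphism from \<open>M\<close>; the defaults outside the domain
  follow \<open>is_struct\<close>. Isomorphic copies thereby become terms instead of existentially
  quantified objects.\<close>

definition img :: "('f, 'r) vocabulary \<Rightarrow> ('a \<Rightarrow> 'b) \<Rightarrow> ('a, 'f, 'r) struct \<Rightarrow> ('b, 'f, 'r) struct" where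
  "img V f M = \<lparr>univ = f ` univ M,
     fint = (\<lambda>F xs. if F \<in> Funs V \<and> length xs = farity V F \<and> set xs \<subseteq> f ` univ M
                then f (fint M F (map (inv_into (univ M) f) xs)) else undefined),
     rint = (\<lambda>Q xs. Q \<in> Rels V \<and> length xs = rarity V Q \<and> set xs \<subseteq> f ` univ M \<and>
                rint M Q (map (inv_into (univ M) f) xs))\<rparr>"

lemma univ_img [simp]: "univ (img V f M) = f ` univ M"
  by (simp add: img_def)

lemma is_struct_fint: "is_struct V M \<Longrightarrow> F \<in> Funs V \<Longrightarrow> length xs = farity V F \<Longrightarrow>
    set xs \<subseteq> univ M \<Longrightarrow> fint M F xs \<in> univ M"
  unfolding is_struct_def by meson

lemma is_struct_fint_undef: "is_struct V M \<Longrightarrow>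
    \<not> (F \<in> Funs V \<and> length xs = farity V F \<and> set xs \<subseteq> univ M) \<Longrightarrow> fint M F xs = undefined"
  unfolding is_struct_def by meson

lemma is_struct_rint: "is_struct V M \<Longrightarrow> rint M Q xs \<Longrightarrow>
    Q \<in> Rels V \<and> length xs = rarity V Q \<and> set xs \<subseteq> univ M"
  unfolding is_struct_def by meson

lemma struct_eqI:
  assumes A: "is_struct V A" and B: "is_struct V B" and u: "univ A = univ B"
    and f: "\<And>F xs. F \<in> Funs V \<Longrightarrow> length xs = farity V F \<Longrightarrow> set xs \<subseteq> univ A \<Longrightarrow> fint A F xs = fint B F xs"
    and r: "\<And>Q xs. Q \<in> Rels V \<Longrightarrow> length xs = rarity V Q \<Longrightarrow> set xs \<subseteq> univ A \<Longrightarrow> rint A Q xs = rint B Q xs"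
  shows "A = (B :: ('a, 'f, 'r) struct)"
proof -
  have "fint A F xs = fint B F xs" for F xs
    using f[of F xs] is_struct_fint_undef[OF A, of F xs] is_struct_fint_undef[OF B, of F xs] u by metis
  moreover have "rint A Q xs = rint B Q xs" for Q xs
    using r[of Q xs] is_struct_rint[OF A, of Q xs] is_struct_rint[OF B, of Q xs] u by metis
  ultimately have "fint A = fint B" "rint A = rint B" by (auto intro!: ext)
  then show ?thesis using u by (cases A, cases B) simp
qed

lemma map_inv_into: "set xs \<subseteq> f ` A \<Longrightarrow> map f (map (inv_into A f) xs) = xs"
  by (induction xs) (auto simp: f_inv_into_f)

lemma map_inv_into2: "inj_on f A \<Longrightarrow> set xs \<subseteq> A \<Longrightarrow> map (inv_into A f) (map f xs) = xs"
  by (induction xs) auto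

lemma is_iso_img:
  assumes M: "is_struct V M" and i: "inj_on f (univ M)"
  shows "is_iso V f M (img V f M)"
proof -
  have st: "set (map (inv_into (univ M) f) xs) \<subseteq> univ M" if "set xs \<subseteq> f ` univ M" for xs
    using that by (auto intro: inv_into_into)
  have "is_struct V (img V f M)"
    using M is_struct_fint[OF M _ _ st] unfolding is_struct_def by (auto simp: img_def)
  moreover have "bij_betw f (univ M) (univ (img V f M))"
    using i by (simp add: bij_betw_def)
  ultimately show ?thesis
    unfolding is_iso_def using M map_inv_into2[OF i] by (auto simp: img_def simp del: map_map)
qed

section \<open>Isomorphisms\<close>

lemma is_isoI:
  assumes "is_struct V M" "is_struct V N" "bij_betw f (univ M) (univ N)"
    and "\<And>F xs. F \<in> Funs V \<Longrightarrow> length xs = farity V F \<Longrightarrow> set xs \<subseteq> univ M \<Longrightarrow>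
           f (fint M F xs) = fint N F (map f xs)"
    and "\<And>Q xs. Q \<in> Rels V \<Longrightarrow> length xs = rarity V Q \<Longrightarrow> set xs \<subseteq> univ M \<Longrightarrow>
           rint M Q xs = rint N Q (map f xs)"
  shows "is_iso V f M N"
  unfolding is_iso_def using assms by meson

lemma is_iso_fint: "is_iso V f M N \<Longrightarrow> F \<in> Funs V \<Longrightarrow> length xs = farity V F \<Longrightarrow> set xs \<subseteq> univ M \<Longrightarrow>
    f (fint M F xs) = fint N F (map f xs)"
  unfolding is_iso_def by meson

lemma is_iso_rint: "is_iso V f M N \<Longrightarrow> Q \<in> Rels V \<Longrightarrow> length xs = rarity V Q \<Longrightarrow> set xs \<subseteq> univ M \<Longrightarrow>
    rint M Q xs = rint N Q (map f xs)"
  unfolding is_iso_def by meson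

lemma is_iso_struct: assumes "is_iso V f M N" shows "is_struct V M" "is_struct V N"
  using assms unfolding is_iso_def by auto

lemma is_iso_inj: "is_iso V f M N \<Longrightarrow> inj_on f (univ M)"
  by (simp add: is_iso_def bij_betw_def)

lemma is_iso_univ: "is_iso V f M N \<Longrightarrow> univ N = f ` univ M"
  by (simp add: is_iso_def bij_betw_def)

lemma is_iso_cong:
  assumes "is_iso V f M N" "\<And>x. x \<in> univ M \<Longrightarrow> f x = g x"
  shows "is_iso V g M N"
proof -
  have M: "is_struct V M" using assms(1) by (rule is_iso_struct)
  have eq: "map g xs = map f xs" if "set xs \<subseteq> univ M" for xs
    using that assms(2) by auto
  show ?thesis
  proof (rule is_isoI)
    show "is_struct V M" "is_struct V N" using assms(1) is_iso_struct by blast+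
    show "bij_betw g (univ M) (univ N)"
      using assms bij_betw_cong[of "univ M" f g] by (simp add: is_iso_def)
    show "g (fint M F xs) = fint N F (map g xs)"
      if h: "F \<in> Funs V" "length xs = farity V F" "set xs \<subseteq> univ M" for F xs
      unfolding eq[OF h(3)] using is_iso_fint[OF assms(1) h] assms(2)[OF is_struct_fint[OF M h]] by simp
    show "rint M Q xs = rint N Q (map g xs)"
      if h: "Q \<in> Rels V" "length xs = rarity V Q" "set xs \<subseteq> univ M" for Q xs
      unfolding eq[OF h(3)] using is_iso_rint[OF assms(1) h] .
  qed
qed

lemma is_iso_id: "is_struct V M \<Longrightarrow> is_iso V id M M"
  by (simp add: is_iso_def)

lemma is_iso_comp:
  assumes f: "is_iso V f M N" and g: "is_iso V g N P"
  shows "is_iso V (g \<circ> f) M P"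
proof (rule is_isoI)
  show "is_struct V M" "is_struct V P" using is_iso_struct f g by blast+
  show "bij_betw (g \<circ> f) (univ M) (univ P)"
    using f g bij_betw_trans[of f "univ M" "univ N" g "univ P"] unfolding is_iso_def by blast
  have st: "set (map f xs) \<subseteq> univ N" if "set xs \<subseteq> univ M" for xs
    using that is_iso_univ[OF f] by auto
  show "(g \<circ> f) (fint M F xs) = fint P F (map (g \<circ> f) xs)"
    if h: "F \<in> Funs V" "length xs = farity V F" "set xs \<subseteq> univ M" for F xs
    using is_iso_fint[OF f h] is_iso_fint[OF g h(1) _ st[OF h(3)]] h(2) by simp
  show "rint M Q xs = rint P Q (map (g \<circ> f) xs)"
    if h: "Q \<in> Rels V" "length xs = rarity V Q" "set xs \<subseteq> univ M" for Q xs
    using is_iso_rint[OF f h] is_iso_rint[OF g h(1) _ st[OF h(3)]] h(2) by simp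
qed

lemma is_iso_unique:
  assumes f: "is_iso V f M N"
  shows "N = img V f (M :: ('a, 'f, 'r) struct)"
proof (rule struct_eqI)
  have i: "inj_on f (univ M)" and u: "univ N = f ` univ M" and M: "is_struct V M"
    using f by (simp_all add: is_iso_inj is_iso_univ is_iso_struct)
  note g = is_iso_img[OF M i]
  show "is_struct V N" "is_struct V (img V f M)" using is_iso_struct f g by blast+
  show "univ N = univ (img V f M)" using u by simp
  have st: "set (map (inv_into (univ M) f) xs) \<subseteq> univ M" if "set xs \<subseteq> univ N" for xs
    using that u by (auto intro: inv_into_into)
  have eq: "map f (map (inv_into (univ M) f) xs) = xs" if "set xs \<subseteq> univ N" for xs
    using map_inv_into[of xs f "univ M"] that u by blast
  show "fint N F xs = fint (img V f M) F xs"
    if h: "F \<in> Funs V" "length xs = farity V F" "set xs \<subseteq> univ N" for F xs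
    using is_iso_fint[OF f h(1) _ st[OF h(3)]] is_iso_fint[OF g h(1) _ st[OF h(3)]] h(2)
    by (simp only: length_map eq[OF h(3)])
  show "rint N Q xs = rint (img V f M) Q xs"
    if h: "Q \<in> Rels V" "length xs = rarity V Q" "set xs \<subseteq> univ N" for Q xs
    using is_iso_rint[OF f h(1) _ st[OF h(3)]] is_iso_rint[OF g h(1) _ st[OF h(3)]] h(2)
    by (simp only: length_map eq[OF h(3)])
qed

section \<open>Substructures and unions of chains\<close>

lemma substructure_struct: assumes "substructure V M N" shows "is_struct V M" "is_struct V N" "univ M \<subseteq> univ N"
  using assms unfolding substructure_def by auto

lemma is_iso_substructure:
  assumes f: "is_iso V f N N'" and s: "substructure V M N"
  shows "is_iso V f M (img V f M)" "substructure V (img V f M) N'"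
proof -
  have MN: "is_struct V M" "is_struct V N" "univ M \<subseteq> univ N"
    by (rule substructure_struct[OF s])+
  then have i: "inj_on f (univ M)" using is_iso_inj[OF f] inj_on_subset by blast
  show g: "is_iso V f M (img V f M)" by (rule is_iso_img[OF MN(1) i])
  have st: "set (map (inv_into (univ M) f) xs) \<subseteq> univ M" if "set xs \<subseteq> f ` univ M" for xs
    using that by (auto intro: inv_into_into)
  have "fint (img V f M) F xs = fint N' F xs"
    if h: "F \<in> Funs V" "length xs = farity V F" "set xs \<subseteq> f ` univ M" for F xs
  proof -
    let ?ys = "map (inv_into (univ M) f) xs"
    have y: "length ?ys = farity V F" "set ?ys \<subseteq> univ M" "set ?ys \<subseteq> univ N"
      using h st[OF h(3)] MN by auto
    have "fint (img V f M) F (map f ?ys) = f (fint M F ?ys)" using is_iso_fint[OF g h(1) y(1,2)] by simp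
    also have "\<dots> = f (fint N F ?ys)" using s h y unfolding substructure_def by simp
    also have "\<dots> = fint N' F (map f ?ys)" by (rule is_iso_fint[OF f h(1) y(1,3)])
    finally show ?thesis unfolding map_inv_into[OF h(3)] .
  qed
  moreover have "rint (img V f M) Q xs = rint N' Q xs"
    if h: "Q \<in> Rels V" "length xs = rarity V Q" "set xs \<subseteq> f ` univ M" for Q xs
  proof -
    let ?ys = "map (inv_into (univ M) f) xs"
    have y: "length ?ys = rarity V Q" "set ?ys \<subseteq> univ M" "set ?ys \<subseteq> univ N"
      using h st[OF h(3)] MN by auto
    have "rint (img V f M) Q (map f ?ys) = rint M Q ?ys" using is_iso_rint[OF g h(1) y(1,2)] by simp
    also have "\<dots> = rint N Q ?ys" using s h y unfolding substructure_def by simp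
    also have "\<dots> = rint N' Q (map f ?ys)" by (rule is_iso_rint[OF f h(1) y(1,3)])
    finally show ?thesis unfolding map_inv_into[OF h(3)] .
  qed
  ultimately show "substructure V (img V f M) N'"
    unfolding substructure_def using is_iso_struct[OF f] is_iso_struct[OF g] is_iso_univ[OF f] MN by auto
qed

lemma substructure_within:
  assumes "substructure V A N" "substructure V B N" "univ A \<subseteq> univ B"
  shows "substructure V A B"
  using assms unfolding substructure_def by (metis subset_trans)

lemma substructure_eq:
  assumes "substructure V A N" "substructure V B N" "univ A = univ B"
  shows "A = (B :: ('a, 'f, 'r) struct)"
  by (rule struct_eqI) (use substructure_within[OF assms(1,2)] assms(3) in \<open>auto simp: substructure_def\<close>)

lemma union_exists:
  assumes ne: "C \<noteq> {}" and st: "\<And>M. M \<in> C \<Longrightarrow> is_struct V M"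
    and ch: "\<And>M N. M \<in> C \<Longrightarrow> N \<in> C \<Longrightarrow> substructure V M N \<or> substructure V N M"
  shows "\<exists>U. is_union V U (C :: ('a, 'f, 'r) struct set)"
proof -
  let ?W = "\<Union>M\<in>C. univ M"
  have fin: "\<exists>M\<in>C. set xs \<subseteq> univ M" if "set xs \<subseteq> ?W" for xs
    using that
  proof (induction xs)
    case Nil then show ?case using ne by auto
  next
    case (Cons x xs)
    then obtain M N where MN: "M \<in> C" "set xs \<subseteq> univ M" "N \<in> C" "x \<in> univ N" by auto
    from ch[OF MN(1,3)] show ?case
    proof
      assume "substructure V M N"
      then show ?thesis using MN substructure_struct(3) by fastforce
    next
      assume "substructure V N M"
      then show ?thesis using MN substructure_struct(3) by fastforce
    qed
  qed
  \<comment> \<open>A tuple is finite, so some member of the chain contains it. Which one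
    \<open>p\<close> selects is irrelevant: of two members one is a substructure of the other, so
    they interpret the tuple alike.\<close>
  define p where "p xs = (SOME M. M \<in> C \<and> set xs \<subseteq> univ M)" for xs
  have p: "p xs \<in> C" "set xs \<subseteq> univ (p xs)" if "set xs \<subseteq> ?W" for xs
    using someI_ex[of "\<lambda>M. M \<in> C \<and> set xs \<subseteq> univ M"] fin[OF that] unfolding p_def by auto
  define U where "U = \<lparr>univ = ?W,
     fint = (\<lambda>F xs. if F \<in> Funs V \<and> length xs = farity V F \<and> set xs \<subseteq> ?W
                then fint (p xs) F xs else undefined),
     rint = (\<lambda>Q xs. Q \<in> Rels V \<and> length xs = rarity V Q \<and> set xs \<subseteq> ?W \<and> rint (p xs) Q xs)\<rparr>"
  have U: "univ U = ?W" by (simp add: U_def)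
  have sU: "is_struct V U"
    unfolding is_struct_def
  proof (intro conjI allI impI)
    obtain M where M: "M \<in> C" using ne by blast
    then have "univ M \<noteq> {}" using st[OF M] by (simp add: is_struct_def)
    then show "univ U \<noteq> {}" unfolding U using M by blast
    show "if F \<in> Funs V \<and> length xs = farity V F \<and> set xs \<subseteq> univ U then fint U F xs \<in> univ U
       else fint U F xs = undefined" for F xs
    proof (cases "F \<in> Funs V \<and> length xs = farity V F \<and> set xs \<subseteq> ?W")
      case True
      then have "fint (p xs) F xs \<in> univ (p xs)" using is_struct_fint[OF st] p by blast
      then show ?thesis using True p(1)[of xs] by (auto simp add: U_def)
    next
      case False
      then show ?thesis unfolding U_def by auto
    qed
  qed (simp_all add: U_def)
  have "substructure V M U" if M: "M \<in> C" for M
  proof -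
    have sub: "univ M \<subseteq> ?W" using M by blast
    have "fint M F xs = fint U F xs"
      if h: "F \<in> Funs V" "length xs = farity V F" "set xs \<subseteq> univ M" for F xs
    proof -
      have W: "set xs \<subseteq> ?W" using h sub by blast
      have "fint M F xs = fint (p xs) F xs"
        using ch[OF M p(1)[OF W]] h p(2)[OF W] unfolding substructure_def by auto
      then show ?thesis using h W by (simp add: U_def)
    qed
    moreover have "rint M Q xs = rint U Q xs"
      if h: "Q \<in> Rels V" "length xs = rarity V Q" "set xs \<subseteq> univ M" for Q xs
    proof -
      have W: "set xs \<subseteq> ?W" using h sub by blast
      have "rint M Q xs = rint (p xs) Q xs"
        using ch[OF M p(1)[OF W]] h p(2)[OF W] unfolding substructure_def by auto
      then show ?thesis using h W by (simp add: U_def)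
    qed
    ultimately show ?thesis
      unfolding substructure_def using st[OF M] sU sub U by simp
  qed
  then have "is_union V U C" unfolding is_union_def using sU U by blast
  then show ?thesis by blast
qed

section \<open>Chains, filtrations and embeddings\<close>

locale aec_succ = abstract_elementary_class K + succ_card lam
  for K :: "('a, 'f, 'r) aec" and lam :: "'c rel" +
  assumes room: "cardSuc lam <o |UNIV :: 'a set|"
    and LST: "LST_le K lam"
begin

abbreviation le_K (infix "\<preceq>" 50) where "M \<preceq> N \<equiv> le K M N"
abbreviation K0 where "K0 \<equiv> models_card K lam"
abbreviation K1 where "K1 \<equiv> models_card K R"
abbreviation V where "V \<equiv> voc K"

lemma le_univ: "M \<preceq> N \<Longrightarrow> univ M \<subseteq> univ N"
  using le_substructure substructure_struct(3) by blast

text \<open>Inclusion inside a common strong extension gives a substructure, which coherence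
  upgrades. Comparisons of models below thus reduce to comparisons of universes inside one large
  model.\<close>

lemma le_within: "A \<preceq> N \<Longrightarrow> B \<preceq> N \<Longrightarrow> univ A \<subseteq> univ B \<Longrightarrow> A \<preceq> B"
  using coherence substructure_within le_substructure by metis

lemma le_eq: "A \<preceq> N \<Longrightarrow> B \<preceq> N \<Longrightarrow> univ A = univ B \<Longrightarrow> A = B"
  using substructure_eq le_substructure by metis

lemma le_antisym: "A \<preceq> B \<Longrightarrow> univ A = univ B \<Longrightarrow> A = B"
  using le_eq le_refl le_models by metis

section \<open>Increasing continuous chains and their unions\<close>

lemma inc_cont_iff: "inc_cont K R I A \<longleftrightarrow> (\<forall>j\<in>I. \<forall>i. i \<sqsubseteq> j \<longrightarrow> A i \<preceq> A j) \<and>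
    (\<forall>j\<in>I. is_limit R j \<longrightarrow> is_union V (A j) (A ` {i. i \<sqsubset> j}))"
proof -
  have "underS R j = {i. i \<sqsubset> j}" "under R j = {i. i \<sqsubseteq> j}" for j by (rule set_eqI; simp)+
  then show ?thesis unfolding inc_cont_def by simp
qed

lemma is_union_leI:
  assumes "U \<in> models K" "univ U = (\<Union>M\<in>C. univ M)" "\<And>M. M \<in> C \<Longrightarrow> M \<preceq> U"
  shows "is_union V U C"
  unfolding is_union_def using assms models_struct le_substructure by blast

lemma inc_cont_le: "inc_cont K R I A \<Longrightarrow> j \<in> I \<Longrightarrow> i \<sqsubseteq> j \<Longrightarrow> A i \<preceq> A j"
  by (simp add: inc_cont_iff)

lemma inc_cont_limit: "inc_cont K R I A \<Longrightarrow> j \<in> I \<Longrightarrow> is_limit R j \<Longrightarrow> univ (A j) = (\<Union>i\<in>{i. i \<sqsubset> j}. univ (A i))"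
  unfolding inc_cont_iff is_union_def by simp

lemma inc_contI:
  assumes I: "\<And>i j. j \<in> I \<Longrightarrow> i \<sqsubseteq> j \<Longrightarrow> i \<in> I" "I \<subseteq> ord"
    and le: "\<And>i j. j \<in> I \<Longrightarrow> i \<sqsubseteq> j \<Longrightarrow> A i \<preceq> A j"
    and lim: "\<And>j. j \<in> I \<Longrightarrow> is_limit R j \<Longrightarrow> univ (A j) \<subseteq> (\<Union>i\<in>{i. i \<sqsubset> j}. univ (A i))"
  shows "inc_cont K R I A"
  unfolding inc_cont_iff
proof (intro conjI ballI allI impI)
  show "A i \<preceq> A j" if "j \<in> I" "i \<sqsubseteq> j" for i j using le that .
  show "is_union V (A j) (A ` {i. i \<sqsubset> j})" if j: "j \<in> I" "is_limit R j" for j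
  proof (rule is_union_leI)
    have l: "A i \<preceq> A j" if "i \<sqsubset> j" for i using le j(1) ilt_imp_ile that by blast
    have "A j \<preceq> A j" using le[OF j(1)] j I(2) by auto
    then show "A j \<in> models K" using le_models by blast
    show "univ (A j) = (\<Union>M\<in>A ` {i. i \<sqsubset> j}. univ M)" using lim[OF j] le_univ[OF l] by auto
    show "M \<preceq> A j" if "M \<in> A ` {i. i \<sqsubset> j}" for M using that l by blast
  qed
qed

lemma inc_cont_within:
  assumes I: "\<And>i j. j \<in> I \<Longrightarrow> i \<sqsubseteq> j \<Longrightarrow> i \<in> I" "I \<subseteq> ord"
    and le: "\<And>i. i \<in> I \<Longrightarrow> A i \<preceq> N"
    and mono: "\<And>i j. j \<in> I \<Longrightarrow> i \<sqsubset> j \<Longrightarrow> univ (A i) \<subseteq> univ (A j)"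
    and lim: "\<And>j. j \<in> I \<Longrightarrow> is_limit R j \<Longrightarrow> univ (A j) \<subseteq> (\<Union>i\<in>{i. i \<sqsubset> j}. univ (A i))"
  shows "inc_cont K R I A"
proof (rule inc_contI[OF I])
  show "A i \<preceq> A j" if "j \<in> I" "i \<sqsubseteq> j" for i j
    using le_within[OF le le] mono[OF that(1)] I(1)[OF that] that(1,2) unfolding ilt_iff by blast
qed (use lim in auto)

lemma ord_inj: "\<exists>e :: 'c set \<Rightarrow> 'a. inj_on e ord"
proof -
  have "|ord| \<le>o |UNIV :: 'a set|"
    using room R_card card_of_Field_ordIso ordIso_ordLess_trans ordLess_imp_ordLeq by blast
  then show ?thesis using card_of_ordLeq[of ord "UNIV :: 'a set"] by blast
qed

text \<open>The chain axioms are stated for well-orders on \<open>'a\<close>; the index set is carried over there.\<close>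

lemma chain_transfer:
  assumes I: "\<And>i j. j \<in> I \<Longrightarrow> i \<sqsubseteq> j \<Longrightarrow> i \<in> I" "I \<subseteq> ord"
    and A: "inc_cont K R I A"
  obtains r' :: "'a rel" and M where "Well_order r'" "inc_cont K r' (Field r') M" "M ` Field r' = A ` I"
proof -
  obtain e :: "'c set \<Rightarrow> 'a" where e0: "inj_on e ord" using ord_inj by blast
  then have e: "inj_on e I" using I(2) inj_on_subset by blast
  let ?S = "Restr R I"
  let ?r = "dir_image ?S e"
  have S: "Well_order ?S" using R_wo by (rule Well_order_Restr)
  have FS: "Field ?S = I" using I(2) ile_refl unfolding ile_def Field_def by blast
  have W: "Well_order ?r" using Well_order_dir_image[OF S] e FS by simp
  have F: "Field ?r = e ` I" using dir_image_Field[of ?S e] FS by simp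
  let ?M = "A \<circ> inv_into I e"
  have M [simp]: "?M (e i) = A i" if "i \<in> I" for i using inv_into_f_f[OF e that] by simp
  have mem: "(e i, e j) \<in> ?r \<longleftrightarrow> i \<sqsubseteq> j" if ij: "i \<in> I" "j \<in> I" for i j
  proof
    assume "(e i, e j) \<in> ?r"
    then obtain a b where ab: "e i = e a" "e j = e b" "(a, b) \<in> R" "a \<in> I" "b \<in> I"
      unfolding dir_image_def by blast
    then have "a = i" "b = j" using e ij unfolding inj_on_def by metis+
    then show "i \<sqsubseteq> j" using ab by (simp add: ile_def)
  next
    assume "i \<sqsubseteq> j"
    then show "(e i, e j) \<in> ?r" using ij unfolding dir_image_def ile_def by blast
  qed
  have dom: "\<exists>i\<in>I. x = e i" if "(x, y) \<in> ?r" for x y using that unfolding dir_image_def by blast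
  have uS: "underS ?r (e j) = e ` {i. i \<sqsubset> j}" if j: "j \<in> I" for j
  proof (rule set_eqI)
    fix x
    show "x \<in> underS ?r (e j) \<longleftrightarrow> x \<in> e ` {i. i \<sqsubset> j}"
    proof
      assume x: "x \<in> underS ?r (e j)"
      then obtain i where i: "i \<in> I" "x = e i" using dom unfolding underS_def by blast
      then have "i \<sqsubset> j" using x mem[OF i(1) j] unfolding underS_def ilt_iff by auto
      then show "x \<in> e ` {i. i \<sqsubset> j}" using i by blast
    next
      assume "x \<in> e ` {i. i \<sqsubset> j}"
      then obtain i where i: "i \<sqsubset> j" "x = e i" by blast
      have iI: "i \<in> I" using I(1)[OF j] i(1) by (simp add: ilt_iff)
      have "e i \<noteq> e j" using e iI j i(1) unfolding inj_on_def by (metis ilt_irrefl)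
      then show "x \<in> underS ?r (e j)" using mem[OF iI j] i unfolding underS_def ilt_iff by auto
    qed
  qed
  have "inc_cont K ?r (Field ?r) ?M"
    unfolding inc_cont_def
  proof (intro conjI ballI impI)
    fix y x assume y: "y \<in> Field ?r" and x: "x \<in> under ?r y"
    obtain j where j: "j \<in> I" "y = e j" using y F by blast
    obtain i where i: "i \<in> I" "x = e i" using dom x unfolding under_def by blast
    then have "i \<sqsubseteq> j" using x mem[OF i(1) j(1)] j unfolding under_def by simp
    then show "?M x \<preceq> ?M y" using inc_cont_le[OF A j(1)] M i j by metis
  next
    fix y assume y: "y \<in> Field ?r" and lim: "is_limit ?r y"
    obtain j where j: "j \<in> I" "y = e j" using y F by blast
    have down: "i \<in> I" if "i \<sqsubset> j" for i using I(1)[OF j(1)] that by (simp add: ilt_iff)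
    have "is_limit R j"
      unfolding is_limit_def
    proof (intro conjI ballI)
      show "j \<in> ord" using j I by blast
      show "underS R j \<noteq> {}"
      proof -
        obtain i where "i \<sqsubset> j" using lim unfolding is_limit_def j(2) uS[OF j(1)] by blast
        then show ?thesis using mem_underS by blast
      qed
      fix i assume "i \<in> underS R j"
      then have i: "i \<sqsubset> j" by simp
      then have "e i \<in> underS ?r y" using uS[OF j(1)] j by blast
      then obtain z where z: "z \<in> underS ?r y" "e i \<noteq> z" "(e i, z) \<in> ?r"
        using lim unfolding is_limit_def by blast
      then obtain k where k: "k \<sqsubset> j" "z = e k" using uS[OF j(1)] j by blast
      have "i \<sqsubseteq> k" using z(3) mem[OF down[OF i] down[OF k(1)]] k by blast
      then show "\<exists>k\<in>underS R j. i \<noteq> k \<and> (i, k) \<in> R"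
        using k z by (intro bexI[of _ k]) (auto simp: ile_def)
    qed
    then have "is_union V (A j) (A ` {i. i \<sqsubset> j})" using A j unfolding inc_cont_iff by blast
    moreover have "?M ` underS ?r y = A ` {i. i \<sqsubset> j}"
      unfolding j(2) uS[OF j(1)] image_image
      by (rule image_cong) (simp_all add: down M del: comp_apply)
    ultimately show "is_union V (?M y) (?M ` underS ?r y)" using j M by metis
  qed
  moreover have "?M ` Field ?r = A ` I"
    unfolding F image_image by (rule image_cong) (simp_all add: M del: comp_apply)
  ultimately show ?thesis using that W by blast
qed

lemma chain_limit:
  assumes I: "\<And>i j. j \<in> I \<Longrightarrow> i \<sqsubseteq> j \<Longrightarrow> i \<in> I" "I \<subseteq> ord" "I \<noteq> {}"
    and A: "inc_cont K R I A"
  shows "\<exists>U\<in>models K. univ U = (\<Union>i\<in>I. univ (A i)) \<and> (\<forall>i\<in>I. A i \<preceq> U) \<and>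
    (\<forall>N. (\<forall>i\<in>I. A i \<preceq> N) \<longrightarrow> U \<preceq> N)"
proof -
  obtain r' :: "'a rel" and M where r: "Well_order r'" "inc_cont K r' (Field r') M" "M ` Field r' = A ` I"
    using chain_transfer[OF I(1,2) A] .
  have ne: "Field r' \<noteq> {}" using r(3) I(3) by auto
  have "\<exists>U. is_union V U (A ` I)"
  proof (rule union_exists)
    show "A ` I \<noteq> {}" using I by blast
    have self: "A i \<preceq> A i" if "i \<in> I" for i using inc_cont_le[OF A that, of i] that I(2) by auto
    show "is_struct V M" if "M \<in> A ` I" for M using that self le_models models_struct by blast
    fix M N assume "M \<in> A ` I" "N \<in> A ` I"
    then obtain i j where ij: "i \<in> I" "j \<in> I" "M = A i" "N = A j" by blast
    have "i \<sqsubseteq> j \<or> j \<sqsubseteq> i" using ij I(2) ile_linear by blast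
    then show "substructure V M N \<or> substructure V N M"
      using ij inc_cont_le[OF A] le_substructure by blast
  qed
  then obtain U where U: "is_union V U (A ` I)" by blast
  have AU: "A i \<preceq> U" if "i \<in> I" for i
  proof -
    have "A i \<in> M ` Field r'" using that r(3) by blast
    then obtain x where "x \<in> Field r'" "A i = M x" by blast
    then show ?thesis using chain_union[OF r(1,2)] U r(3) by metis
  qed
  have "U \<preceq> N" if N: "\<forall>i\<in>I. A i \<preceq> N" for N
  proof (rule smoothness[OF r(1) ne r(2)])
    show "is_union V U (M ` Field r')" using U r(3) by simp
    fix x assume "x \<in> Field r'"
    then have "M x \<in> A ` I" using r(3) by blast
    then obtain i where "i \<in> I" "M x = A i" by blast
    then show "M x \<preceq> N" using N by simp
  qed
  moreover have "U \<in> models K" using AU I(3) le_models by blast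
  moreover have "univ U = (\<Union>i\<in>I. univ (A i))" using U unfolding is_union_def by simp
  ultimately show ?thesis using AU by blast
qed

lemma chain_limit_ord:
  assumes "inc_cont K R ord A"
  shows "\<exists>U\<in>models K. univ U = (\<Union>i\<in>ord. univ (A i)) \<and> (\<forall>i\<in>ord. A i \<preceq> U) \<and>
    (\<forall>N. (\<forall>i\<in>ord. A i \<preceq> N) \<longrightarrow> U \<preceq> N)"
  by (rule chain_limit[OF _ order_refl ord_ne assms]) (rule ile_ord(1))

section \<open>Sizes of models and the Loewenheim-Skolem property\<close>

lemma K_cardD: assumes "M \<in> models_card K mu" shows "M \<in> models K" "|univ M| \<le>o mu" "mu \<le>o |univ M|"
  using assms ordIso_imp_ordLeq ordIso_symmetric unfolding models_card_def by auto

lemma K_cardI: "M \<in> models K \<Longrightarrow> |univ M| \<le>o mu \<Longrightarrow> mu \<le>o |univ M| \<Longrightarrow> M \<in> models_card K mu"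
  unfolding models_card_def by (simp add: ordIso_iff_ordLeq)

lemma lam_le_R: "lam \<le>o R"
  using lam_less_R ordLess_imp_ordLeq by blast

lemma Loewenheim_Skolem:
  fixes mu :: "'d rel"
  assumes mu: "Card_order mu" "lam \<le>o mu"
    and N: "N \<in> models K" "mu \<le>o |univ N|" and A: "A \<subseteq> univ N" "|A| \<le>o mu"
  shows "\<exists>M\<in>models_card K mu. M \<preceq> N \<and> A \<subseteq> univ M"
proof -
  have inf: "infinite (Field mu)"
  proof -
    have "|Field lam| \<le>o |Field mu|" using mu(2) card_of_mono2 by blast
    then show ?thesis using lam_inf card_of_ordLeq_infinite by blast
  qed
  have "|Field mu| \<le>o |univ N|"
    using N(2) card_of_Field_ordIso[OF mu(1)] ordIso_ordLeq_trans by blast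
  then obtain f where f: "inj_on f (Field mu)" "f ` Field mu \<subseteq> univ N"
    using card_of_ordLeq[of "Field mu" "univ N"] by blast
  \<comment> \<open>Adding \<open>mu\<close> many elements of \<open>N\<close> forces the size to be
    exactly \<open>mu\<close>; the property itself only bounds it from above.\<close>
  let ?A = "A \<union> f ` Field mu"
  have "|f ` Field mu| \<le>o mu"
    using card_of_image ordLeq_ordIso_trans card_of_Field_ordIso[OF mu(1)] by blast
  then have A1: "|?A| \<le>o mu" by (rule card_of_Un_ordLeq_infinite_Field[OF inf A(2) _ mu(1)])
  have "|Field mu| \<le>o |?A|" using f(1) card_of_ordLeq[of "Field mu" ?A] by blast
  then have A2: "mu \<le>o |?A|"
    using card_of_Field_ordIso[OF mu(1)] ordIso_symmetric ordIso_ordLeq_trans by blast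
  obtain kappa :: "'c rel" where k: "Card_order kappa" "kappa \<le>o lam" "LS_property K kappa"
    using LST unfolding LST_le_def by blast
  have "?A \<subseteq> univ N" using A f by blast
  then obtain M where M: "M \<preceq> N" "?A \<subseteq> univ M" "|univ M| \<le>o kappa +c |?A|"
    using k(3) N(1) unfolding LS_property_def by blast
  have "kappa +c |?A| \<le>o mu"
    using csum_cinfinite_bound[OF ordLeq_transitive[OF k(2) mu(2)] A1 k(1) card_of_Card_order] inf mu(1)
    by (simp add: cinfinite_def)
  then have "|univ M| \<le>o mu" using M(3) ordLeq_transitive by blast
  moreover have "mu \<le>o |univ M|" using A2 card_of_mono1[OF M(2)] ordLeq_transitive by blast
  ultimately have "M \<in> models_card K mu" using K_cardI M(1) le_models by blast
  then show ?thesis using M by blast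
qed

lemma K1_lam: "M \<in> K1 \<Longrightarrow> lam \<le>o |univ M|"
  using K_cardD(3) lam_le_R ordLeq_transitive by blast

lemma LS_lam: "N \<in> models K \<Longrightarrow> lam \<le>o |univ N| \<Longrightarrow> A \<subseteq> univ N \<Longrightarrow> |A| \<le>o lam \<Longrightarrow>
    \<exists>M\<in>K0. M \<preceq> N \<and> A \<subseteq> univ M"
  using Loewenheim_Skolem[OF lam_card ordLeq_refl[OF lam_card]] by blast

lemma LS_R: "N \<in> models K \<Longrightarrow> R \<le>o |univ N| \<Longrightarrow> A \<subseteq> univ N \<Longrightarrow> |A| \<le>o R \<Longrightarrow>
    \<exists>M\<in>K1. M \<preceq> N \<and> A \<subseteq> univ M"
  using Loewenheim_Skolem[OF R_card lam_le_R] by blast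

lemma card_Un_R: "|A| \<le>o R \<Longrightarrow> |B| \<le>o R \<Longrightarrow> |A \<union> B| \<le>o R"
  by (rule card_of_Un_ordLeq_infinite_Field[OF R_inf _ _ R_card])

lemma card_UN_R:
  assumes "I \<subseteq> ord" "\<And>i. i \<in> I \<Longrightarrow> |F i| \<le>o R"
  shows "|\<Union>i\<in>I. F i| \<le>o R"
proof (rule card_of_UNION_ordLeq_infinite_Field[OF R_inf R_card])
  show "|I| \<le>o R"
    by (rule ordLeq_ordIso_trans[OF card_of_mono1[OF assms(1)] card_of_Field_ordIso[OF R_card]])
qed (use assms(2) in blast)

text \<open>The source of all disjointness: the type \<open>'a\<close> exceeds the successor of
  \<open>lam\<close>, so the complement of \<open>W\<close> and the image of \<open>Z\<close>
  together still has room for \<open>P - Z\<close>. Avoiding the image of \<open>Z\<close> as well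
  keeps the map injective.\<close>

lemma fresh_injection:
  fixes P :: "'b set" and W :: "'a set"
  assumes P: "|P| \<le>o R" and W: "|W| \<le>o R" and Z: "Z \<subseteq> P" "inj_on f Z"
  shows "\<exists>h. inj_on h P \<and> (\<forall>z\<in>Z. h z = f z) \<and> h ` (P - Z) \<inter> W = {}"
proof -
  let ?Y = "W \<union> f ` Z"
  have "|f ` Z| \<le>o R"
    by (rule ordLeq_transitive[OF card_of_image ordLeq_transitive[OF card_of_mono1[OF Z(1)] P]])
  then have Y: "|?Y| \<le>o R" by (rule card_Un_R[OF W])
  have "|P - Z| \<le>o |- ?Y|"
  proof (rule ccontr)
    assume "\<not> ?thesis"
    then have "|- ?Y| <o |P - Z|" by (simp only: not_ordLeq_iff_ordLess[OF card_of_Well_order card_of_Well_order] simp_thms)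
    moreover have "|P - Z| \<le>o R" by (rule ordLeq_transitive[OF card_of_mono1 P]) blast
    ultimately have "|- ?Y| \<le>o R" by (rule ordLess_imp_ordLeq[OF ordLess_ordLeq_trans])
    then have "|?Y \<union> - ?Y| \<le>o R" by (rule card_Un_R[OF Y])
    moreover have "?Y \<union> - ?Y = UNIV" by blast
    ultimately have "|UNIV :: 'a set| \<le>o R" by simp
    then show False using not_ordLess_ordLeq[OF room] by blast
  qed
  then obtain g where g: "inj_on g (P - Z)" "g ` (P - Z) \<subseteq> - ?Y"
    using card_of_ordLeq[of "P - Z" "- ?Y"] by blast
  let ?h = "\<lambda>x. if x \<in> Z then f x else g x"
  have "inj_on ?h P"
  proof (rule inj_onI)
    fix x y assume xy: "x \<in> P" "y \<in> P" "?h x = ?h y"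
    have Y: "f z \<in> ?Y" if "z \<in> Z" for z using that by blast
    have nY: "g z \<notin> ?Y" if "z \<in> P" "z \<notin> Z" for z using g(2) that by blast
    show "x = y"
    proof (cases "x \<in> Z"; cases "y \<in> Z")
      assume "x \<in> Z" "y \<in> Z" then show ?thesis using xy Z(2) by (simp add: inj_on_def)
    next
      assume "x \<notin> Z" "y \<notin> Z" then show ?thesis using xy g(1) by (simp add: inj_on_def)
    qed (use xy Y nY in \<open>metis\<close>)+
  qed
  moreover have "?h ` (P - Z) \<inter> W = {}" using g(2) by auto
  ultimately show ?thesis by (intro exI[of _ ?h]) simp
qed

section \<open>Filtrations\<close>

lemma filtrationI:
  assumes K0: "\<And>i. i \<in> ord \<Longrightarrow> A i \<in> K0" and le: "\<And>i. i \<in> ord \<Longrightarrow> A i \<preceq> M"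
    and mono: "\<And>i j. i \<sqsubset> j \<Longrightarrow> univ (A i) \<subseteq> univ (A j)"
    and lim: "\<And>j. is_limit R j \<Longrightarrow> univ (A j) \<subseteq> (\<Union>i\<in>{i. i \<sqsubset> j}. univ (A i))"
    and cov: "univ M \<subseteq> (\<Union>i\<in>ord. univ (A i))"
  shows "is_filtration K lam A M"
  unfolding is_filtration_def
proof (intro conjI ballI)
  show "inc_cont K R ord A"
    by (rule inc_cont_within[OF _ _ le mono lim]) (auto simp: ile_ord)
  show "is_union V M (A ` ord)"
  proof (rule is_union_leI)
    show "M \<in> models K" using le[OF oz_ord] le_models by blast
    show "univ M = (\<Union>M\<in>A ` ord. univ M)" using cov le_univ[OF le] by auto
    show "N \<preceq> M" if "N \<in> A ` ord" for N using that le by blast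
  qed
qed (use K0 le in auto)

lemma filtrationD:
  assumes "is_filtration K lam A M"
  shows filt_K0: "i \<in> ord \<Longrightarrow> A i \<in> K0" and filt_le: "i \<in> ord \<Longrightarrow> A i \<preceq> M"
    and filt_mono: "i \<sqsubseteq> j \<Longrightarrow> A i \<preceq> A j"
    and filt_limit: "is_limit R j \<Longrightarrow> univ (A j) = (\<Union>i\<in>{i. i \<sqsubset> j}. univ (A i))"
    and filt_union: "univ M = (\<Union>i\<in>ord. univ (A i))"
  using assms ile_ord(2) limit_ord unfolding is_filtration_def
  by (auto simp: inc_cont_le inc_cont_limit is_union_def)

lemma filt_mem: "is_filtration K lam A M \<Longrightarrow> x \<in> univ M \<Longrightarrow> \<exists>i\<in>ord. x \<in> univ (A i)"
  using filt_union by blast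

text \<open>By regularity, the stages at which at most \<open>lam\<close> many elements appear have
  a common bound.\<close>

lemma filt_cover:
  assumes A: "is_filtration K lam A M" and B: "B \<subseteq> univ M" "|B| \<le>o lam"
  shows "\<exists>j\<in>ord. B \<subseteq> univ (A j)"
proof -
  have "\<forall>b\<in>B. \<exists>i\<in>ord. b \<in> univ (A i)" using filt_mem[OF A] B by blast
  then obtain k where k: "\<And>b. b \<in> B \<Longrightarrow> k b \<in> ord \<and> b \<in> univ (A (k b))" by metis
  obtain j where j: "j \<in> ord" "\<And>b. b \<in> B \<Longrightarrow> k b \<sqsubset> j"
    using ord_bounded[OF _ card_image_lam[OF B(2)], of k] k by (auto simp: image_subset_iff)
  have "B \<subseteq> univ (A j)"
    using k le_univ[OF filt_mono[OF A ilt_imp_ile[OF j(2)]]] by blast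
  then show ?thesis using j by blast
qed

lemma chain_K0:
  assumes A: "inc_cont K R {i. i \<sqsubset> d} A" and d: "d \<in> ord" "d \<noteq> oz"
    and small: "\<forall>i. i \<sqsubset> d \<longrightarrow> A i \<in> K0"
  shows "\<exists>U\<in>K0. univ U = (\<Union>i\<in>{i. i \<sqsubset> d}. univ (A i)) \<and> (\<forall>i. i \<sqsubset> d \<longrightarrow> A i \<preceq> U) \<and>
    (\<forall>N. (\<forall>i. i \<sqsubset> d \<longrightarrow> A i \<preceq> N) \<longrightarrow> U \<preceq> N)"
proof -
  have oz: "oz \<sqsubset> d" using d oz_least ilt_iff by auto
  have K0: "A i \<in> K0" if "i \<sqsubset> d" for i using small that by blast
  obtain U where U: "U \<in> models K" "univ U = (\<Union>i\<in>{i. i \<sqsubset> d}. univ (A i))"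
    "\<forall>i. i \<sqsubset> d \<longrightarrow> A i \<preceq> U" "\<forall>N. (\<forall>i. i \<sqsubset> d \<longrightarrow> A i \<preceq> N) \<longrightarrow> U \<preceq> N"
  proof -
    have "{i. i \<sqsubset> d} \<subseteq> ord" "{i. i \<sqsubset> d} \<noteq> {}" using ilt_ord oz by blast+
    moreover have "i \<in> {i. i \<sqsubset> d}" if "j \<in> {i. i \<sqsubset> d}" "i \<sqsubseteq> j" for i j
      using that ile_ilt_trans by blast
    ultimately show ?thesis using that chain_limit[OF _ _ _ A] by auto
  qed
  have "|univ U| \<le>o lam"
    unfolding U(2) by (rule card_UN_lam[OF card_underS[OF d(1)] K_cardD(2)[OF K0]]) simp
  moreover have "lam \<le>o |univ U|"
    by (rule ordLeq_transitive[OF K_cardD(3)[OF K0[OF oz]] card_of_mono1[OF le_univ]]) (use U(3) oz in blast)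
  ultimately have "U \<in> K0" by (rule K_cardI[OF U(1)])
  then show ?thesis using U by blast
qed

lemma filtration_exists:
  assumes M: "M \<in> K1" and N: "N \<in> K0" "N \<preceq> M"
  shows "\<exists>A. is_filtration K lam A M \<and> A oz = N"
proof -
  have "|univ M| \<le>o |ord|"
    using K_cardD(2)[OF M] card_of_Field_ordIso[OF R_card] ordIso_symmetric ordLeq_ordIso_trans by blast
  then obtain e where e: "inj_on e (univ M)" "e ` univ M \<subseteq> ord"
    using card_of_ordLeq[of "univ M" ord] by blast
  \<comment> \<open>The element \<open>x\<close> enters at stage \<open>os (e x)\<close>. Using
    successor stages only leaves stage zero free to be \<open>N\<close> and limit stages free to be
    unions; at most one such element has to be accommodated at each stage.\<close>
  define P where "P A i X \<longleftrightarrow> X \<in> K0 \<and> X \<preceq> M \<and> (i = oz \<longrightarrow> X = N) \<and>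
     (\<forall>j. j \<sqsubset> i \<longrightarrow> univ (A j) \<subseteq> univ X) \<and> (\<forall>x\<in>univ M. i = os (e x) \<longrightarrow> x \<in> univ X) \<and>
     (is_limit R i \<longrightarrow> univ X \<subseteq> (\<Union>j\<in>{j. j \<sqsubset> i}. univ (A j)))"
    for A :: "'c set \<Rightarrow> ('a, 'f, 'r) struct" and i X
  have "\<exists>A. \<forall>i\<in>ord. P A i (A i)"
  proof (rule ord_recursion)
    show "P f i X = P g i X" if "\<And>z. z \<sqsubset> i \<Longrightarrow> f z = g z" for i f g X
      using that unfolding P_def by simp
    fix i A assume i: "i \<in> ord" and IH: "\<And>j. j \<sqsubset> i \<Longrightarrow> P A j (A j)"
    show "\<exists>X. P A i X"
    proof (cases "is_limit R i")
      case True
      have A: "inc_cont K R {j. j \<sqsubset> i} A"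
        by (rule inc_cont_within[where N = M])
          (use IH ile_ilt_trans ilt_ord in \<open>auto simp: P_def\<close>)
      have nz: "i \<noteq> oz" using True oz_not_limit by blast
      have "\<forall>j. j \<sqsubset> i \<longrightarrow> A j \<in> K0" using IH unfolding P_def by blast
      from chain_K0[OF A i nz this]
      obtain X where X: "X \<in> K0" "univ X = (\<Union>j\<in>{j. j \<sqsubset> i}. univ (A j))"
        "\<forall>Y. (\<forall>j. j \<sqsubset> i \<longrightarrow> A j \<preceq> Y) \<longrightarrow> X \<preceq> Y" by blast
      have "X \<preceq> M" using X(3) IH unfolding P_def by blast
      moreover have "i \<noteq> os (e x)" if "x \<in> univ M" for x using True os_not_limit e(2) that by blast
      ultimately have "P A i X" unfolding P_def using X nz by auto
      then show ?thesis by blast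
    next
      case False
      show ?thesis
      proof (cases "i = oz")
        case True
        have "oz \<noteq> os (e x)" if "x \<in> univ M" for x
          using os_ne_oz[of "e x"] e(2) that by (metis image_subset_iff)
        then have "P A i N" unfolding P_def using N False True by auto
        then show ?thesis by blast
      next
        case nz: False
        let ?B = "(\<Union>j\<in>{j. j \<sqsubset> i}. univ (A j)) \<union> {x \<in> univ M. i = os (e x)}"
        have sing: "\<exists>y. {x \<in> univ M. i = os (e x)} \<subseteq> {y}"
        proof -
          have "x = y" if "x \<in> univ M" "y \<in> univ M" "i = os (e x)" "i = os (e y)" for x y
          proof -
            have "e x \<in> ord" "e y \<in> ord" using e(2) that by blast+
            then have "e x = e y" using os_inject that by metis
            then show ?thesis using e(1) that by (simp add: inj_on_def)
          qed
          then show ?thesis by blast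
        qed
        have "|?B| \<le>o lam"
        proof (rule card_Un_lam)
          show "|\<Union>j\<in>{j. j \<sqsubset> i}. univ (A j)| \<le>o lam"
          proof (rule card_UN_lam[OF card_underS[OF i]])
            fix j assume "j \<in> {j. j \<sqsubset> i}"
            then have "A j \<in> K0" using IH unfolding P_def by blast
            then show "|univ (A j)| \<le>o lam" by (rule K_cardD(2))
          qed
          obtain y where "{x \<in> univ M. i = os (e x)} \<subseteq> {y}" using sing by blast
          then show "|{x \<in> univ M. i = os (e x)}| \<le>o lam"
            by (rule card_subset_lam[OF _ card_singleton_lam])
        qed
        moreover have "?B \<subseteq> univ M"
        proof -
          have "univ (A j) \<subseteq> univ M" if "j \<sqsubset> i" for j
            using le_univ[of "A j" M] IH[OF that] unfolding P_def by blast
          then show ?thesis by blast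
        qed
        ultimately obtain X where X: "X \<in> K0" "X \<preceq> M" "?B \<subseteq> univ X"
          using LS_lam[OF K_cardD(1)[OF M] K1_lam[OF M]] by blast
        then have "P A i X" unfolding P_def using False nz by auto
        then show ?thesis by blast
      qed
    qed
  qed
  then obtain A where A: "\<And>i. i \<in> ord \<Longrightarrow> P A i (A i)" by blast
  have "is_filtration K lam A M"
  proof (rule filtrationI)
    show "univ (A i) \<subseteq> univ (A j)" if "i \<sqsubset> j" for i j
      using A[OF ilt_ord(2)[OF that]] that unfolding P_def by blast
    show "univ (A j) \<subseteq> (\<Union>i\<in>{i. i \<sqsubset> j}. univ (A i))" if "is_limit R j" for j
      using A[OF limit_ord[OF that]] that unfolding P_def by blast
    show "univ M \<subseteq> (\<Union>i\<in>ord. univ (A i))"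
    proof
      fix x assume x: "x \<in> univ M"
      then have o: "os (e x) \<in> ord" using e(2) by auto
      then show "x \<in> (\<Union>i\<in>ord. univ (A i))" using A[OF o] x unfolding P_def by blast
    qed
  qed (use A in \<open>auto simp: P_def\<close>)
  moreover have "A oz = N" using A[OF oz_ord] unfolding P_def by blast
  ultimately show ?thesis by blast
qed

text \<open>Continuity of \<open>D\<close> turns limits into limits with the earlier values cofinal
  in them, and \<open>normal_ge\<close> guarantees that nothing of \<open>M\<close> is lost. This is
  how one passes to the levels in a club.\<close>

lemma filtration_reindex:
  assumes A: "is_filtration K lam A M" and D: "normal D"
  shows "is_filtration K lam (\<lambda>i. A (D i)) M"
proof (rule filtrationI)
  show "A (D i) \<in> K0" "A (D i) \<preceq> M" if "i \<in> ord" for i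
    using filt_K0[OF A] filt_le[OF A] normal_ord[OF D that] by blast+
  have D1: "D i \<sqsubset> D j" if "i \<sqsubset> j" for i j using D that unfolding normal_def by blast
  show "univ (A (D i)) \<subseteq> univ (A (D j))" if "i \<sqsubset> j" for i j
    by (rule le_univ[OF filt_mono[OF A ilt_imp_ile[OF D1[OF that]]]])
  show "univ (A (D j)) \<subseteq> (\<Union>i\<in>{i. i \<sqsubset> j}. univ (A (D i)))" if j: "is_limit R j" for j
  proof -
    have "is_limit R (D j)"
      unfolding is_limit_iff
    proof (intro conjI allI impI)
      show "D j \<in> ord" using normal_ord[OF D limit_ord[OF j]] .
      show "D j \<noteq> oz" using D1[OF limit_pos[OF j]] not_lt_oz by metis
      fix k assume "k \<sqsubset> D j"
      then obtain i where i: "i \<sqsubset> j" "k \<sqsubset> D i" using D j unfolding normal_def by blast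
      then have "os k \<sqsubseteq> D i" using os_le_iff ilt_ord by blast
      then show "os k \<sqsubset> D j" using D1[OF i(1)] ile_ilt_trans by blast
    qed
    show ?thesis
    proof
      fix x assume "x \<in> univ (A (D j))"
      then obtain k where k: "k \<sqsubset> D j" "x \<in> univ (A k)"
        using filt_limit[OF A \<open>is_limit R (D j)\<close>] by blast
      then obtain i where i: "i \<sqsubset> j" "k \<sqsubset> D i" using D j unfolding normal_def by blast
      then have "x \<in> univ (A (D i))" using k(2) le_univ[OF filt_mono[OF A ilt_imp_ile]] by blast
      then show "x \<in> (\<Union>i\<in>{i. i \<sqsubset> j}. univ (A (D i)))" using i by blast
    qed
  qed
  show "univ M \<subseteq> (\<Union>i\<in>ord. univ (A (D i)))"
  proof
    fix x assume "x \<in> univ M"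
    then obtain i where i: "i \<in> ord" "x \<in> univ (A i)" using filt_mem[OF A] by blast
    then have "x \<in> univ (A (D i))" using le_univ[OF filt_mono[OF A normal_ge[OF D i(1)]]] by blast
    then show "x \<in> (\<Union>i\<in>ord. univ (A (D i)))" using i by blast
  qed
qed

section \<open>Isomorphic copies and embeddings\<close>

lemma iso_le: "is_iso V h N N' \<Longrightarrow> M \<preceq> N \<Longrightarrow> is_iso V h M (img V h M)"
  using is_iso_substructure(1) le_substructure by blast

lemma img_le: "is_iso V h N N' \<Longrightarrow> M \<preceq> N \<Longrightarrow> img V h M \<preceq> N'"
  using le_iso iso_le by blast

lemma iso_card:
  assumes h: "is_iso V h M M'" and M: "M \<in> models_card K mu"
  shows "M' \<in> models_card K mu"
proof -
  have "|univ M| =o |univ M'|" using h card_of_ordIso unfolding is_iso_def by blast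
  then show ?thesis using M models_iso[OF _ h] ordIso_symmetric ordIso_transitive
    unfolding models_card_def by blast
qed

lemma filtration_iso:
  assumes A: "is_filtration K lam A M" and h: "is_iso V h M M'"
  shows "is_filtration K lam (\<lambda>i. img V h (A i)) M'"
proof (rule filtrationI)
  show "img V h (A i) \<in> K0" if "i \<in> ord" for i
    using iso_card[OF iso_le[OF h filt_le[OF A that]] filt_K0[OF A that]] .
  show "img V h (A i) \<preceq> M'" if "i \<in> ord" for i using img_le[OF h filt_le[OF A that]] .
  show "univ (img V h (A i)) \<subseteq> univ (img V h (A j))" if "i \<sqsubset> j" for i j
    using le_univ[OF filt_mono[OF A ilt_imp_ile[OF that]]] by auto
  show "univ (img V h (A j)) \<subseteq> (\<Union>i\<in>{i. i \<sqsubset> j}. univ (img V h (A i)))" if "is_limit R j" for j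
    using filt_limit[OF A that] by auto
  show "univ M' \<subseteq> (\<Union>i\<in>ord. univ (img V h (A i)))"
    using is_iso_univ[OF h] filt_union[OF A] by auto
qed

lemma embedding_iff: "is_embedding K f M N \<longleftrightarrow> is_iso V f M (img V f M) \<and> img V f M \<preceq> N"
  unfolding is_embedding_def using is_iso_unique by metis

lemma embedding_img: "is_embedding K f M N \<Longrightarrow> img V f M \<preceq> N"
  and embedding_iso: "is_embedding K f M N \<Longrightarrow> is_iso V f M (img V f M)"
  by (simp_all add: embedding_iff)

lemma embedding_id: "M \<preceq> N \<Longrightarrow> is_embedding K id M N"
  unfolding is_embedding_def using is_iso_id models_struct le_models by blast

lemma embedding_of_iso: "is_iso V f M N \<Longrightarrow> N \<in> models K \<Longrightarrow> is_embedding K f M N"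
  unfolding is_embedding_def using le_refl by blast

lemma embedding_comp:
  assumes f: "is_embedding K f M N" and g: "is_embedding K g N P"
  shows "is_embedding K (g \<circ> f) M P"
proof -
  have f1: "is_iso V f M (img V f M)" "img V f M \<preceq> N" using f embedding_iff by blast+
  have g1: "is_iso V g N (img V g N)" "img V g N \<preceq> P" using g embedding_iff by blast+
  have "is_iso V (g \<circ> f) M (img V g (img V f M))"
    by (rule is_iso_comp[OF f1(1) iso_le[OF g1(1) f1(2)]])
  moreover have "img V g (img V f M) \<preceq> P" using img_le[OF g1(1) f1(2)] g1(2) le_trans by blast
  ultimately show ?thesis unfolding is_embedding_def by blast
qed

lemma embedding_sub: "is_embedding K f M N \<Longrightarrow> M' \<preceq> M \<Longrightarrow> is_embedding K f M' N"
  using embedding_comp[OF embedding_id, of M' M f N] by simp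

lemma embedding_into: "is_embedding K f M N \<Longrightarrow> N' \<preceq> N \<Longrightarrow> f ` univ M \<subseteq> univ N' \<Longrightarrow> is_embedding K f M N'"
  using embedding_iff le_within[of "img V f M" N N'] by simp

lemma embedding_inj: "is_embedding K f M N \<Longrightarrow> inj_on f (univ M)"
  using embedding_iso is_iso_inj by blast

lemma embedding_image: "is_embedding K f M N \<Longrightarrow> f ` univ M \<subseteq> univ N"
  using embedding_img le_univ by fastforce

lemma embedding_models: assumes "is_embedding K f M N" shows "N \<in> models K"
  using embedding_img[OF assms] le_models by blast

text \<open>Replacing the target by a copy turns an embedding into an inclusion; there is room for
  the new elements to avoid a given small set.\<close>

lemma embedding_inclusion:
  assumes f: "is_embedding K f Q P" and P: "|univ P| \<le>o R" and W: "|W| \<le>o R"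
  obtains h P' where "is_iso V h P P'" "Q \<preceq> P'" "\<And>x. x \<in> univ Q \<Longrightarrow> h (f x) = x"
    "univ P' \<inter> W \<subseteq> univ Q"
proof -
  have i: "inj_on f (univ Q)" using embedding_inj[OF f] .
  have "inj_on (inv_into (univ Q) f) (f ` univ Q)" by (rule inj_on_inv_into) simp
  \<comment> \<open>\<open>h\<close> extends the inverse of \<open>f\<close> and sends the remaining
    elements of \<open>P\<close> outside \<open>W\<close>, so the copy contains \<open>Q\<close> and
    meets \<open>W\<close> only inside it.\<close>
  then obtain h where h: "inj_on h (univ P)" "\<forall>z\<in>f ` univ Q. h z = inv_into (univ Q) f z"
    "h ` (univ P - f ` univ Q) \<inter> W = {}"
    using fresh_injection[OF P W embedding_image[OF f], of "inv_into (univ Q) f"] by blast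
  have hf: "h (f x) = x" if "x \<in> univ Q" for x using h(2) i that by simp
  have PK: "P \<in> models K" using embedding_models[OF f] .
  have iso: "is_iso V h P (img V h P)" using is_iso_img models_struct PK h(1) by blast
  have "is_iso V (h \<circ> f) Q (img V h (img V f Q))"
    by (rule is_iso_comp[OF embedding_iso[OF f] iso_le[OF iso embedding_img[OF f]]])
  then have "is_iso V id Q (img V h (img V f Q))" by (rule is_iso_cong) (simp add: hf)
  moreover have "is_iso V id Q Q" using is_iso_id is_iso_struct[OF embedding_iso[OF f]] by blast
  ultimately have "img V h (img V f Q) = Q" using is_iso_unique by metis
  then have "Q \<preceq> img V h P" using img_le[OF iso embedding_img[OF f]] by simp
  moreover have "univ (img V h P) \<inter> W \<subseteq> univ Q"
  proof
    fix y assume y: "y \<in> univ (img V h P) \<inter> W"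
    then obtain x where x: "x \<in> univ P" "y = h x" by auto
    then have "x \<in> f ` univ Q" using h(3) y by blast
    then show "y \<in> univ Q" using x hf by auto
  qed
  ultimately show ?thesis using that iso hf by blast
qed

text \<open>Amalgams come without a bound on their size. Cutting the target down around the two
  images returns to size \<open>\<lambda>\<^sup>+\<close>, where amalgamation can be applied
  again.\<close>

lemma embedding_shrink:
  assumes "is_embedding K f1 Q1 P" "is_embedding K f2 Q2 P" "Q1 \<in> K1" "Q2 \<in> K1"
  shows "\<exists>P'\<in>K1. P' \<preceq> P \<and> is_embedding K f1 Q1 P' \<and> is_embedding K f2 Q2 P'"
proof -
  have b: "|f1 ` univ Q1 \<union> f2 ` univ Q2| \<le>o R"
    by (rule card_Un_R; rule ordLeq_transitive[OF card_of_image K_cardD(2)]; fact)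
  have "|univ Q1| \<le>o |univ P|"
    using card_of_ordLeq[of "univ Q1" "univ P"] embedding_inj[OF assms(1)] embedding_image[OF assms(1)] by blast
  then have c: "R \<le>o |univ P|" by (rule ordLeq_transitive[OF K_cardD(3)[OF assms(3)]])
  have "f1 ` univ Q1 \<union> f2 ` univ Q2 \<subseteq> univ P"
    using embedding_image[OF assms(1)] embedding_image[OF assms(2)] by blast
  from LS_R[OF embedding_models[OF assms(1)] c this b]
  obtain P' where P': "P' \<in> K1" "P' \<preceq> P" "f1 ` univ Q1 \<union> f2 ` univ Q2 \<subseteq> univ P'" by blast
  have "is_embedding K f1 Q1 P'" by (rule embedding_into[OF assms(1) P'(2)]) (use P'(3) in simp)
  moreover have "is_embedding K f2 Q2 P'" by (rule embedding_into[OF assms(2) P'(2)]) (use P'(3) in simp)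
  ultimately show ?thesis using P'(1,2) by blast
qed

text \<open>Smoothness speaks of some union of the earlier levels; antisymmetry identifies that
  union with \<open>A i\<close>, so smoothness transfers to the level itself.\<close>

lemma filt_smooth:
  assumes A: "is_filtration K lam A M" and i: "is_limit R i" and X: "\<And>j. j \<sqsubset> i \<Longrightarrow> A j \<preceq> X"
  shows "A i \<preceq> X"
proof -
  have ic: "inc_cont K R {j. j \<sqsubset> i} A"
  proof -
    have "{j. j \<sqsubset> i} \<subseteq> ord" using ilt_ord(1) by blast
    moreover have "inc_cont K R ord A" using A unfolding is_filtration_def by blast
    ultimately show ?thesis unfolding inc_cont_def by (simp add: subset_iff)
  qed
  have nz: "i \<noteq> oz" using i oz_not_limit by blast
  have "\<forall>j. j \<sqsubset> i \<longrightarrow> A j \<in> K0" using filt_K0[OF A ilt_ord(1)] by blast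
  from chain_K0[OF ic limit_ord[OF i] nz this]
  obtain U where U: "univ U = (\<Union>j\<in>{j. j \<sqsubset> i}. univ (A j))"
    "\<forall>N. (\<forall>j. j \<sqsubset> i \<longrightarrow> A j \<preceq> N) \<longrightarrow> U \<preceq> N"
    by blast
  have "\<forall>j. j \<sqsubset> i \<longrightarrow> A j \<preceq> A i" using filt_mono[OF A ilt_imp_ile] by blast
  then have "U \<preceq> A i" using U(2) by blast
  then have "U = A i" by (rule le_antisym) (simp add: U(1) filt_limit[OF A i])
  then show ?thesis using U(2) X by blast
qed

lemma chain_K1:
  assumes A: "inc_cont K R I A" and I: "\<And>i j. j \<in> I \<Longrightarrow> i \<sqsubseteq> j \<Longrightarrow> i \<in> I" "I \<subseteq> ord" "oz \<in> I"
    and K: "\<And>i. i \<in> I \<Longrightarrow> A i \<in> K1"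
  shows "\<exists>U\<in>K1. univ U = (\<Union>i\<in>I. univ (A i)) \<and> (\<forall>i\<in>I. A i \<preceq> U) \<and>
    (\<forall>N. (\<forall>i\<in>I. A i \<preceq> N) \<longrightarrow> U \<preceq> N)"
proof -
  have "I \<noteq> {}" using I(3) by blast
  have "\<exists>U\<in>models K. univ U = (\<Union>i\<in>I. univ (A i)) \<and> (\<forall>i\<in>I. A i \<preceq> U) \<and>
    (\<forall>N. (\<forall>i\<in>I. A i \<preceq> N) \<longrightarrow> U \<preceq> N)"
    by (rule chain_limit[OF _ I(2) \<open>I \<noteq> {}\<close> A]) (rule I(1))
  then obtain U where U: "U \<in> models K" "univ U = (\<Union>i\<in>I. univ (A i))" "\<forall>i\<in>I. A i \<preceq> U"
    "\<forall>N. (\<forall>i\<in>I. A i \<preceq> N) \<longrightarrow> U \<preceq> N" by blast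
  have "|univ U| \<le>o R" unfolding U(2) by (rule card_UN_R[OF I(2) K_cardD(2)[OF K]])
  moreover have "R \<le>o |univ U|"
    by (rule ordLeq_transitive[OF K_cardD(3)[OF K[OF I(3)]] card_of_mono1[OF le_univ]]) (use U(3) I(3) in blast)
  ultimately have "U \<in> K1" by (rule K_cardI[OF U(1)])
  then show ?thesis using U by blast
qed

lemma K1_submodel:
  assumes "X \<in> K1"
  shows "\<exists>X0\<in>K0. X0 \<preceq> X"
proof -
  have "|{} :: 'a set| \<le>o lam" by (rule card_of_empty1) (simp add: lam_card)
  from LS_lam[OF K_cardD(1)[OF assms] K1_lam[OF assms] empty_subsetI this] show ?thesis by blast
qed

text \<open>Close \<open>d\<close> under the stages at which elements of \<open>B i\<close> in
  \<open>M\<close> appear in \<open>A\<close>, and under those at which elements of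
  \<open>A i\<close> appear in \<open>B\<close>. For \<open>M = N\<close> this says that any two
  filtrations of a model coincide on a club.\<close>

lemma club_filtrations_agree:
  assumes A: "is_filtration K lam A M" and B: "is_filtration K lam B N" and MN: "M \<preceq> N"
  shows "club (\<lambda>d. univ (A d) = univ (B d) \<inter> univ M)"
proof -
  have "\<forall>x\<in>univ M. \<exists>i. i \<in> ord \<and> x \<in> univ (A i)" using filt_mem[OF A] by blast
  then obtain p where p: "\<forall>x\<in>univ M. p x \<in> ord \<and> x \<in> univ (A (p x))" by (rule bchoice[THEN exE])
  have "\<forall>x\<in>univ N. \<exists>i. i \<in> ord \<and> x \<in> univ (B i)" using filt_mem[OF B] by blast
  then obtain q where q: "\<forall>x\<in>univ N. q x \<in> ord \<and> x \<in> univ (B (q x))" by (rule bchoice[THEN exE])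
  let ?S = "\<lambda>i. p ` (univ (B i) \<inter> univ M) \<union> q ` univ (A i)"
  have AN: "univ (A i) \<subseteq> univ N" if "i \<in> ord" for i
    using le_univ[OF filt_le[OF A that]] le_univ[OF MN] by blast
  have "club (\<lambda>d. is_limit R d \<and> (\<forall>i. i \<sqsubset> d \<longrightarrow> (\<forall>b\<in>?S i. b \<sqsubset> d)))"
  proof (rule club_bound)
    fix i assume i: "i \<in> ord"
    show "?S i \<subseteq> ord" using p q AN[OF i] by blast
    have "|univ (B i) \<inter> univ M| \<le>o lam"
      by (rule card_subset_lam[OF Int_lower1 K_cardD(2)[OF filt_K0[OF B i]]])
    then show "|?S i| \<le>o lam"
      by (rule card_Un_lam[OF card_image_lam card_image_lam[OF K_cardD(2)[OF filt_K0[OF A i]]]])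
  qed
  then show ?thesis
  proof (rule club_mono)
    fix d assume d: "is_limit R d \<and> (\<forall>i. i \<sqsubset> d \<longrightarrow> (\<forall>b\<in>?S i. b \<sqsubset> d))"
    then have L: "is_limit R d" by blast
    note do = limit_ord[OF L]
    show "univ (A d) = univ (B d) \<inter> univ M"
    proof (intro equalityI subsetI IntI)
      fix x assume x: "x \<in> univ (A d)"
      show xM: "x \<in> univ M" using x le_univ[OF filt_le[OF A do]] by blast
      obtain i where i: "i \<sqsubset> d" "x \<in> univ (A i)" using x filt_limit[OF A L] by blast
      then have "q x \<sqsubset> d" using d by blast
      moreover have "x \<in> univ (B (q x))" using q xM le_univ[OF MN] by blast
      ultimately show "x \<in> univ (B d)" using le_univ[OF filt_mono[OF B ilt_imp_ile]] by blast
    next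
      fix x assume x: "x \<in> univ (B d) \<inter> univ M"
      then obtain i where i: "i \<sqsubset> d" "x \<in> univ (B i)" using filt_limit[OF B L] by blast
      then have "p x \<in> ?S i" using x by blast
      then have "p x \<sqsubset> d" using d i(1) by blast
      moreover have "x \<in> univ (A (p x))" using p x by blast
      ultimately show "x \<in> univ (A d)" using le_univ[OF filt_mono[OF A ilt_imp_ile]] by blast
    qed
  qed
qed

section \<open>Galois types\<close>

lemma E_starI:
  assumes "M \<preceq> N1" "M \<preceq> N2" "a \<in> univ N1" "b \<in> univ N2"
    and "is_embedding K f1 N1 P" "is_embedding K f2 N2 P"
    and "\<And>x. x \<in> univ M \<Longrightarrow> f1 x = x" "\<And>x. x \<in> univ M \<Longrightarrow> f2 x = x" "f1 a = f2 b"
  shows "((M, N1, a), (M, N2, b)) \<in> E_star K"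
  unfolding E_star_def is_amalgamation_def using assms by blast

lemma E_starE:
  assumes "((M, N1, a), y) \<in> E_star K"
  obtains N2 b f1 f2 P where "y = (M, N2, b)" "M \<preceq> N1" "M \<preceq> N2" "a \<in> univ N1" "b \<in> univ N2"
    "is_embedding K f1 N1 P" "is_embedding K f2 N2 P"
    "\<And>x. x \<in> univ M \<Longrightarrow> f1 x = x" "\<And>x. x \<in> univ M \<Longrightarrow> f2 x = x" "f1 a = f2 b"
  using assms unfolding E_star_def is_amalgamation_def by blast

lemma sym_E_star: "sym (E_star K)"
proof (rule symI)
  fix x y assume "(x, y) \<in> E_star K"
  moreover obtain M N1 a where x: "x = (M, N1, a)" by (cases x)
  ultimately have "((M, N1, a), y) \<in> E_star K" by simp
  then show "(y, x) \<in> E_star K" unfolding x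
    by (rule E_starE) (simp add: E_starI)
qed

lemma E_star_refl: "M \<preceq> N \<Longrightarrow> a \<in> univ N \<Longrightarrow> ((M, N, a), (M, N, a)) \<in> E_star K"
  by (rule E_starI[of _ _ _ _ _ id N id]) (auto intro!: embedding_id le_refl dest: le_models)

lemma tp_self: "M \<preceq> N \<Longrightarrow> a \<in> univ N \<Longrightarrow> (M, N, a) \<in> tp K a M N"
  unfolding tp_def using E_star_refl by blast

lemma tp_iff: "y \<in> tp K a M N \<longleftrightarrow> ((M, N, a), y) \<in> (E_star K)\<^sup>+"
  unfolding tp_def by blast

lemma tp_eqI:
  assumes "((M, N1, a), (M', N2, b)) \<in> (E_star K)\<^sup>+"
  shows "tp K a M N1 = tp K b M' N2"
proof -
  have "((M', N2, b), (M, N1, a)) \<in> (E_star K)\<^sup>+"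
    using sym_trancl[OF sym_E_star] assms by (rule symD)
  then show ?thesis unfolding tp_def using assms trancl_trans[of _ _ "E_star K"] by blast
qed

lemma tp_eqD: "tp K a M N1 = tp K b M N2 \<Longrightarrow> M \<preceq> N2 \<Longrightarrow> b \<in> univ N2 \<Longrightarrow>
    ((M, N1, a), (M, N2, b)) \<in> (E_star K)\<^sup>+"
  using tp_self tp_iff by blast

text \<open>An amalgam over \<open>M\<close> is also one over the smaller \<open>M0\<close>. Applied
  along the chain of steps, this makes the restriction of a type independent of its
  representative.\<close>

lemma E_trancl_restrict:
  assumes "((M, N, a), y) \<in> (E_star K)\<^sup>+" and M0: "M0 \<preceq> M"
  shows "\<exists>N' b. y = (M, N', b) \<and> ((M0, N, a), (M0, N', b)) \<in> (E_star K)\<^sup>+"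
  using assms(1)
proof (induction rule: trancl_induct)
  case (base y)
  then obtain N2 b f1 f2 P where y: "y = (M, N2, b)" "M \<preceq> N" "M \<preceq> N2" "a \<in> univ N" "b \<in> univ N2"
    "is_embedding K f1 N P" "is_embedding K f2 N2 P"
    "\<And>x. x \<in> univ M \<Longrightarrow> f1 x = x" "\<And>x. x \<in> univ M \<Longrightarrow> f2 x = x" "f1 a = f2 b"
    by (rule E_starE) blast
  have "((M0, N, a), (M0, N2, b)) \<in> E_star K"
    by (rule E_starI[OF _ _ y(4,5,6,7)]) (use y le_trans[OF M0] le_univ[OF M0] in auto)
  then show ?case using y(1) by blast
next
  case (step y z)
  then obtain N1 c where c: "y = (M, N1, c)" "((M0, N, a), (M0, N1, c)) \<in> (E_star K)\<^sup>+" by blast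
  then have "((M, N1, c), z) \<in> E_star K" using step by simp
  then obtain N2 b f1 f2 P where y: "z = (M, N2, b)" "M \<preceq> N1" "M \<preceq> N2" "c \<in> univ N1" "b \<in> univ N2"
    "is_embedding K f1 N1 P" "is_embedding K f2 N2 P"
    "\<And>x. x \<in> univ M \<Longrightarrow> f1 x = x" "\<And>x. x \<in> univ M \<Longrightarrow> f2 x = x" "f1 c = f2 b"
    by (rule E_starE) blast
  have "((M0, N1, c), (M0, N2, b)) \<in> E_star K"
    by (rule E_starI[OF _ _ y(4,5,6,7)]) (use y le_trans[OF M0] le_univ[OF M0] in auto)
  then show ?case using y(1) c(2) trancl_into_trancl by fast
qed

lemma restrict_tp:
  assumes M: "M0 \<preceq> M" "M \<preceq> N" "a \<in> univ N"
  shows "restrict_type K (tp K a M N) M0 = tp K a M0 N"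
proof -
  have "tp K b M0 N' = tp K a M0 N" if "(M', N', b) \<in> tp K a M N" for M' N' b
  proof -
    have "((M0, N, a), (M0, N', b)) \<in> (E_star K)\<^sup>+"
      using E_trancl_restrict[OF _ M(1)] that unfolding tp_iff by blast
    then show ?thesis by (rule tp_eqI[symmetric])
  qed
  then show ?thesis unfolding restrict_type_def using tp_self[OF M(2,3)] by fast
qed

lemma tp_embedding:
  assumes M: "M \<preceq> N" "M \<preceq> N'" and h: "is_embedding K h N N'"
    and "\<And>x. x \<in> univ M \<Longrightarrow> h x = x" "a \<in> univ N"
  shows "tp K (h a) M N' = tp K a M N"
proof (rule tp_eqI[symmetric], rule r_into_trancl)
  have "N' \<preceq> N'" using M(2) le_models le_refl by blast
  then show "((M, N, a), (M, N', h a)) \<in> E_star K"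
    by (intro E_starI[OF M _ _ h embedding_id]) (use assms embedding_image[OF h] in auto)
qed

lemma tp_mono: "M \<preceq> N \<Longrightarrow> N \<preceq> N' \<Longrightarrow> a \<in> univ N \<Longrightarrow> tp K a M N' = tp K a M N"
  using tp_embedding[OF _ _ embedding_id, of M N N' a] le_trans by simp

section \<open>Equality of types over models of size \<open>\<lambda>\<^sup>+\<close>\<close>

text \<open>Amalgamation is stated for inclusions, so both targets are first replaced by copies that
  contain \<open>Q\<close> itself.\<close>

lemma amalgamation_embeddings:
  assumes ap: "amalgamation_property K R" and Q: "Q \<in> K1"
    and f: "is_embedding K f Q P1" "P1 \<in> K1" and g: "is_embedding K g Q P2" "P2 \<in> K1"
  shows "\<exists>k1 k2 P. is_embedding K k1 P1 P \<and> is_embedding K k2 P2 P \<and> (\<forall>x\<in>univ Q. k1 (f x) = x \<and> k2 (g x) = x)"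
proof -
  have e: "|{} :: 'a set| \<le>o R" by (rule card_of_empty1) (simp add: R_wo)
  obtain h1 P1' where 1: "is_iso V h1 P1 P1'" "Q \<preceq> P1'" "\<And>x. x \<in> univ Q \<Longrightarrow> h1 (f x) = x"
    by (rule embedding_inclusion[OF f(1) K_cardD(2)[OF f(2)] e]) blast
  obtain h2 P2' where 2: "is_iso V h2 P2 P2'" "Q \<preceq> P2'" "\<And>x. x \<in> univ Q \<Longrightarrow> h2 (g x) = x"
    by (rule embedding_inclusion[OF g(1) K_cardD(2)[OF g(2)] e]) blast
  note c = iso_card[OF 1(1) f(2)] iso_card[OF 2(1) g(2)]
  obtain k1 k2 P where k: "is_amalgamation K Q P1' P2' k1 k2 P"
    using ap Q c 1(2) 2(2) unfolding amalgamation_property_def by blast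
  have "is_embedding K (k1 \<circ> h1) P1 P" "is_embedding K (k2 \<circ> h2) P2 P"
    using k embedding_comp embedding_of_iso[OF 1(1) K_cardD(1)[OF c(1)]]
      embedding_of_iso[OF 2(1) K_cardD(1)[OF c(2)]] unfolding is_amalgamation_def by blast+
  moreover have "\<forall>x\<in>univ Q. (k1 \<circ> h1) (f x) = x \<and> (k2 \<circ> h2) (g x) = x"
    using k 1(3) 2(3) unfolding is_amalgamation_def by simp
  ultimately show ?thesis by blast
qed

text \<open>Types over a model of size \<open>\<lambda>\<^sup>+\<close>: the intermediate models in a chain of \<open>E\<^sup>*\<close>-steps can
  be cut down to size \<open>\<lambda>\<^sup>+\<close>, so that amalgamation composes the steps into one.\<close>

lemma E_trancl_amalgamation:
  assumes ap: "amalgamation_property K R" and M: "M \<in> K1"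
    and E: "((M, N, a), y) \<in> (E_star K)\<^sup>+"
    and Q: "Q \<in> K1" "M \<preceq> Q" "Q \<preceq> N" "a \<in> univ Q"
  shows "\<exists>N' b. y = (M, N', b) \<and> M \<preceq> N' \<and> (\<forall>Q'\<in>K1. M \<preceq> Q' \<longrightarrow> Q' \<preceq> N' \<longrightarrow> b \<in> univ Q' \<longrightarrow>
    (\<exists>P\<in>K1. \<exists>f1 f2. is_embedding K f1 Q P \<and> is_embedding K f2 Q' P \<and>
       (\<forall>x\<in>univ M. f1 x = x \<and> f2 x = x) \<and> f1 a = f2 b)) \<and> b \<in> univ N'"
  using E
proof (induction rule: trancl_induct)
  case (base y)
  then obtain N2 b f1 f2 P where y: "y = (M, N2, b)" "M \<preceq> N" "M \<preceq> N2" "a \<in> univ N" "b \<in> univ N2"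
    "is_embedding K f1 N P" "is_embedding K f2 N2 P"
    "\<And>x. x \<in> univ M \<Longrightarrow> f1 x = x" "\<And>x. x \<in> univ M \<Longrightarrow> f2 x = x" "f1 a = f2 b"
    by (rule E_starE) blast
  have "\<exists>P\<in>K1. \<exists>f1 f2. is_embedding K f1 Q P \<and> is_embedding K f2 Q' P \<and>
       (\<forall>x\<in>univ M. f1 x = x \<and> f2 x = x) \<and> f1 a = f2 b" if Q': "Q' \<in> K1" "Q' \<preceq> N2" for Q'
  proof -
    obtain P' where "P' \<in> K1" "is_embedding K f1 Q P'" "is_embedding K f2 Q' P'"
      using embedding_shrink[OF embedding_sub[OF y(6) Q(3)] embedding_sub[OF y(7) Q'(2)] Q(1) Q'(1)] by blast
    then show ?thesis using y(8-10) by blast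
  qed
  then show ?case using y by blast
next
  case (step y z)
  then obtain N1 c where c: "y = (M, N1, c)" "M \<preceq> N1" "c \<in> univ N1"
    and IH: "\<And>Q'. Q' \<in> K1 \<Longrightarrow> M \<preceq> Q' \<Longrightarrow> Q' \<preceq> N1 \<Longrightarrow> c \<in> univ Q' \<Longrightarrow>
      \<exists>P\<in>K1. \<exists>f1 f2. is_embedding K f1 Q P \<and> is_embedding K f2 Q' P \<and>
       (\<forall>x\<in>univ M. f1 x = x \<and> f2 x = x) \<and> f1 a = f2 c" by blast
  have "((M, N1, c), z) \<in> E_star K" using step c by simp
  then obtain N2 b g1 g2 P where y: "z = (M, N2, b)" "M \<preceq> N1" "M \<preceq> N2" "c \<in> univ N1" "b \<in> univ N2"
    "is_embedding K g1 N1 P" "is_embedding K g2 N2 P"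
    "\<And>x. x \<in> univ M \<Longrightarrow> g1 x = x" "\<And>x. x \<in> univ M \<Longrightarrow> g2 x = x" "g1 c = g2 b"
    by (rule E_starE) blast
  have "R \<le>o |univ N1|"
    by (rule ordLeq_transitive[OF K_cardD(3)[OF M] card_of_mono1[OF le_univ[OF c(2)]]])
  moreover have "|univ M \<union> {c}| \<le>o R"
    by (rule card_Un_R[OF K_cardD(2)[OF M] ordLeq_transitive[OF card_singleton_lam lam_le_R]])
  moreover have "univ M \<union> {c} \<subseteq> univ N1" using le_univ[OF c(2)] c(3) by blast
  moreover have "N1 \<in> models K" using le_models c(2) by blast
  \<comment> \<open>The induction hypothesis covers every suitable submodel of the intermediate
    \<open>N1\<close>. It is applied to an \<open>S\<close> of size
    \<open>\<lambda>\<^sup>+\<close>, because only over models of that size can the old amalgam be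
    glued to the new one.\<close>
  ultimately obtain S where S: "S \<in> K1" "S \<preceq> N1" "univ M \<union> {c} \<subseteq> univ S"
    using LS_R[of N1 "univ M \<union> {c}"] by blast
  have MS: "M \<preceq> S" using le_within[OF c(2) S(2)] S(3) by simp
  obtain P1 f1 f2 where f: "P1 \<in> K1" "is_embedding K f1 Q P1" "is_embedding K f2 S P1"
    "\<forall>x\<in>univ M. f1 x = x \<and> f2 x = x" "f1 a = f2 c" using IH[OF S(1) MS S(2)] S(3) by blast
  have "\<exists>P\<in>K1. \<exists>f1 f2. is_embedding K f1 Q P \<and> is_embedding K f2 Q' P \<and>
       (\<forall>x\<in>univ M. f1 x = x \<and> f2 x = x) \<and> f1 a = f2 b"
    if Q': "Q' \<in> K1" "Q' \<preceq> N2" "M \<preceq> Q'" "b \<in> univ Q'" for Q'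
  proof -
    obtain P2 where P2: "P2 \<in> K1" "is_embedding K g1 S P2" "is_embedding K g2 Q' P2"
      using embedding_shrink[OF embedding_sub[OF y(6) S(2)] embedding_sub[OF y(7) Q'(2)] S(1) Q'(1)] by blast
    \<comment> \<open>The two amalgams are glued along \<open>S\<close>. Both composites become the
      identity on it, and as \<open>c\<close> is in \<open>S\<close>, the equations at
      \<open>c\<close> link \<open>a\<close> to \<open>b\<close>.\<close>
    obtain k1 k2 T where k: "is_embedding K k1 P1 T" "is_embedding K k2 P2 T"
      "\<forall>x\<in>univ S. k1 (f2 x) = x \<and> k2 (g1 x) = x"
      using amalgamation_embeddings[OF ap S(1) f(3,1) P2(2,1)] by blast
    obtain T' where T': "T' \<in> K1" "is_embedding K (k1 \<circ> f1) Q T'" "is_embedding K (k2 \<circ> g2) Q' T'"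
      using embedding_shrink[OF embedding_comp[OF f(2) k(1)] embedding_comp[OF P2(3) k(2)] Q(1) Q'(1)] by blast
    have "(k1 \<circ> f1) x = x \<and> (k2 \<circ> g2) x = x" if "x \<in> univ M" for x
    proof -
      have "x \<in> univ S" using S(3) that by blast
      then have "k1 (f2 x) = x" "k2 (g1 x) = x" using k(3) by blast+
      then show ?thesis using f(4) y(8,9) that by simp
    qed
    moreover have "(k1 \<circ> f1) a = (k2 \<circ> g2) b"
    proof -
      have "k1 (f2 c) = c" "k2 (g1 c) = c" using k(3) S(3) by blast+
      then show ?thesis using f(5) y(10) by simp
    qed
    ultimately show ?thesis using T' by blast
  qed
  then show ?case using y by blast
qed

lemma tp_eq_amalgamation:
  assumes ap: "amalgamation_property K R" and M: "M \<in> K1"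
    and N: "N1 \<in> K1" "N2 \<in> K1" "M \<preceq> N1" "M \<preceq> N2" "a \<in> univ N1" "b \<in> univ N2"
    and eq: "tp K a M N1 = tp K b M N2"
  shows "\<exists>P\<in>K1. \<exists>f1 f2. is_embedding K f1 N1 P \<and> is_embedding K f2 N2 P \<and>
    (\<forall>x\<in>univ M. f1 x = x \<and> f2 x = x) \<and> f1 a = f2 b"
proof -
  have "N1 \<preceq> N1" "N2 \<preceq> N2" using N le_refl K_cardD(1) by blast+
  then show ?thesis
    using E_trancl_amalgamation[OF ap M tp_eqD[OF eq N(4,6)] N(1,3) _ N(5)] N by auto
qed

end

section \<open>Density of basic types over models of size \<open>\<lambda>\<^sup>+\<close>\<close>

locale nonforking_setting =
  aec_succ K lam + semi_good_frame K lam Sbs nf + nonforking_amalgamation K lam Sbs nf NF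
  for K :: "('a, 'f, 'r) aec" and lam :: "'c rel" and Sbs nf NF +
  assumes amalgamation_R: "amalgamation_property K (cardSuc lam)"
    and tame: "tame_nonforking K lam Sbs nf"
begin

abbreviation "large_nf \<equiv> nf_large K lam Sbs nf"
abbreviation "leNF \<equiv> le_NF K lam NF"

lemma nf_tp_monotonicity:
  assumes "nf (tp K a B N) A B" "A \<preceq> A'" "A' \<preceq> B'" "B' \<preceq> B" "A' \<in> K0" "B' \<in> K0" "B \<preceq> N" "a \<in> univ N"
  shows "nf (tp K a B' N) A' B'"
  using nf_monotonicity[OF assms(1,5,6,2,3,4)] restrict_tp[OF assms(4,7,8)] by simp

text \<open>Every model of size \<open>lam\<close> between \<open>A i0\<close> and \<open>M\<close>
  lies inside a later level, and monotonicity brings non-forking down from there. Hence testing the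
  levels of one filtration suffices.\<close>

lemma large_nfI:
  assumes A: "is_filtration K lam A M" and MN: "M \<preceq> N" "a \<in> univ N - univ M" and i0: "i0 \<in> ord"
    and nf: "\<And>i. i0 \<sqsubseteq> i \<Longrightarrow> nf (tp K a (A i) N) (A i0) (A i)"
  shows "large_nf a (A i0) M N"
  unfolding nf_large_def
proof (intro conjI bexI[of _ "A i0"] ballI impI)
  show "A i0 \<in> K0" "A i0 \<preceq> M" using filt_K0[OF A i0] filt_le[OF A i0] by blast+
  then show "lam \<le>o |univ (A i0)|" "A i0 \<preceq> A i0" using K_cardD le_refl by blast+
  fix P assume P: "P \<in> K0" "A i0 \<preceq> P" "P \<preceq> M"
  obtain j where j: "j \<in> ord" "univ P \<subseteq> univ (A j)"
    using filt_cover[OF A le_univ[OF P(3)] K_cardD(2)[OF P(1)]] by blast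
  obtain k where k: "i0 \<sqsubseteq> k" "j \<sqsubseteq> k" using ile_linear[OF i0 j(1)] i0 j(1) by force
  have ko: "k \<in> ord" using ile_ord(2)[OF k(1)] .
  have "P \<preceq> A k"
    by (rule le_within[OF P(3) filt_le[OF A ko]]) (use j(2) le_univ[OF filt_mono[OF A k(2)]] in blast)
  then have "nf (tp K a P N) (A i0) P"
    using nf_tp_monotonicity[OF nf[OF k(1)] _ P(2) _ filt_K0[OF A i0] P(1)]
      le_refl[OF K_cardD(1)[OF filt_K0[OF A i0]]] le_trans[OF filt_le[OF A ko] MN(1)] MN(2) by blast
  then show "tp K a P N \<in> Sbs P" "nf (tp K a P N) (A i0) P" using nf_basic by blast+
qed (use MN in auto)

text \<open>The witness inside \<open>M0\<close> can be kept: every test over \<open>X'\<close> is a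
  test over \<open>X\<close>, and the type is the same whether computed in \<open>N'\<close> or in
  \<open>N\<close>. This brings an element found in limit models back to an earlier stage.\<close>

lemma large_nf_restrict:
  assumes l: "large_nf a M0 X N" and "M0 \<preceq> X'" "X' \<preceq> X" "X' \<preceq> N'" "N' \<preceq> N" "a \<in> univ N' - univ X'"
  shows "large_nf a M0 X' N'"
proof -
  obtain N0 where N0: "N0 \<in> K0" "N0 \<preceq> M0"
    "\<And>P. P \<in> K0 \<Longrightarrow> N0 \<preceq> P \<Longrightarrow> P \<preceq> X \<Longrightarrow> tp K a P N \<in> Sbs P \<and> nf (tp K a P N) N0 P"
    using l unfolding nf_large_def by blast
  have "tp K a P N' \<in> Sbs P \<and> nf (tp K a P N') N0 P" if P: "P \<in> K0" "N0 \<preceq> P" "P \<preceq> X'" for P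
  proof -
    have "tp K a P N = tp K a P N'"
      by (rule tp_mono[OF le_trans[OF P(3) assms(4)] assms(5)]) (use assms(6) in blast)
    then show ?thesis using N0(3)[OF P(1,2) le_trans[OF P(3) assms(3)]] by simp
  qed
  then show ?thesis using l assms N0(1,2) unfolding nf_large_def by blast
qed

text \<open>Local character at a limit point of the two filtrations that is closed under the ordinals
  witnessing failure replaces the usual appeal to Fodor's lemma.\<close>

lemma density_R:
  assumes X: "X \<in> K1" and N: "N \<in> K1" and XN: "X \<preceq> N" "X \<noteq> N"
  shows "\<exists>a\<in>univ N - univ X. \<exists>M0\<in>K0. M0 \<preceq> X \<and> large_nf a M0 X N"
proof (rule ccontr)
  assume no: "\<not> ?thesis"
  obtain X0 where X0: "X0 \<in> K0" "X0 \<preceq> X"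
    using K1_submodel[OF X] by blast
  obtain A where A: "is_filtration K lam A X" using filtration_exists[OF X X0] by blast
  obtain B where B: "is_filtration K lam B N" using filtration_exists[OF N X0(1) le_trans[OF X0(2) XN(1)]] by blast
  \<comment> \<open>Under the assumption no level \<open>A i\<close> can serve as a base for
    \<open>a\<close>, so by \<open>large_nfI\<close> some level from \<open>i\<close> on witnesses
    the failure.\<close>
  let ?bad = "\<lambda>a i j. i \<sqsubseteq> j \<and> \<not> nf (tp K a (A j) N) (A i) (A j)"
  have "\<exists>j. ?bad a i j" if a: "a \<in> univ N - univ X" and i: "i \<in> ord" for a i
  proof (rule ccontr)
    assume "\<not> ?thesis"
    then have "large_nf a (A i) X N" using large_nfI[OF A XN(1) a i] by blast
    then show False using no a filt_K0[OF A i] filt_le[OF A i] by blast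
  qed
  then obtain bad where bad: "\<And>a i. a \<in> univ N - univ X \<Longrightarrow> i \<in> ord \<Longrightarrow> ?bad a i (bad a i)" by metis
  \<comment> \<open>The recorded failures that involve an element of \<open>B m\<close> and a base
    up to stage \<open>m\<close>: at most \<open>lam\<close> many, so a club of \<open>d\<close>
    lies above those of every earlier stage.\<close>
  let ?S = "\<lambda>m. \<Union>a\<in>univ (B m) - univ X. bad a ` {i. i \<sqsubseteq> m}"
  have c: "club (\<lambda>d. is_limit R d \<and> (\<forall>m. m \<sqsubset> d \<longrightarrow> (\<forall>b\<in>?S m. b \<sqsubset> d)))"
  proof (rule club_bound)
    fix m assume m: "m \<in> ord"
    have BN: "univ (B m) \<subseteq> univ N" by (rule le_univ[OF filt_le[OF B m]])
    show "?S m \<subseteq> ord"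
    proof
      fix j assume "j \<in> ?S m"
      then obtain a i where ai: "a \<in> univ (B m) - univ X" "i \<sqsubseteq> m" "j = bad a i" by blast
      then have "i \<sqsubseteq> j" using bad[of a i] BN ile_ord(1)[OF ai(2)] by blast
      then show "j \<in> ord" by (rule ile_ord)
    qed
    show "|?S m| \<le>o lam"
      by (rule card_UN_lam[OF card_subset_lam[OF Diff_subset K_cardD(2)[OF filt_K0[OF B m]]]
            card_image_lam[OF card_under[OF m]]])
  qed
  have "univ X \<noteq> univ N" using le_antisym[OF XN(1)] XN(2) by blast
  then obtain a0 where a0: "a0 \<in> univ N - univ X" using le_univ[OF XN(1)] by blast
  then obtain k where k: "k \<in> ord" "a0 \<in> univ (B k)" using filt_mem[OF B] by blast
  \<comment> \<open>Agreement of the traces places every element of \<open>B d\<close> outside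
    \<open>A d\<close> also outside \<open>X\<close>, and \<open>k\<close> below \<open>d\<close>
    ensures that such elements exist.\<close>
  obtain d where "is_limit R d" "(is_limit R d \<and> (\<forall>m. m \<sqsubset> d \<longrightarrow> (\<forall>b\<in>?S m. b \<sqsubset> d))) \<and>
      univ (A d) = univ (B d) \<inter> univ X \<and> k \<sqsubset> d"
    using club_ex[OF club_conj[OF c club_conj[OF club_filtrations_agree[OF A B XN(1)] club_above[OF k(1)]]]]
    by blast
  then have d: "is_limit R d" "\<And>m b. m \<sqsubset> d \<Longrightarrow> b \<in> ?S m \<Longrightarrow> b \<sqsubset> d"
    "univ (A d) = univ (B d) \<inter> univ X" "k \<sqsubset> d" by blast+
  note do = limit_ord[OF d(1)]
  have AB: "A d \<preceq> B d"
    by (rule le_within[OF le_trans[OF filt_le[OF A do] XN(1)] filt_le[OF B do]]) (simp add: d(3))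
  have "a0 \<in> univ (B d)" using k(2) le_univ[OF filt_mono[OF B ilt_imp_ile[OF d(4)]]] by blast
  then have "a0 \<in> univ (B d) - univ (A d)" using d(3) a0 by blast
  then have "A d \<noteq> B d" by fastforce
  then obtain a where a: "a \<in> univ (B d) - univ (A d)" "tp K a (A d) (B d) \<in> Sbs (A d)"
    using density[OF filt_K0[OF A do] filt_K0[OF B do] AB] by blast
  have aN: "a \<in> univ N - univ X" using a(1) d(3) le_univ[OF filt_le[OF B do]] by blast
  have tpa: "tp K a (A d) (B d) = tp K a (A d) N"
    using tp_mono[OF AB filt_le[OF B do]] a(1) by simp
  have "\<exists>i\<in>underS R d. nf (tp K a (A d) (B d)) (A i) (A d)"
  proof (rule local_character[OF d(1)])
    show "inc_cont K R (under R d) A"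
      by (rule inc_contI)
        (use filt_mono[OF A] filt_limit[OF A] ile_trans ile_ord(1) in auto)
    show "A i \<in> K0" if "i \<in> under R d" for i
      using filt_K0[OF A ile_ord(1)] that by simp
  qed (rule a(2))
  then obtain i where i: "i \<sqsubset> d" "nf (tp K a (A d) N) (A i) (A d)" using tpa by auto
  obtain m0 where m0: "m0 \<sqsubset> d" "a \<in> univ (B m0)" using a(1) filt_limit[OF B d(1)] by blast
  obtain m where m: "m \<sqsubset> d" "m0 \<sqsubseteq> m" "i \<sqsubseteq> m"
    using ile_linear[OF ilt_ord(1)[OF i(1)] ilt_ord(1)[OF m0(1)]] i(1) m0(1) ilt_ord(1) ile_refl by blast
  have "a \<in> univ (B m)" using m0(2) le_univ[OF filt_mono[OF B m(2)]] by blast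
  then have "bad a i \<in> ?S m" using aN m(3) by blast
  then have j: "bad a i \<sqsubset> d" by (rule d(2)[OF m(1)])
  have b: "?bad a i (bad a i)" by (rule bad[OF aN ilt_ord(1)[OF i(1)]])
  \<comment> \<open>Local character gave a base \<open>A i\<close> for the type over
    \<open>A d\<close>. The recorded failure of that base occurs below \<open>d\<close>, where
    monotonicity contradicts it.\<close>
  have "nf (tp K a (A (bad a i)) N) (A i) (A (bad a i))"
  proof (rule nf_tp_monotonicity[OF i(2)])
    have "A i \<in> K0" by (rule filt_K0[OF A ilt_ord(1)[OF i(1)]])
    then show "A i \<preceq> A i" "A i \<in> K0" using le_refl[OF K_cardD(1)] by blast+
    show "A i \<preceq> A (bad a i)" using filt_mono[OF A] b by blast
    show "A (bad a i) \<preceq> A d" by (rule filt_mono[OF A ilt_imp_ile[OF j]])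
    show "A (bad a i) \<in> K0" by (rule filt_K0[OF A ilt_ord(1)[OF j]])
    show "A d \<preceq> N" by (rule le_trans[OF AB filt_le[OF B do]])
    show "a \<in> univ N" using aN by blast
  qed
  then show False using b by blast
qed

section \<open>The relation induced by non-forking amalgamation\<close>

text \<open>Extension produces some amalgam \<open>P\<close> above \<open>N\<close>, and
  monotonicity exchanges it for \<open>N\<close>, with \<open>P\<close> as the common
  extension.\<close>

lemma NF_trivial:
  assumes "M \<preceq> N" "M \<in> K0" "N \<in> K0"
  shows "NF M M N N"
proof -
  have r: "M \<preceq> M" "N \<preceq> N" using assms le_refl K_cardD(1) by blast+
  have "univ M \<inter> univ N = univ M" using le_univ[OF assms(1)] by blast
  then obtain P where P: "NF M M N P" using NF_extension[of M M N] assms r by blast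
  have PK: "P \<in> K0" "N \<preceq> P" using NF_models[OF P] NF_disjoint[OF P] by simp_all
  then show ?thesis
    using NF_monotonicity[OF P, of M N N P] assms r le_univ[OF assms(1)] le_refl[OF K_cardD(1)[OF PK(1)]] by simp
qed

lemma NF_le: assumes "NF M0 M1 M2 M3" shows "M0 \<preceq> M1" "M0 \<preceq> M2" "M1 \<preceq> M3" "M2 \<preceq> M3"
    "univ M1 \<inter> univ M2 = univ M0" "M0 \<in> K0" "M1 \<in> K0" "M2 \<in> K0" "M3 \<in> K0"
  using NF_disjoint[OF assms] NF_models[OF assms] by simp_all

text \<open>Here \<open>m i\<close> is the maximum of \<open>a\<close> and \<open>i\<close>. For a
  limit up to \<open>a\<close> the chain is constant, so its value at zero covers the limit; beyond
  \<open>a\<close> the original levels do.\<close>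

lemma max_limit_cover:
  assumes A: "is_filtration K lam A M" and a: "a \<in> ord" and j: "is_limit R j"
  defines "m \<equiv> \<lambda>i. if i \<sqsubseteq> a then a else i"
  shows "univ (A (m j)) \<subseteq> (\<Union>i\<in>{i. i \<sqsubset> j}. univ (A (m i)))"
proof (cases "j \<sqsubseteq> a")
  case True
  then have "m oz = a" "m j = a" using oz_least[OF a] by (simp_all add: m_def)
  then show ?thesis using limit_pos[OF j] by force
next
  case False
  then have "a \<sqsubset> j" using not_ile limit_ord[OF j] a by blast
  show ?thesis
  proof
    fix x assume "x \<in> univ (A (m j))"
    then have "x \<in> univ (A j)" using False by (simp add: m_def)
    then obtain i where i: "i \<sqsubset> j" "x \<in> univ (A i)" using filt_limit[OF A j] by blast
    have "i \<sqsubseteq> m i" using ilt_ord(1)[OF i(1)] by (simp add: m_def)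
    then have "x \<in> univ (A (m i))" using i(2) le_univ[OF filt_mono[OF A]] by blast
    then show "x \<in> (\<Union>i\<in>{i. i \<sqsubset> j}. univ (A (m i)))" using i(1) by blast
  qed
qed

text \<open>Long transitivity speaks about chains indexed from \<open>0\<close>; an interval starting at \<open>a\<close> is
  handled by making the chains constant up to \<open>a\<close>.\<close>

lemma NF_filtration_pair:
  assumes A: "is_filtration K lam A M" and B: "is_filtration K lam B N"
    and NF: "\<And>i. i \<in> ord \<Longrightarrow> NF (A i) (B i) (A (os i)) (B (os i))" and ab: "a \<sqsubseteq> b"
  shows "NF (A a) (B a) (A b) (B b)"
proof -
  note ao = ile_ord(1)[OF ab] and bo = ile_ord(2)[OF ab]
  have triv: "NF (A a) (A a) (B a) (B a)"
    by (rule NF_trivial[OF NF_le(1)[OF NF[OF ao]] filt_K0[OF A ao] filt_K0[OF B ao]])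
  show ?thesis
  proof (cases "a = b")
    case True
    then show ?thesis using NF_symmetry[OF triv] by simp
  next
    case False
    then have ab': "a \<sqsubset> b" using ab by (simp add: ilt_iff)
    define m where "m i = (if i \<sqsubseteq> a then a else i)" for i
    have mo: "m i \<in> ord" if "i \<in> ord" for i using that ao by (simp add: m_def)
    have mm: "m i \<sqsubseteq> m j" if "i \<sqsubseteq> j" for i j
      using that ao ile_trans[OF that] not_ile[OF _ ao, of j] ile_ord[OF that]
      by (auto simp: m_def ilt_imp_ile)
    have c: "inc_cont K R (under R b) (\<lambda>i. C (m i))" if C: "is_filtration K lam C P" for C P
    proof (rule inc_contI)
      show "C (m i) \<preceq> C (m j)" if "i \<sqsubseteq> j" for i j by (rule filt_mono[OF C mm[OF that]])
      show "univ (C (m j)) \<subseteq> (\<Union>i\<in>{i. i \<sqsubset> j}. univ (C (m i)))" if "is_limit R j" for j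
        unfolding m_def by (rule max_limit_cover[OF C ao that])
    qed (use ile_trans ile_ord(1) in auto)
    \<comment> \<open>Long transitivity composes along the second argument, while here the
      hypothesis advances in the third. Symmetry exchanges the two before and after.\<close>
    have "NF (A (m oz)) (A (m b)) (B (m oz)) (B (m b))"
    proof (rule NF_long_transitivity[OF bo])
      show "underS R b \<noteq> {}" using ab' mem_underS by blast
      show "inc_cont K R (under R b) (\<lambda>i. A (m i))" "inc_cont K R (under R b) (\<lambda>i. B (m i))"
        by (rule c[OF A] c[OF B])+
      show "A (m i) \<in> K0 \<and> B (m i) \<in> K0" if "i \<in> under R b" for i
      proof -
        have "m i \<in> ord" using that mo ile_ord(1) by simp
        then show ?thesis using filt_K0[OF A] filt_K0[OF B] by blast
      qed
      fix i assume "i \<in> underS R b"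
      then have io: "i \<in> ord" using ilt_ord(1) by simp
      show "NF (A (m i)) (A (m (os i))) (B (m i)) (B (m (os i)))"
      proof (cases "i \<sqsubset> a")
        case True
        then have "m i = a" "m (os i) = a"
          using os_le_iff[OF io ao] by (simp_all add: m_def ilt_imp_ile)
        then show ?thesis using triv by simp
      next
        case False
        then have "a \<sqsubseteq> i" using not_ilt io ao by blast
        then have "m i = i" using ile_antisym by (auto simp: m_def)
        moreover have "m (os i) = os i"
          using os_le_iff[OF io ao] False by (simp add: m_def)
        ultimately show ?thesis using NF_symmetry[OF NF[OF io]] by simp
      qed
    qed
    moreover have "m oz = a" "m b = b" using oz_least[OF ao] ab ile_antisym by (auto simp: m_def)
    ultimately show ?thesis using NF_symmetry by simp
  qed
qed

section \<open>Closure properties of the induced relation\<close>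

text \<open>\<open>NF_hat\<close> wants \<open>NF\<close> between consecutive levels at every index,
  but comparisons of filtrations succeed only on clubs. Enumerating part of the club continuously
  turns its members into all the levels of two new filtrations.\<close>

lemma le_NF_clubI:
  assumes M: "M \<in> K1" and N: "N \<in> K1" and MN: "M \<preceq> N"
    and A: "is_filtration K lam A M" and B: "is_filtration K lam B N"
    and C: "club C" and NF: "\<And>i j. C i \<Longrightarrow> C j \<Longrightarrow> i \<sqsubset> j \<Longrightarrow> NF (A i) (B i) (A j) (B j)"
  shows "leNF M N"
proof -
  obtain D where D: "normal D" "\<And>i. i \<in> ord \<Longrightarrow> C (D i)" using club_normal[OF C] by blast
  have D1: "D i \<sqsubset> D j" if "i \<sqsubset> j" for i j using D(1) that unfolding normal_def by blast
  note fA = filtration_reindex[OF A D(1)] and fB = filtration_reindex[OF B D(1)]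
  have "NF (A (D i)) (B (D i)) (A (D (os i))) (B (D (os i)))" if "i \<in> ord" for i
    using NF[OF D(2)[OF that] D(2)[OF os_ord[OF that]] D1[OF lt_os[OF that]]] .
  then have "NF_hat K lam NF (A (D oz)) (B (D oz)) M N"
    unfolding NF_hat_def using fA fB M N filt_K0[OF fA oz_ord] filt_K0[OF fB oz_ord] by auto
  then show ?thesis
    unfolding le_NF_def using M N MN filt_K0[OF fA oz_ord] filt_K0[OF fB oz_ord] by blast
qed

lemma le_NF_E:
  assumes "leNF M N"
  obtains A B where "is_filtration K lam A M" "is_filtration K lam B N"
    "\<And>i j. i \<sqsubseteq> j \<Longrightarrow> NF (A i) (B i) (A j) (B j)"
proof -
  obtain A B where AB: "is_filtration K lam A M" "is_filtration K lam B N"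
    "\<forall>i\<in>ord. NF (A i) (B i) (A (os i)) (B (os i))"
    using assms unfolding le_NF_def NF_hat_def by blast
  then show ?thesis using that NF_filtration_pair[OF AB(1,2)] by blast
qed

lemma le_NF_D: assumes "leNF M N" shows "M \<in> K1" "N \<in> K1" "M \<preceq> N"
  using assms unfolding le_NF_def by blast+

lemma le_NF_refl: assumes M: "M \<in> K1" shows "leNF M M"
proof -
  obtain X0 where X0: "X0 \<in> K0" "X0 \<preceq> M" using K1_submodel[OF M] by blast
  obtain A where A: "is_filtration K lam A M" using filtration_exists[OF M X0] by blast
  show ?thesis
  proof (rule le_NF_clubI[OF M M le_refl[OF K_cardD(1)[OF M]] A A club_limit])
    fix i j assume ij: "i \<sqsubset> j"
    show "NF (A i) (A i) (A j) (A j)"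
      by (rule NF_trivial[OF filt_mono[OF A ilt_imp_ile[OF ij]] filt_K0[OF A ilt_ord(1)[OF ij]]
            filt_K0[OF A ilt_ord(2)[OF ij]]])
  qed
qed

text \<open>Cut the levels \<open>B i\<close> down to their traces on \<open>N\<close>. For a club
  of indices these are the levels of a filtration of \<open>N\<close>, and monotonicity of
  \<open>NF\<close> permits shrinking its second and last arguments to them.\<close>

lemma le_NF_coherence:
  assumes NF: "leNF M X" and N: "N \<in> K1" "M \<preceq> N" "N \<preceq> X"
  shows "leNF M N"
proof -
  obtain A B where A: "is_filtration K lam A M" and B: "is_filtration K lam B X"
    and AB: "\<And>i j. i \<sqsubseteq> j \<Longrightarrow> NF (A i) (B i) (A j) (B j)" using le_NF_E[OF NF] by blast
  obtain N0 where N0: "N0 \<in> K0" "N0 \<preceq> N" using K1_submodel[OF N(1)] by blast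
  obtain G where G: "is_filtration K lam G N" using filtration_exists[OF N(1) N0] by blast
  show ?thesis
  proof (rule le_NF_clubI[OF le_NF_D(1)[OF NF] N(1,2) A G club_filtrations_agree[OF G B N(3)]])
    fix i j assume i: "univ (G i) = univ (B i) \<inter> univ N" and j: "univ (G j) = univ (B j) \<inter> univ N"
      and ij: "i \<sqsubset> j"
    note io = ilt_ord(1)[OF ij] and jo = ilt_ord(2)[OF ij]
    note nf = AB[OF ilt_imp_ile[OF ij]]
    have GB: "G k \<preceq> B k" if "k \<in> ord" "univ (G k) = univ (B k) \<inter> univ N" for k
      by (rule le_within[OF le_trans[OF filt_le[OF G that(1)] N(3)] filt_le[OF B that(1)]]) (simp add: that(2))
    have AG: "A k \<preceq> G k" if k: "k \<in> ord" "univ (G k) = univ (B k) \<inter> univ N" for k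
    proof (rule le_within[OF le_trans[OF filt_le[OF A k(1)] N(2)] filt_le[OF G k(1)]])
      have "A k \<preceq> B k" using AB[of k k] k(1) NF_le(1) by simp
      then show "univ (A k) \<subseteq> univ (G k)"
        using k(2) le_univ le_univ[OF filt_le[OF A k(1)]] le_univ[OF N(2)] by blast
    qed
    show "NF (A i) (G i) (A j) (G j)"
    proof (rule NF_monotonicity[OF nf])
      show "{G i, A j, G j, B j} \<subseteq> K0"
        using filt_K0[OF A jo] filt_K0[OF B jo] filt_K0[OF G jo] filt_K0[OF G io] by simp
      show "A i \<preceq> G i" by (rule AG[OF io i])
      show "G i \<preceq> B i" by (rule GB[OF io i])
      show "A i \<preceq> A j" by (rule filt_mono[OF A ilt_imp_ile[OF ij]])
      show "A j \<preceq> A j" by (rule le_refl[OF K_cardD(1)[OF filt_K0[OF A jo]]])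
      show "univ (G i) \<union> univ (A j) \<subseteq> univ (G j)"
        using le_univ[OF filt_mono[OF G ilt_imp_ile[OF ij]]] le_univ[OF AG[OF jo j]] by blast
      show "B j \<preceq> B j" by (rule le_refl[OF K_cardD(1)[OF filt_K0[OF B jo]]])
      show "G j \<preceq> B j" by (rule GB[OF jo j])
    qed
  qed
qed

lemma img_fixed:
  assumes "is_struct V M" "\<And>x. x \<in> univ M \<Longrightarrow> h x = x"
  shows "img V h M = M"
proof -
  have "is_iso V h M M" by (rule is_iso_cong[OF is_iso_id[OF assms(1)]]) (simp add: assms(2))
  then show ?thesis using is_iso_unique by metis
qed

text \<open>The isomorphism fixes \<open>M\<close>, hence every level of its filtration, so only the
  second filtration moves.\<close>

lemma le_NF_iso:
  assumes NF: "leNF M N" and h: "is_iso V h N N'" and fx: "\<And>x. x \<in> univ M \<Longrightarrow> h x = x"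
  shows "leNF M N'"
proof -
  obtain A B where A: "is_filtration K lam A M" and B: "is_filtration K lam B N"
    and AB: "\<And>i j. i \<sqsubseteq> j \<Longrightarrow> NF (A i) (B i) (A j) (B j)" using le_NF_E[OF NF] by blast
  note M = le_NF_D[OF NF]
  have "img V h M = M" by (rule img_fixed[OF models_struct[OF K_cardD(1)[OF M(1)]] fx])
  then have MN: "M \<preceq> N'" using img_le[OF h M(3)] by simp
  have Ai: "img V h (A i) = A i" "A i \<preceq> N" if "i \<in> ord" for i
  proof -
    have "A i \<preceq> M" by (rule filt_le[OF A that])
    then show "img V h (A i) = A i" "A i \<preceq> N"
      using img_fixed[of "A i" h] le_models models_struct fx le_univ le_trans[OF _ M(3)] by blast+
  qed
  show ?thesis
  proof (rule le_NF_clubI[OF M(1) iso_card[OF h M(2)] MN A filtration_iso[OF B h] club_limit])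
    fix i j assume ij: "i \<sqsubset> j"
    note io = ilt_ord(1)[OF ij] and jo = ilt_ord(2)[OF ij]
    show "NF (A i) (img V h (B i)) (A j) (img V h (B j))"
    proof (rule NF_iso[OF AB[OF ilt_imp_ile[OF ij]]])
      show "is_iso V h (A i) (A i)" using iso_le[OF h Ai(2)[OF io]] Ai(1)[OF io] by simp
      show "is_iso V h (A j) (A j)" using iso_le[OF h Ai(2)[OF jo]] Ai(1)[OF jo] by simp
      show "is_iso V h (B i) (img V h (B i))" by (rule iso_le[OF h filt_le[OF B io]])
      show "is_iso V h (B j) (img V h (B j))" by (rule iso_le[OF h filt_le[OF B jo]])
    qed
  qed
qed

text \<open>For \<open>a\<close> below \<open>b\<close> in a suitable club, cut the levels
  \<open>G a\<close> and \<open>G b\<close> of the union along the models \<open>X i\<close> with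
  \<open>i\<close> up to \<open>a\<close>. The passage from \<open>a\<close> to \<open>b\<close> is
  in \<open>NF\<close> for each pair \<open>X i\<close>, \<open>X (os i)\<close>; long transitivity
  in the direction of \<open>i\<close> composes these squares into one that starts at
  \<open>X oz\<close> and reaches \<open>G a\<close>.\<close>

lemma le_NF_chain:
  assumes X: "inc_cont K R ord X" and XK: "\<And>i. i \<in> ord \<Longrightarrow> X i \<in> K1"
    and NF: "\<And>i. i \<in> ord \<Longrightarrow> leNF (X i) (X (os i))"
    and U: "U \<in> K1" "\<And>i. i \<in> ord \<Longrightarrow> X i \<preceq> U" "univ U \<subseteq> (\<Union>i\<in>ord. univ (X i))"
  shows "leNF (X oz) U"
proof -
  have "\<forall>i\<in>ord. \<exists>AB. is_filtration K lam (fst AB) (X i) \<and> is_filtration K lam (snd AB) (X (os i)) \<and>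
    (\<forall>k l. k \<sqsubseteq> l \<longrightarrow> NF (fst AB k) (snd AB k) (fst AB l) (snd AB l))"
  proof
    fix i assume "i \<in> ord"
    from NF[OF this] obtain A B where AB: "is_filtration K lam A (X i)" "is_filtration K lam B (X (os i))"
      "\<And>k l. k \<sqsubseteq> l \<Longrightarrow> NF (A k) (B k) (A l) (B l)" by (rule le_NF_E) blast
    then show "\<exists>AB. is_filtration K lam (fst AB) (X i) \<and> is_filtration K lam (snd AB) (X (os i)) \<and>
      (\<forall>k l. k \<sqsubseteq> l \<longrightarrow> NF (fst AB k) (snd AB k) (fst AB l) (snd AB l))"
      by (intro exI[of _ "(A, B)"]) simp
  qed
  then obtain AB where AB0: "\<forall>i\<in>ord. is_filtration K lam (fst (AB i)) (X i) \<and>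
    is_filtration K lam (snd (AB i)) (X (os i)) \<and>
    (\<forall>k l. k \<sqsubseteq> l \<longrightarrow> NF (fst (AB i) k) (snd (AB i) k) (fst (AB i) l) (snd (AB i) l))"
    by (rule bchoice[THEN exE])
  define A where "A i = fst (AB i)" for i
  define B where "B i = snd (AB i)" for i
  have A: "is_filtration K lam (A i) (X i)" and B: "is_filtration K lam (B i) (X (os i))"
    and AB: "k \<sqsubseteq> l \<Longrightarrow> NF (A i k) (B i k) (A i l) (B i l)" if "i \<in> ord" for i k l
    using AB0 that unfolding A_def B_def by blast+
  obtain U0 where U0: "U0 \<in> K0" "U0 \<preceq> U" using K1_submodel[OF U(1)] by blast
  obtain G where G: "is_filtration K lam G U" using filtration_exists[OF U(1) U0] by blast
  have "\<forall>x\<in>univ U. \<exists>i. i \<in> ord \<and> x \<in> univ (X i)" using U(3) by blast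
  then obtain p where p: "\<forall>x\<in>univ U. p x \<in> ord \<and> x \<in> univ (X (p x))" by (rule bchoice[THEN exE])
  \<comment> \<open>The first conjunct puts every element of \<open>G d\<close> into some
    \<open>X i\<close> with \<open>i\<close> below \<open>d\<close>. The second compares
    \<open>\<lambda>\<^sup>+\<close> many filtrations with \<open>G\<close>; this takes a diagonal
    intersection, so \<open>A i\<close> and \<open>B i\<close> are controlled at \<open>d\<close>
    only for \<open>i\<close> below \<open>d\<close>.\<close>
  define C where "C d \<longleftrightarrow> (is_limit R d \<and> (\<forall>i. i \<sqsubset> d \<longrightarrow> (\<forall>b\<in>p ` univ (G i). b \<sqsubset> d))) \<and>
     (\<forall>i. i \<sqsubset> d \<longrightarrow> univ (A i d) = univ (G d) \<inter> univ (X i) \<and>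
        univ (B i d) = univ (G d) \<inter> univ (X (os i)))" for d
  have "club C"
    unfolding C_def
  proof (rule club_conj[OF club_bound club_diagonal[OF club_conj]])
    fix i assume i: "i \<in> ord"
    show "p ` univ (G i) \<subseteq> ord" using p le_univ[OF filt_le[OF G i]] by blast
    show "|p ` univ (G i)| \<le>o lam" by (rule card_image_lam[OF K_cardD(2)[OF filt_K0[OF G i]]])
    show "club (\<lambda>d. univ (A i d) = univ (G d) \<inter> univ (X i))"
      by (rule club_filtrations_agree[OF A[OF i] G U(2)[OF i]])
    show "club (\<lambda>d. univ (B i d) = univ (G d) \<inter> univ (X (os i)))"
      by (rule club_filtrations_agree[OF B[OF i] G U(2)[OF os_ord[OF i]]])
  qed
  moreover have "NF (A oz a) (G a) (A oz b) (G b)" if Ca: "C a" and Cb: "C b" and ab: "a \<sqsubset> b" for a b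
  proof -
    have La: "is_limit R a" and Lb: "is_limit R b" using Ca Cb unfolding C_def by blast+
    note ao = limit_ord[OF La] and bo = limit_ord[OF Lb]
    have Aa: "univ (A i a) = univ (G a) \<inter> univ (X i)" "univ (B i a) = univ (G a) \<inter> univ (X (os i))"
      if "i \<sqsubset> a" for i using Ca that unfolding C_def by blast+
    have Ab: "univ (A i b) = univ (G b) \<inter> univ (X i)" "univ (B i b) = univ (G b) \<inter> univ (X (os i))"
      if "i \<sqsubset> b" for i using Cb that unfolding C_def by blast+
    have Ga: "\<exists>i. i \<sqsubset> a \<and> x \<in> univ (X i)" if x: "x \<in> univ (G a)" for x
    proof -
      obtain i where i: "i \<sqsubset> a" "x \<in> univ (G i)" using x filt_limit[OF G La] by blast
      then have "p x \<sqsubset> a" using Ca unfolding C_def by blast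
      moreover have "x \<in> univ (X (p x))" using p x le_univ[OF filt_le[OF G ao]] by blast
      ultimately show ?thesis by blast
    qed
    have XX: "univ (X i) \<subseteq> univ (X j)" if "i \<sqsubseteq> j" for i j
      by (rule le_univ[OF inc_cont_le[OF X _ that]]) (rule ile_ord(2)[OF that])
    have XL: "univ (X j) = (\<Union>i\<in>{i. i \<sqsubset> j}. univ (X i))" if "is_limit R j" for j
      by (rule inc_cont_limit[OF X limit_ord[OF that] that])
    \<comment> \<open>At the endpoint \<open>G a\<close> replaces \<open>A a a\<close>, about which
      the club says nothing. In \<open>Q\<close> the level \<open>A a b\<close> is under control
      because \<open>a\<close> is below \<open>b\<close>.\<close>
    define P where "P i = (if i \<sqsubset> a then A i a else G a)" for i
    define Q where "Q i = A i b" for i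
    have ltb: "i \<sqsubset> b" if "i \<sqsubseteq> a" for i by (rule ile_ilt_trans[OF that ab])
    have uP: "univ (P i) = univ (G a) \<inter> univ (X i)" if i: "i \<sqsubseteq> a" for i
    proof (cases "i \<sqsubset> a")
      case True then show ?thesis using Aa(1) by (simp add: P_def)
    next
      case False
      then have "i = a" using i by (simp add: ilt_iff)
      moreover have "univ (G a) \<subseteq> univ (X a)" using Ga XX[OF ilt_imp_ile] by blast
      ultimately show ?thesis by (auto simp: P_def)
    qed
    have uQ: "univ (Q i) = univ (G b) \<inter> univ (X i)" if i: "i \<sqsubseteq> a" for i
      unfolding Q_def by (rule Ab(1)[OF ltb[OF i]])
    have PU: "P i \<preceq> U" "P i \<in> K0" if i: "i \<sqsubseteq> a" for i
      using filt_le[OF A[OF ile_ord(1)[OF i]] ao] filt_K0[OF A[OF ile_ord(1)[OF i]] ao]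
        le_trans[OF _ U(2)[OF ile_ord(1)[OF i]]] filt_le[OF G ao] filt_K0[OF G ao]
      unfolding P_def by auto
    have QU: "Q i \<preceq> U" "Q i \<in> K0" if i: "i \<sqsubseteq> a" for i
      using filt_le[OF A[OF ile_ord(1)[OF i]] bo] filt_K0[OF A[OF ile_ord(1)[OF i]] bo]
        le_trans[OF _ U(2)[OF ile_ord(1)[OF i]]] unfolding Q_def by auto
    have ic: "inc_cont K R (under R a) F"
      if F: "\<And>i. i \<sqsubseteq> a \<Longrightarrow> F i \<preceq> U" "\<And>i. i \<sqsubseteq> a \<Longrightarrow> univ (F i) = H \<inter> univ (X i)" for F H
    proof (rule inc_cont_within[where N = U])
      show "univ (F i) \<subseteq> univ (F j)" if "j \<in> under R a" "i \<sqsubset> j" for i j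
      proof -
        have j: "j \<sqsubseteq> a" and i: "i \<sqsubseteq> a"
          using that ile_trans[OF ilt_imp_ile[OF that(2)]] by simp_all
        show ?thesis unfolding F(2)[OF j] F(2)[OF i] using XX[OF ilt_imp_ile[OF that(2)]] by blast
      qed
      show "univ (F j) \<subseteq> (\<Union>i\<in>{i. i \<sqsubset> j}. univ (F i))" if "j \<in> under R a" "is_limit R j" for j
      proof
        fix x assume x: "x \<in> univ (F j)"
        have j: "j \<sqsubseteq> a" using that by simp
        then have "x \<in> H" "x \<in> univ (X j)" using x F(2) by simp_all
        moreover note XL[OF that(2)]
        ultimately obtain i where i: "i \<sqsubset> j" "x \<in> univ (X i)" by blast
        then have "x \<in> univ (F i)" using F(2)[OF ile_trans[OF ilt_imp_ile[OF i(1)] j]] \<open>x \<in> H\<close> by simp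
        then show "x \<in> (\<Union>i\<in>{i. i \<sqsubset> j}. univ (F i))" using i(1) by blast
      qed
    qed (use F(1) ile_trans ile_ord(1) in auto)
    have "NF (P oz) (P a) (Q oz) (Q a)"
    proof (rule NF_long_transitivity[OF ao])
      show "underS R a \<noteq> {}" using limit_pos[OF La] mem_underS by blast
      show "inc_cont K R (under R a) P" by (rule ic[OF PU(1) uP])
      show "inc_cont K R (under R a) Q" by (rule ic[OF QU(1) uQ])
      show "P i \<in> K0 \<and> Q i \<in> K0" if "i \<in> under R a" for i using PU(2) QU(2) that by simp
      fix i assume "i \<in> underS R a"
      then have i: "i \<sqsubset> a" by simp
      note io = ilt_ord(1)[OF i] and si = ilt_imp_ile[OF limit_suc[OF La i]]
      \<comment> \<open>\<open>B i\<close> and \<open>A (os i)\<close> are independently chosen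
        filtrations of the same model; at index \<open>a\<close> both levels are the trace of
        \<open>G a\<close> on it.\<close>
      have "P (os i) = B i a"
        by (rule le_eq[OF PU(1)[OF si] le_trans[OF filt_le[OF B[OF io] ao] U(2)[OF os_ord[OF io]]]])
          (simp add: uP[OF si] Aa(2)[OF i])
      moreover have "Q (os i) = B i b"
        by (rule le_eq[OF QU(1)[OF si] le_trans[OF filt_le[OF B[OF io] bo] U(2)[OF os_ord[OF io]]]])
          (simp add: uQ[OF si] Ab(2)[OF ltb[OF ilt_imp_ile[OF i]]])
      moreover have "P i = A i a" "Q i = A i b" using i by (simp_all add: P_def Q_def)
      ultimately show "NF (P i) (P (os i)) (Q i) (Q (os i))"
        using AB[OF io ilt_imp_ile[OF ab]] by simp
    qed
    moreover have "P oz = A oz a" "P a = G a" "Q oz = A oz b"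
      using limit_pos[OF La] by (simp_all add: P_def Q_def)
    ultimately have nf: "NF (A oz a) (G a) (A oz b) (Q a)" by simp
    have aa: "a \<sqsubseteq> a" using ao by simp
    have QG: "Q a \<preceq> G b"
      by (rule le_within[OF QU(1)[OF aa] filt_le[OF G bo]]) (simp add: uQ[OF aa])
    note Gb = filt_K0[OF G bo]
    \<comment> \<open>The top \<open>Q a\<close> is only the trace of \<open>G b\<close> on
      \<open>X a\<close>; monotonicity lets it grow to \<open>G b\<close>.\<close>
    show ?thesis
    proof (rule NF_monotonicity[OF nf])
      show "{G a, A oz b, G b, G b} \<subseteq> K0" using NF_le(7,8)[OF nf] Gb by simp
      show "A oz a \<preceq> G a" "A oz a \<preceq> A oz b" by (rule NF_le[OF nf])+
      show "G a \<preceq> G a" "A oz b \<preceq> A oz b" "G b \<preceq> G b"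
        using le_refl[OF K_cardD(1)] NF_le(7,8)[OF nf] Gb by blast+
      show "univ (G a) \<union> univ (A oz b) \<subseteq> univ (G b)"
        using le_univ[OF NF_le(3)[OF nf]] le_univ[OF NF_le(4)[OF nf]] le_univ[OF QG] by blast
      show "Q a \<preceq> G b" by (rule QG)
    qed
  qed
  ultimately show ?thesis
    using le_NF_clubI[OF XK[OF oz_ord] U(1) U(2)[OF oz_ord] A[OF oz_ord] G] by blast
qed

section \<open>Realizing non-forking types\<close>

text \<open>Level zero realizes the restriction to a small \<open>N0\<close> over which the type
  does not fork. \<open>NF\<close> respects the frame, so the realization \<open>b\<close> does not
  fork over \<open>N0\<close> at any level; thus \<open>a\<close> and \<open>b\<close> agree over
  \<open>N0\<close> and both do not fork over it, as tameness requires.\<close>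

lemma realize_nonforking_type:
  assumes M: "M \<in> K1" and N: "N \<in> K1" and MN: "M \<preceq> N" and large: "large_nf a M0 M N"
  shows "\<exists>M' b. leNF M M' \<and> b \<in> univ M' \<and> tp K b M M' = tp K a M N"
proof -
  have aN: "a \<in> univ N - univ M" and M0M: "M0 \<preceq> M" using large unfolding nf_large_def by blast+
  obtain N0 where N0: "N0 \<in> K0" "N0 \<preceq> M0"
    "\<And>P. P \<in> K0 \<Longrightarrow> N0 \<preceq> P \<Longrightarrow> P \<preceq> M \<Longrightarrow> tp K a P N \<in> Sbs P \<and> nf (tp K a P N) N0 P"
    using large unfolding nf_large_def by blast
  have N0M: "N0 \<preceq> M" by (rule le_trans[OF N0(2) M0M])
  have N0N: "N0 \<preceq> N" by (rule le_trans[OF N0M MN])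
  have N0r: "N0 \<preceq> N0" by (rule le_refl[OF K_cardD(1)[OF N0(1)]])
  obtain A where A: "is_filtration K lam A M" "A oz = N0" using filtration_exists[OF M N0(1) N0M] by blast
  have "insert a (univ N0) \<subseteq> univ N" using aN le_univ[OF N0N] by blast
  from LS_lam[OF K_cardD(1)[OF N] K1_lam[OF N] this card_insert_lam[OF K_cardD(2)[OF N0(1)]]]
  obtain S where S: "S \<in> K0" "S \<preceq> N" "a \<in> univ S" "univ N0 \<subseteq> univ S" by blast
  have N0S: "N0 \<preceq> S" by (rule le_within[OF N0N S(2,4)])
  have SR: "|univ S| \<le>o R" by (rule ordLeq_transitive[OF K_cardD(2)[OF S(1)] lam_le_R])
  \<comment> \<open>The realization is moved to a copy that meets \<open>M\<close> only in
    \<open>N0\<close>, since \<open>NF_extension\<close> asks for disjointness over the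
    base.\<close>
  obtain h T where h: "is_iso V h S T" "N0 \<preceq> T" "\<And>x. x \<in> univ N0 \<Longrightarrow> h x = x"
    "univ T \<inter> univ M \<subseteq> univ N0"
    by (rule embedding_inclusion[OF embedding_id[OF N0S] SR K_cardD(2)[OF M]]) auto
  have TK: "T \<in> K0" by (rule iso_card[OF h(1) S(1)])
  define b where "b = h a"
  have bT: "b \<in> univ T" unfolding b_def is_iso_univ[OF h(1)] using S(3) by blast
  \<comment> \<open>An element of the copy in \<open>M\<close> is in \<open>N0\<close>, which
    \<open>h\<close> fixes; injectivity would then force \<open>b = a\<close>, although
    \<open>a\<close> is outside \<open>M\<close>.\<close>
  have bM: "b \<notin> univ M"
  proof
    assume "b \<in> univ M"
    then have bN0: "b \<in> univ N0" using h(4) bT by blast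
    then have "h b = h a" using h(3) b_def by simp
    moreover have "b \<in> univ S" using bN0 S(4) by blast
    ultimately have "b = a" using is_iso_inj[OF h(1)] S(3) unfolding inj_on_def by blast
    then show False using bN0 aN le_univ[OF N0M] by blast
  qed
  have tpb: "tp K b N0 T = tp K a N0 N"
  proof -
    have "tp K b N0 T = tp K a N0 S"
      unfolding b_def
      by (rule tp_embedding[OF N0S h(2) embedding_of_iso[OF h(1) K_cardD(1)[OF TK]] h(3) S(3)])
    also have "\<dots> = tp K a N0 N" by (rule tp_mono[OF N0S S(2,3), symmetric])
    finally show ?thesis .
  qed
  \<comment> \<open>The third conjunct keeps the construction going: no element added so far may
    belong to a later part of \<open>M\<close>. The clause with \<open>os j = i\<close> expresses
    the successor step by quantifying over the predecessor.\<close>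
  define P where "P B i X \<longleftrightarrow> X \<in> K0 \<and> A i \<preceq> X \<and> univ X \<inter> univ M \<subseteq> univ (A i) \<and>
     (i = oz \<longrightarrow> X = T) \<and> (\<forall>j. j \<sqsubset> i \<longrightarrow> B j \<preceq> X) \<and>
     (\<forall>j. j \<sqsubset> i \<longrightarrow> os j = i \<longrightarrow> NF (A j) (B j) (A i) X) \<and>
     (is_limit R i \<longrightarrow> univ X \<subseteq> (\<Union>j\<in>{j. j \<sqsubset> i}. univ (B j)))"
    for B :: "'c set \<Rightarrow> ('a, 'f, 'r) struct" and i X
  have "\<exists>B. \<forall>i\<in>ord. P B i (B i)"
  proof (rule ord_recursion)
    show "P f i X = P g i X" if "\<And>z. z \<sqsubset> i \<Longrightarrow> f z = g z" for i f g X
      using that unfolding P_def by simp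
    fix i B assume io: "i \<in> ord" and IH: "\<And>j. j \<sqsubset> i \<Longrightarrow> P B j (B j)"
    have BK: "B j \<in> K0" "A j \<preceq> B j" "univ (B j) \<inter> univ M \<subseteq> univ (A j)" if "j \<sqsubset> i" for j
      using IH[OF that] unfolding P_def by blast+
    have BB: "B k \<preceq> B j" if "k \<sqsubseteq> j" "j \<sqsubset> i" for j k
    proof (cases "k = j")
      case True then show ?thesis using le_refl[OF K_cardD(1)[OF BK(1)[OF that(2)]]] by simp
    next
      case False then show ?thesis using IH[OF that(2)] that(1) unfolding P_def ilt_iff by blast
    qed
    from io show "\<exists>X. P B i X"
    proof (cases rule: ord_cases)
      case zero
      have "os j \<noteq> oz" if "j \<sqsubset> oz" for j using that by simp
      then have "P B i T"
        unfolding P_def using zero TK h(2,4) A(2) oz_not_limit by simp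
      then show ?thesis by blast
    next
      case (suc j)
      have ji: "j \<sqsubset> i" using lt_os[OF suc(1)] suc(2) by simp
      have AA: "A j \<preceq> A i" by (rule filt_mono[OF A(1) ilt_imp_ile[OF ji]])
      have AiM: "A i \<preceq> M" by (rule filt_le[OF A(1) io])
      have "univ (B j) \<inter> univ (A i) = univ (A j)"
        using le_univ[OF AA] le_univ[OF BK(2)[OF ji]] BK(3)[OF ji] le_univ[OF AiM] by blast
      then obtain Y where Y: "NF (A j) (B j) (A i) Y"
        using NF_extension[of "A j" "B j" "A i"] filt_K0[OF A(1) suc(1)] filt_K0[OF A(1) io] BK[OF ji] AA
        by auto
      let ?Z = "univ (B j) \<union> univ (A i)"
      have Z: "?Z \<subseteq> univ Y" using le_univ[OF NF_le(3)[OF Y]] le_univ[OF NF_le(4)[OF Y]] by blast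
      have YR: "|univ Y| \<le>o R" by (rule ordLeq_transitive[OF K_cardD(2)[OF NF_le(9)[OF Y]] lam_le_R])
      \<comment> \<open>\<open>NF_extension\<close> does not control where the new elements of
        \<open>Y\<close> lie. They are renamed outside \<open>M\<close>, while the two given models
        stay fixed.\<close>
      obtain k where k: "inj_on k (univ Y)" "\<forall>z\<in>?Z. k z = id z" "k ` (univ Y - ?Z) \<inter> univ M = {}"
        using fresh_injection[OF YR K_cardD(2)[OF M] Z inj_on_id] by blast
      have iso: "is_iso V k Y (img V k Y)"
        by (rule is_iso_img[OF models_struct[OF K_cardD(1)[OF NF_le(9)[OF Y]]] k(1)])
      have sub: "A j \<preceq> Y" by (rule le_trans[OF NF_le(1) NF_le(3)]; rule Y)
      have fixd: "img V k Q = Q" if "Q \<preceq> Y" "univ Q \<subseteq> ?Z" for Q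
        by (rule img_fixed) (use that k(2) models_struct le_models in auto)
      have f: "img V k (A j) = A j" "img V k (B j) = B j" "img V k (A i) = A i"
        using fixd[OF sub] fixd[OF NF_le(3)[OF Y]] fixd[OF NF_le(4)[OF Y]] le_univ[OF AA] by auto
      have nf: "NF (A j) (B j) (A i) (img V k Y)"
        using NF_iso[OF Y iso_le[OF iso sub] iso_le[OF iso NF_le(3)[OF Y]] iso_le[OF iso NF_le(4)[OF Y]] iso] f
        by simp
      have "univ (img V k Y) \<inter> univ M \<subseteq> univ (A i)"
      proof
        fix y assume y: "y \<in> univ (img V k Y) \<inter> univ M"
        then obtain x where x: "x \<in> univ Y" "y = k x" by auto
        then have xZ: "x \<in> ?Z" using k(3) y by blast
        then have "y = x" using k(2) x(2) by simp
        then show "y \<in> univ (A i)" using xZ y BK(3)[OF ji] le_univ[OF AA] by blast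
      qed
      moreover have "B l \<preceq> img V k Y" if "l \<sqsubset> i" for l
        using le_trans[OF BB NF_le(3)[OF nf]] that ji lt_os_iff[OF suc(1)] suc(2) by simp
      moreover have "NF (A l) (B l) (A i) (img V k Y)" if "l \<sqsubset> i" "os l = i" for l
      proof -
        have "l = j" using that suc os_inject ilt_ord(1) by metis
        then show ?thesis using nf by simp
      qed
      moreover have "\<not> is_limit R i" using os_not_limit[OF suc(1)] suc(2) by simp
      moreover have "i \<noteq> oz" using os_ne_oz[OF suc(1)] suc(2) by simp
      ultimately have "P B i (img V k Y)"
        unfolding P_def using NF_le(4,9)[OF nf] by blast
      then show ?thesis by blast
    next
      case limit
      have nz: "i \<noteq> oz" using limit oz_not_limit by blast
      have ic: "inc_cont K R {j. j \<sqsubset> i} B"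
      proof (rule inc_contI)
        show "B k \<preceq> B j" if "j \<in> {j. j \<sqsubset> i}" "k \<sqsubseteq> j" for j k using BB that by simp
        show "univ (B j) \<subseteq> (\<Union>k\<in>{k. k \<sqsubset> j}. univ (B k))" if "j \<in> {j. j \<sqsubset> i}" "is_limit R j" for j
          using IH[of j] that unfolding P_def by blast
      qed (use ile_ilt_trans ilt_ord(1) in auto)
      have "\<forall>j. j \<sqsubset> i \<longrightarrow> B j \<in> K0" using BK(1) by blast
      from chain_K0[OF ic io nz this]
      obtain X where X: "X \<in> K0" "univ X = (\<Union>j\<in>{j. j \<sqsubset> i}. univ (B j))" "\<forall>j. j \<sqsubset> i \<longrightarrow> B j \<preceq> X"
        by blast
      have "A j \<preceq> X" if "j \<sqsubset> i" for j using le_trans[OF BK(2)[OF that]] X(3) that by blast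
      then have "A i \<preceq> X" by (rule filt_smooth[OF A(1) limit])
      moreover have "univ X \<inter> univ M \<subseteq> univ (A i)"
        using X(2) BK(3) le_univ[OF filt_mono[OF A(1) ilt_imp_ile]] by blast
      moreover have "os j \<noteq> i" if "j \<sqsubset> i" for j using limit_suc[OF limit that] by auto
      ultimately have "P B i X" unfolding P_def using X nz by blast
      then show ?thesis by blast
    qed
  qed
  then obtain B where B: "\<And>i. i \<in> ord \<Longrightarrow> P B i (B i)" by blast
  have BK: "B i \<in> K0" "A i \<preceq> B i" "univ (B i) \<inter> univ M \<subseteq> univ (A i)" if "i \<in> ord" for i
    using B[OF that] unfolding P_def by blast+
  have BT: "B oz = T" using B[OF oz_ord] unfolding P_def by blast
  have BB: "B k \<preceq> B j" if "k \<sqsubseteq> j" for j k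
  proof (cases "k = j")
    case True then show ?thesis using le_refl[OF K_cardD(1)[OF BK(1)[OF ile_ord(2)[OF that]]]] by simp
  next
    case False then show ?thesis using B[OF ile_ord(2)[OF that]] that unfolding P_def ilt_iff by blast
  qed
  have Blim: "univ (B j) \<subseteq> (\<Union>k\<in>{k. k \<sqsubset> j}. univ (B k))" if "is_limit R j" for j
    using B[OF limit_ord[OF that]] that unfolding P_def by blast
  have BNF: "NF (A i) (B i) (A (os i)) (B (os i))" if "i \<in> ord" for i
    using B[OF os_ord[OF that]] lt_os[OF that] unfolding P_def by blast
  have "inc_cont K R ord B"
    by (rule inc_contI[OF _ _ BB Blim]) (auto simp: ile_ord(1))
  from chain_limit_ord[OF this]
  obtain M' where M': "M' \<in> models K" "univ M' = (\<Union>i\<in>ord. univ (B i))" "\<forall>i\<in>ord. B i \<preceq> M'"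
    by blast
  have "inc_cont K R ord A" using A(1) unfolding is_filtration_def by blast
  from chain_limit_ord[OF this]
  obtain U where U: "univ U = (\<Union>i\<in>ord. univ (A i))" "\<forall>N. (\<forall>i\<in>ord. A i \<preceq> N) \<longrightarrow> U \<preceq> N"
    by blast
  \<comment> \<open>\<open>M\<close> is itself the union of its levels, so smoothness turns
    \<open>A i \<preceq> M'\<close> for all \<open>i\<close> into
    \<open>M \<preceq> M'\<close>.\<close>
  have "U \<preceq> M" using U(2) filt_le[OF A(1)] by blast
  then have "U = M" by (rule le_antisym) (simp add: U(1) filt_union[OF A(1)])
  moreover have "A i \<preceq> M'" if "i \<in> ord" for i using le_trans[OF BK(2)[OF that]] M'(3) that by blast
  ultimately have MM': "M \<preceq> M'" using U(2) by blast
  have "|univ M'| \<le>o R"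
    unfolding M'(2) by (rule card_UN_R[OF order_refl ordLeq_transitive[OF K_cardD(2)[OF BK(1)] lam_le_R]])
  then have M'K: "M' \<in> K1"
    by (rule K_cardI[OF M'(1) _ ordLeq_transitive[OF K_cardD(3)[OF M] card_of_mono1[OF le_univ[OF MM']]]])
  have fB: "is_filtration K lam B M'"
  proof (rule filtrationI)
    show "univ (B i) \<subseteq> univ (B j)" if "i \<sqsubset> j" for i j by (rule le_univ[OF BB[OF ilt_imp_ile[OF that]]])
  qed (use BK(1) M'(2,3) Blim in auto)
  have pair: "NF (A i) (B i) (A j) (B j)" if "i \<sqsubseteq> j" for i j
    by (rule NF_filtration_pair[OF A(1) fB BNF that])
  have le: "leNF M M'"
    by (rule le_NF_clubI[OF M M'K MM' A(1) fB club_limit pair[OF ilt_imp_ile]])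
  have bM': "b \<in> univ M' - univ M" using bT BT M'(2) bM by force
  have "nf (tp K b (A i) M') (A oz) (A i)" if "oz \<sqsubseteq> i" for i
  proof -
    note io = ile_ord(2)[OF that]
    have "tp K b N0 T \<in> Sbs N0" using N0(3)[OF N0(1) N0r N0M] tpb by simp
    moreover have "b \<in> univ (B oz) - univ (A oz)" using bT BT bM A(2) le_univ[OF N0M] by auto
    ultimately have "nf (tp K b (A i) (B i)) (A oz) (A i)"
      using NF_respects_frame[OF pair[OF that], of b] A(2) BT by simp
    moreover have "tp K b (A i) M' = tp K b (A i) (B i)"
    proof (rule tp_mono[OF BK(2)[OF io]])
      show "B i \<preceq> M'" using M'(3) io by blast
      show "b \<in> univ (B i)" using bT BT le_univ[OF BB[OF that]] by auto
    qed
    ultimately show ?thesis by simp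
  qed
  from large_nfI[OF A(1) MM' bM' oz_ord this]
  have 1: "large_nf b N0 M M'" unfolding A(2) by blast
  have 2: "large_nf a N0 M N"
    unfolding nf_large_def using N0 N0r N0M MN aN K_cardD(3)[OF N0(1)] by blast
  have TM': "T \<preceq> M'" using M'(3) oz_ord BT by metis
  have 3: "tp K b N0 M' = tp K a N0 N" using tp_mono[OF h(2) TM' bT] tpb by simp
  have "tp K b M M' = tp K a M N"
    using tame[unfolded tame_nonforking_def, rule_format, OF M M'K N bM' aN MM' MN]
      N0(1) N0M 1 2 3 by blast
  then show ?thesis using le bM' by blast
qed

text \<open>Passing to a copy of the amalgam that includes \<open>N\<close> makes \<open>a\<close>
  itself, rather than an image of it, an element of the extension of \<open>X\<close>. The composed
  map fixes \<open>X\<close>, so \<open>le_NF_iso\<close> carries the relation over.\<close>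

lemma capture_element:
  assumes X: "X \<in> K1" and N: "N \<in> K1" and XN: "X \<preceq> N" and large: "large_nf a M0 X N"
  shows "\<exists>X' N'. leNF X X' \<and> N' \<in> K1 \<and> X' \<preceq> N' \<and> N \<preceq> N' \<and> a \<in> univ X'"
proof -
  obtain Y b where Y: "leNF X Y" "b \<in> univ Y" "tp K b X Y = tp K a X N"
    using realize_nonforking_type[OF X N XN large] by blast
  have aN: "a \<in> univ N" using large unfolding nf_large_def by blast
  note YK = le_NF_D[OF Y(1)]
  obtain P f1 f2 where P: "P \<in> K1" "is_embedding K f1 Y P" "is_embedding K f2 N P"
    "\<forall>x\<in>univ X. f1 x = x \<and> f2 x = x" "f1 b = f2 a"
    using tp_eq_amalgamation[OF amalgamation_R X YK(2) N YK(3) XN Y(2) aN Y(3)] by blast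
  have e: "|{} :: 'a set| \<le>o R" by (rule card_of_empty1) (simp add: R_wo)
  obtain h N' where h: "is_iso V h P N'" "N \<preceq> N'" "\<And>x. x \<in> univ N \<Longrightarrow> h (f2 x) = x"
    by (rule embedding_inclusion[OF P(3) K_cardD(2)[OF P(1)] e]) blast
  have N'K: "N' \<in> K1" by (rule iso_card[OF h(1) P(1)])
  have em: "is_embedding K (h \<circ> f1) Y N'"
    by (rule embedding_comp[OF P(2) embedding_of_iso[OF h(1) K_cardD(1)[OF N'K]]])
  have "(h \<circ> f1) x = x" if "x \<in> univ X" for x
    using P(4) h(3)[of x] le_univ[OF XN] that by auto
  then have "leNF X (img V (h \<circ> f1) Y)" by (rule le_NF_iso[OF Y(1) embedding_iso[OF em]])
  moreover have "a \<in> univ (img V (h \<circ> f1) Y)"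
  proof -
    have "(h \<circ> f1) b = a" using P(5) h(3)[OF aN] by simp
    then show ?thesis using Y(2) by force
  qed
  ultimately show ?thesis using N'K embedding_img[OF em] h(2) by blast
qed

text \<open>The step from \<open>j\<close> to \<open>j + 1\<close> captures, if possible, the element of an earlier \<open>N\<^sub>k\<close> that
  bookkeeping assigns to stage \<open>j\<close>; at the end nothing is left to capture, so the two unions agree.\<close>

lemma le_imp_le_NF:
  assumes M: "M \<in> K1" and M': "M' \<in> K1" and MM': "M \<preceq> M'"
  shows "leNF M M'"
proof -
  obtain pr :: "'c set \<Rightarrow> 'c set \<times> 'c set" where
    pr: "\<And>i x. i \<in> ord \<Longrightarrow> x \<in> ord \<Longrightarrow> \<exists>j\<in>ord. i \<sqsubseteq> j \<and> pr j = (i, x)"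
    using bookkeeping by blast
  have "\<exists>e. univ N \<subseteq> e ` ord" if N: "N \<in> K1" for N
  proof -
    have "|univ N| \<le>o |ord|"
      by (rule ordLeq_ordIso_trans[OF K_cardD(2)[OF N] ordIso_symmetric[OF card_of_Field_ordIso[OF R_card]]])
    moreover have "univ N \<noteq> {}"
      using models_struct[OF K_cardD(1)[OF N]] by (simp add: is_struct_def)
    ultimately show ?thesis using card_of_ordLeq2[of "univ N" ord] by auto
  qed
  then have "\<forall>N\<in>K1. \<exists>e. univ N \<subseteq> e ` ord" by blast
  then obtain en :: "('a, 'f, 'r) struct \<Rightarrow> 'c set \<Rightarrow> 'a" where en: "\<forall>N\<in>K1. univ N \<subseteq> en N ` ord"
    by (rule bchoice[THEN exE])
  define target where "target F j = en (snd (F (fst (pr j)))) (snd (pr j))"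
    for F :: "'c set \<Rightarrow> ('a, 'f, 'r) struct \<times> ('a, 'f, 'r) struct" and j
  \<comment> \<open>Capturing is demanded only of elements of non-forking type; otherwise
    \<open>Y = X\<close> will do, by reflexivity.\<close>
  define step where "step X N a Y \<longleftrightarrow> leNF X Y \<and>
      ((\<exists>M0\<in>K0. large_nf a M0 X N) \<longrightarrow> a \<in> univ Y)" for X N a Y
  \<comment> \<open>\<open>target F j\<close> looks up stage \<open>fst (pr j)\<close>. The guard
    \<open>fst (pr j) \<sqsubseteq> j\<close> ensures that this stage has been built, so that
    \<open>P\<close> depends on earlier values only, as the recursion demands.\<close>
  define P where "P F i Z \<longleftrightarrow> fst Z \<in> K1 \<and> snd Z \<in> K1 \<and> fst Z \<preceq> snd Z \<and> (i = oz \<longrightarrow> Z = (M, M')) \<and>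
     (\<forall>j. j \<sqsubset> i \<longrightarrow> fst (F j) \<preceq> fst Z \<and> snd (F j) \<preceq> snd Z) \<and>
     (\<forall>j. j \<sqsubset> i \<longrightarrow> os j = i \<longrightarrow> fst (pr j) \<sqsubseteq> j \<longrightarrow> step (fst (F j)) (snd (F j)) (target F j) (fst Z)) \<and>
     (\<forall>j. j \<sqsubset> i \<longrightarrow> os j = i \<longrightarrow> leNF (fst (F j)) (fst Z)) \<and>
     (is_limit R i \<longrightarrow> univ (fst Z) \<subseteq> (\<Union>j\<in>{j. j \<sqsubset> i}. univ (fst (F j))) \<and>
        univ (snd Z) \<subseteq> (\<Union>j\<in>{j. j \<sqsubset> i}. univ (snd (F j))))"
    for F i and Z :: "('a, 'f, 'r) struct \<times> ('a, 'f, 'r) struct"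
  have "\<exists>F. \<forall>i\<in>ord. P F i (F i)"
  proof (rule ord_recursion)
    show "P f i Z = P g i Z" if eq: "\<And>z. z \<sqsubset> i \<Longrightarrow> f z = g z" for i f g Z
    proof -
      have t: "target f j = target g j" if "j \<sqsubset> i" "fst (pr j) \<sqsubseteq> j" for j
        using eq[OF ile_ilt_trans[OF that(2,1)]] by (simp add: target_def)
      show ?thesis unfolding P_def using eq t by (simp cong: conj_cong)
    qed
    fix i F assume io: "i \<in> ord" and IH: "\<And>j. j \<sqsubset> i \<Longrightarrow> P F j (F j)"
    have FK: "fst (F j) \<in> K1" "snd (F j) \<in> K1" "fst (F j) \<preceq> snd (F j)" if "j \<sqsubset> i" for j
      using IH[OF that] unfolding P_def by blast+
    have FF: "fst (F k) \<preceq> fst (F j) \<and> snd (F k) \<preceq> snd (F j)" if "k \<sqsubseteq> j" "j \<sqsubset> i" for j k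
    proof (cases "k = j")
      case True
      then show ?thesis using le_refl[OF K_cardD(1)] FK[OF that(2)] by blast
    next
      case False then show ?thesis using IH[OF that(2)] that(1) unfolding P_def ilt_iff by blast
    qed
    from io show "\<exists>Z. P F i Z"
    proof (cases rule: ord_cases)
      case zero
      then have "P F i (M, M')"
        unfolding P_def using M M' MM' oz_not_limit by simp
      then show ?thesis by blast
    next
      case (suc j)
      have ji: "j \<sqsubset> i" using lt_os[OF suc(1)] suc(2) by simp
      let ?X = "fst (F j)" and ?N = "snd (F j)" and ?a = "target F j"
      have "\<exists>Y N. step ?X ?N ?a Y \<and> N \<in> K1 \<and> Y \<preceq> N \<and> ?N \<preceq> N"
      proof (cases "\<exists>M0\<in>K0. large_nf ?a M0 ?X ?N")
        case True
        then obtain M0 where "large_nf ?a M0 ?X ?N" by blast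
        from capture_element[OF FK[OF ji] this] show ?thesis unfolding step_def by blast
      next
        case False
        then have "step ?X ?N ?a ?X" unfolding step_def using le_NF_refl[OF FK(1)[OF ji]] by blast
        then show ?thesis using FK[OF ji] le_refl[OF K_cardD(1)[OF FK(2)[OF ji]]] by blast
      qed
      then obtain Y N where Y: "step ?X ?N ?a Y" "N \<in> K1" "Y \<preceq> N" "?N \<preceq> N" by blast
      have le: "leNF ?X Y" using Y(1) unfolding step_def by blast
      have l: "l = j" if "l \<sqsubset> i" "os l = i" for l
        using os_inject[OF ilt_ord(1)[OF that(1)] suc(1)] that suc(2) by simp
      have "fst (F l) \<preceq> Y \<and> snd (F l) \<preceq> N" if "l \<sqsubset> i" for l
      proof -
        have "l \<sqsubseteq> j" using that lt_os_iff[OF suc(1)] suc(2) by simp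
        then have "fst (F l) \<preceq> ?X" "snd (F l) \<preceq> ?N" using FF ji by blast+
        then show ?thesis using le_trans le_NF_D(3)[OF le] Y(4) by blast
      qed
      moreover have "\<not> is_limit R i" using os_not_limit[OF suc(1)] suc(2) by simp
      moreover have "i \<noteq> oz" using os_ne_oz[OF suc(1)] suc(2) by simp
      ultimately have "P F i (Y, N)"
        unfolding P_def fst_conv snd_conv using Y le le_NF_D(2)[OF le] l by blast
      then show ?thesis by blast
    next
      case limit
      let ?I = "{j. j \<sqsubset> i}"
      have I: "\<And>k j. j \<in> ?I \<Longrightarrow> k \<sqsubseteq> j \<Longrightarrow> k \<in> ?I" "?I \<subseteq> ord" "oz \<in> ?I"
      proof -
        show "k \<in> ?I" if "j \<in> ?I" "k \<sqsubseteq> j" for k j using ile_ilt_trans[OF that(2)] that(1) by simp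
        show "?I \<subseteq> ord" using ilt_ord(1) by blast
        show "oz \<in> ?I" using limit_pos[OF limit] by simp
      qed
      have lim: "univ (fst (F j)) \<subseteq> (\<Union>k\<in>{k. k \<sqsubset> j}. univ (fst (F k)))"
        "univ (snd (F j)) \<subseteq> (\<Union>k\<in>{k. k \<sqsubset> j}. univ (snd (F k)))" if "j \<in> ?I" "is_limit R j" for j
        using IH[of j] that unfolding P_def by blast+
      have icX: "inc_cont K R ?I (\<lambda>j. fst (F j))"
      proof (rule inc_contI)
        show "fst (F k) \<preceq> fst (F j)" if "j \<in> ?I" "k \<sqsubseteq> j" for k j using FF[OF that(2)] that(1) by simp
      qed (use I(1,2) lim(1) in simp_all)
      have "\<exists>U\<in>K1. univ U = (\<Union>j\<in>?I. univ (fst (F j))) \<and> (\<forall>j\<in>?I. fst (F j) \<preceq> U) \<and>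
          (\<forall>N. (\<forall>j\<in>?I. fst (F j) \<preceq> N) \<longrightarrow> U \<preceq> N)"
      proof (rule chain_K1[OF icX _ I(2,3)])
        show "k \<in> ?I" if "j \<in> ?I" "k \<sqsubseteq> j" for k j by (rule I(1)[OF that])
        show "fst (F j) \<in> K1" if "j \<in> ?I" for j using FK(1) that by simp
      qed
      then obtain Y where Y: "Y \<in> K1" "univ Y = (\<Union>j\<in>?I. univ (fst (F j)))" "\<forall>j\<in>?I. fst (F j) \<preceq> Y"
          "\<forall>N. (\<forall>j\<in>?I. fst (F j) \<preceq> N) \<longrightarrow> Y \<preceq> N" by blast
      have icN: "inc_cont K R ?I (\<lambda>j. snd (F j))"
      proof (rule inc_contI)
        show "snd (F k) \<preceq> snd (F j)" if "j \<in> ?I" "k \<sqsubseteq> j" for k j using FF[OF that(2)] that(1) by simp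
      qed (use I(1,2) lim(2) in simp_all)
      have "\<exists>U\<in>K1. univ U = (\<Union>j\<in>?I. univ (snd (F j))) \<and> (\<forall>j\<in>?I. snd (F j) \<preceq> U) \<and>
          (\<forall>N. (\<forall>j\<in>?I. snd (F j) \<preceq> N) \<longrightarrow> U \<preceq> N)"
      proof (rule chain_K1[OF icN _ I(2,3)])
        show "k \<in> ?I" if "j \<in> ?I" "k \<sqsubseteq> j" for k j by (rule I(1)[OF that])
        show "snd (F j) \<in> K1" if "j \<in> ?I" for j using FK(2) that by simp
      qed
      then obtain N where N: "N \<in> K1" "univ N = (\<Union>j\<in>?I. univ (snd (F j)))" "\<forall>j\<in>?I. snd (F j) \<preceq> N"
        by blast
      have "\<forall>j\<in>?I. fst (F j) \<preceq> N" using le_trans[OF FK(3)] N(3) by blast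
      then have "Y \<preceq> N" using Y(4) by blast
      moreover have "os j \<noteq> i" if "j \<sqsubset> i" for j using limit_suc[OF limit that] by auto
      moreover have "i \<noteq> oz" using limit oz_not_limit by blast
      ultimately have "P F i (Y, N)" unfolding P_def fst_conv snd_conv using Y(1,2,3) N by blast
      then show ?thesis by blast
    qed
  qed
  then obtain F where F: "\<And>i. i \<in> ord \<Longrightarrow> P F i (F i)" by blast
  define X where "X i = fst (F i)" for i
  define N where "N i = snd (F i)" for i
  have XK: "X i \<in> K1" and NK: "N i \<in> K1" and XN: "X i \<preceq> N i" if "i \<in> ord" for i
    using F[OF that] unfolding P_def X_def N_def by blast+
  have z: "X oz = M" "N oz = M'" using F[OF oz_ord] unfolding P_def X_def N_def by simp_all
  have XX: "X k \<preceq> X j" and NN: "N k \<preceq> N j" if "k \<sqsubseteq> j" for j k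
  proof -
    have "X k \<preceq> X j \<and> N k \<preceq> N j"
    proof (cases "k = j")
      case True
      then show ?thesis
        using le_refl[OF K_cardD(1)[OF XK[OF ile_ord(2)[OF that]]]]
          le_refl[OF K_cardD(1)[OF NK[OF ile_ord(2)[OF that]]]] by simp
    next
      case False
      then have "k \<sqsubset> j" using that by (simp add: ilt_iff)
      moreover have "\<forall>l. l \<sqsubset> j \<longrightarrow> fst (F l) \<preceq> fst (F j) \<and> snd (F l) \<preceq> snd (F j)"
        using F[OF ile_ord(2)[OF that]] unfolding P_def by blast
      ultimately show ?thesis unfolding X_def N_def by blast
    qed
    then show "X k \<preceq> X j" "N k \<preceq> N j" by blast+
  qed
  have lim: "univ (X j) \<subseteq> (\<Union>k\<in>{k. k \<sqsubset> j}. univ (X k))" "univ (N j) \<subseteq> (\<Union>k\<in>{k. k \<sqsubset> j}. univ (N k))"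
    if "is_limit R j" for j using F[OF limit_ord[OF that]] that unfolding P_def X_def N_def by blast+
  have leNF: "leNF (X i) (X (os i))" if "i \<in> ord" for i
    using F[OF os_ord[OF that]] lt_os[OF that] unfolding P_def X_def by blast
  have st: "step (X i) (N i) (target F i) (X (os i))" if "i \<in> ord" "fst (pr i) \<sqsubseteq> i" for i
    using F[OF os_ord[OF that(1)]] lt_os[OF that(1)] that(2) unfolding P_def X_def N_def by blast
  have I: "\<And>k j. j \<in> ord \<Longrightarrow> k \<sqsubseteq> j \<Longrightarrow> k \<in> ord" by (rule ile_ord(1))
  have icX: "inc_cont K R ord X" by (rule inc_contI[OF _ order_refl XX lim(1)]) (rule I)
  have icN: "inc_cont K R ord N" by (rule inc_contI[OF _ order_refl NN lim(2)]) (rule I)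
  have "\<exists>U\<in>K1. univ U = (\<Union>i\<in>ord. univ (X i)) \<and> (\<forall>i\<in>ord. X i \<preceq> U) \<and> (\<forall>N. (\<forall>i\<in>ord. X i \<preceq> N) \<longrightarrow> U \<preceq> N)"
    by (rule chain_K1[OF icX _ order_refl oz_ord XK]) (rule I)
  then obtain X' where X': "X' \<in> K1" "univ X' = (\<Union>i\<in>ord. univ (X i))" "\<forall>i\<in>ord. X i \<preceq> X'"
    "\<forall>N. (\<forall>i\<in>ord. X i \<preceq> N) \<longrightarrow> X' \<preceq> N" by blast
  have "\<exists>U\<in>K1. univ U = (\<Union>i\<in>ord. univ (N i)) \<and> (\<forall>i\<in>ord. N i \<preceq> U) \<and> (\<forall>P. (\<forall>i\<in>ord. N i \<preceq> P) \<longrightarrow> U \<preceq> P)"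
    by (rule chain_K1[OF icN _ order_refl oz_ord NK]) (rule I)
  then obtain N' where N': "N' \<in> K1" "univ N' = (\<Union>i\<in>ord. univ (N i))" "\<forall>i\<in>ord. N i \<preceq> N'" by blast
  have "\<forall>i\<in>ord. X i \<preceq> N'" using le_trans[OF XN] N'(3) by blast
  then have X'N': "X' \<preceq> N'" using X'(4) by blast
  have "X' = N'"
  proof (rule ccontr)
    assume "X' \<noteq> N'"
    then obtain a M0 where a: "a \<in> univ N' - univ X'" and M0: "M0 \<in> K0" "M0 \<preceq> X'" "large_nf a M0 X' N'"
      using density_R[OF X'(1) N'(1) X'N'] by blast
    obtain k where k: "k \<in> ord" "a \<in> univ (N k)" using a N'(2) by blast
    have "\<forall>x\<in>univ M0. \<exists>i. i \<in> ord \<and> x \<in> univ (X i)" using X'(2) le_univ[OF M0(2)] by blast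
    then obtain p where p: "\<forall>x\<in>univ M0. p x \<in> ord \<and> x \<in> univ (X (p x))" by (rule bchoice[THEN exE])
    have "insert k (p ` univ M0) \<subseteq> ord" using k p by blast
    \<comment> \<open>The base \<open>M0\<close> has only \<open>lam\<close> many elements, so some
      stage \<open>i\<close> has all of them in \<open>X i\<close> and \<open>a\<close> in
      \<open>N i\<close>; from there on \<open>a\<close> is a legitimate target.\<close>
    from ord_bounded[OF this card_insert_lam[OF card_image_lam[OF K_cardD(2)[OF M0(1)]]]]
    obtain i where i: "i \<in> ord" "k \<sqsubset> i" "\<And>x. x \<in> univ M0 \<Longrightarrow> p x \<sqsubset> i" by blast
    have aNi: "a \<in> univ (N i)" using k(2) le_univ[OF NN[OF ilt_imp_ile[OF i(2)]]] by blast
    then obtain x where x: "x \<in> ord" "a = en (N i) x" using en NK[OF i(1)] by blast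
    \<comment> \<open>Bookkeeping returns to \<open>a\<close> at some \<open>j\<close> not before
      \<open>i\<close>. The type of \<open>a\<close> restricts to a non-forking type over
      \<open>X j\<close>, so \<open>a\<close> enters \<open>X (os j)\<close>, against its choice
      outside the union.\<close>
    obtain j where j: "j \<in> ord" "i \<sqsubseteq> j" "pr j = (i, x)" using pr[OF i(1) x(1)] by blast
    have t: "target F j = a" unfolding target_def using j(3) x(2) by (simp add: N_def)
    have X'j: "X j \<preceq> X'" "N j \<preceq> N'" using X'(3) N'(3) j(1) by blast+
    have "univ M0 \<subseteq> univ (X j)"
    proof
      fix y assume y: "y \<in> univ M0"
      have "X (p y) \<preceq> X j" by (rule XX[OF ile_trans[OF ilt_imp_ile[OF i(3)[OF y]] j(2)]])
      then show "y \<in> univ (X j)" using p y le_univ by blast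
    qed
    then have "M0 \<preceq> X j" by (rule le_within[OF M0(2) X'j(1)])
    moreover have "a \<in> univ (N j) - univ (X j)"
      using aNi le_univ[OF NN[OF j(2)]] a le_univ[OF X'j(1)] by blast
    ultimately have "large_nf a M0 (X j) (N j)"
      by (rule large_nf_restrict[OF M0(3) _ X'j(1) XN[OF j(1)] X'j(2)])
    moreover have "step (X j) (N j) a (X (os j))" using st[OF j(1)] j(2,3) t by simp
    ultimately have "a \<in> univ (X (os j))" using M0(1) unfolding step_def by blast
    then show False using a X'(2) os_ord[OF j(1)] by blast
  qed
  have "leNF (X oz) X'"
    by (rule le_NF_chain[OF icX XK leNF X'(1)]) (simp_all add: X'(2,3))
  then have "leNF M X'" using z(1) by simp
  moreover have "M' \<preceq> X'" using N'(3) oz_ord z(2) \<open>X' = N'\<close> by metis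
  ultimately show ?thesis using le_NF_coherence[OF _ M' MM'] by blast
qed

end

theorem theorem7p8:
  fixes K :: "('a, 'f, 'r) aec"
    and lam :: "'c rel"
    and Sbs :: "('a, 'f, 'r) struct \<Rightarrow> ('a, 'f, 'r) gtype set"
    and nf :: "('a, 'f, 'r) gtype \<Rightarrow> ('a, 'f, 'r) struct \<Rightarrow> ('a, 'f, 'r) struct \<Rightarrow> bool"
    and NF :: "('a, 'f, 'r) struct \<Rightarrow> ('a, 'f, 'r) struct \<Rightarrow> ('a, 'f, 'r) struct \<Rightarrow>
               ('a, 'f, 'r) struct \<Rightarrow> bool"
    and M M' :: "('a, 'f, 'r) struct"
  assumes lam_infinite_cardinal: "Card_order lam" "infinite (Field lam)"
    and universe_large: "cardSuc lam <o |UNIV :: 'a set|"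
    and aec: "abstract_elementary_class K"
    and LST: "LST_le K lam"
    and categorical: "categorical K lam"
    and frame: "semi_good_frame K lam Sbs nf"
    and conjugation: "conjugation_property K lam Sbs nf"
    and existence: "uniqueness_triples_exist K lam Sbs nf"
    and amalgamation: "amalgamation_property K (cardSuc lam)"
    and tameness: "tame_nonforking K lam Sbs nf"
    and NF: "nonforking_amalgamation K lam Sbs nf NF"
    and models: "M \<in> models_card K (cardSuc lam)" "M' \<in> models_card K (cardSuc lam)"
  shows "M \<preceq>\<^bsub>K\<^esub> M' \<longleftrightarrow> le_NF K lam NF M M'"
proof
  interpret nonforking_setting K lam Sbs nf NF
    by (intro nonforking_setting.intro aec_succ.intro aec_succ_axioms.intro succ_card.intro
        nonforking_setting_axioms.intro) fact+
  show "le_NF K lam NF M M'" if "M \<preceq>\<^bsub>K\<^esub> M'" by (rule le_imp_le_NF[OF models that])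
qed (simp add: le_NF_def)

end
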